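(* Let $\mathbb F$ be an algebraically closed field. Let $H(s)\in\mathbb F[s]^{m\times n}$ be a matrix pencil with Weyr characteristic $(\mathbf W,\mathbf r_*,\mathbf s_* )$, and let $P(s)=u(s)v^T$ be a matrix pencil with $u(s)\in\mathbb F[s]^{m\times 1}$ and $v\in\mathbb F^{n\times 1}$. Let $(\widehat{\mathbf W},\widehat{\mathbf r}_*,\widehat{\mathbf s}_* )$ be the Weyr characteristic of $H(s)+P(s)$. Then: 1. If $\operatorname{rank}(H(s))=\operatorname{rank}(H(s)+P(s))$, then - $-1\le \widehat w_i(\lambda)-w_i(\lambda)\le 1$ for all $i\ge 1$, $\lambda\in\overline{\mathbb F}$; - if $\mathbf r=(0)$, then $0\le \widehat r_i-r_i\le 1$ for all $i\ge 0$; if $\mathbf r\ne(0)$, then $-\left[\sqrt{|\mathbf r_*|}\right]\le \widehat r_i-r_i\le \left[\sqrt{|\mathbf r_*|}\right]$ for all $i\ge 0$; - if $\mathbf s=(0)$, then $0\le \widehat s_i-s_i\le 2$ for all $i\ge 0$; if $\mathbf s\ne(0)$, then $-\left[\sqrt{|\mathbf s|}\right]-1\le \widehat s_i-s_i\le \left[\sqrt{|\mathbf s|-1}\right]+2$ for all $i\ge 0$. 2. If $\operatorname{rank}(H(s)+P(s))=\operatorname{rank}(H(s))-1$, then - $-2\le \widehat w_i(\lambda)-w_i(\lambda)\le 0$ for all $i\ge 1$, $\lambda\in\overline{\mathbb F}$; - $1-\left[\sqrt{|\mathbf r_*|+1}\right]\le \widehat r_i-r_i\le 1$ for all $i\ge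 0$; - $-\left[\sqrt{|\mathbf s|}\right]\le \widehat s_i-s_i\le 1$ for all $i\ge 0$. 3. If $\operatorname{rank}(H(s)+P(s))=\operatorname{rank}(H(s))+1$, then - $0\le \widehat w_i(\lambda)-w_i(\lambda)\le 2$ for all $i\ge 1$, $\lambda\in\overline{\mathbb F}$; - $-1\le \widehat r_i-r_i\le -1+\left[\sqrt{|\mathbf r_*|}\right]$ for all $i\ge 0$; - $-1\le \widehat s_i-s_i\le \left[\sqrt{|\mathbf s|+1}\right]$ for all $i\ge 0$.
   Context: Notation. $\overline{\mathbb F}=\mathbb F\cup\{\infty\}$; $[x]$ is the integer part of a real number $x$. A matrix pencil is a polynomial matrix $H(s)=H_0+sH_1\in\mathbb F[s]^{m\times n}$ of degree at most one; its rank is its normal rank (order of the largest minor that is not identically zero). Partitions. A partition is an infinite nonincreasing sequence of nonnegative integers, almost all zero; $|\mathbf a|$ is the sum of the components of $\mathbf a$; $(0)$ is the zero partition. The conjugate of a partition or finite nonincreasing sequence $\mathbf c=(c_1,c_2,\dots)$ of nonnegative integers is the partition $\overline{\mathbf c}=(r_1,r_2,\dots)$, $r_k=\#\{i:c_i\ge k\}$, $k\ge1$. For a partition written with a star and indexed from $0$, $\mathbf r_*=(r_0,r_1,r_2,\dots)$, one writes $\mathbf r=(r_1,r_2,\dots)$, so $|\mathbf r_*|=r_0+|\mathbf r|$. Weyr characteristic. Let $H(s)\in\mathbb F[s]^{m\times n}$ have rank $\rho$, homogeneous invariant factors $\pi_1(s,t)\mid\dots\mid\pi_\rho(s,t)$,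 column minimal indices $\mathbf c=(c_1\ge\dots\ge c_{n-\rho})$ and row minimal indices $\mathbf u=(u_1\ge\dots\ge u_{m-\rho})$ (the Kronecker invariants). The partial multiplicities $\mathbf z(\lambda)=(z_1(\lambda),z_2(\lambda),\dots)$ at $\lambda\in\overline{\mathbb F}$ are defined by $\pi_{\rho-i+1}(s,t)=t^{z_i(\infty)}\prod_{\lambda\in\mathbb F}(s-\lambda t)^{z_i(\lambda)}$ for $1\le i\le\rho$ (up to nonzero constants), and $z_i(\lambda)=0$ for $i>\rho$. The Weyr characteristic at $\lambda$ is $\mathbf w(\lambda)=\overline{\mathbf z(\lambda)}=(w_1(\lambda),w_2(\lambda),\dots)$. The Weyr characteristic of the regular part is the collection $\mathbf W$ of the $\mathbf w(\lambda)$ over the (finitely many) eigenvalues $\lambda\in\overline{\mathbb F}$ ($\mathbf w(\lambda)=(0)$ at all other $\lambda$). The column Brunovsky partition is $\mathbf r_*=(r_0,r_1,\dots)$ with $r_0=n-\rho$, $(r_1,r_2,\dots)=\overline{\mathbf c}$; the row Brunovsky partition is $\mathbf s_*=(s_0,s_1,\dots)$ with $s_0=m-\rho$, $(s_1,s_2,\dots)=\overline{\mathbf u}$. The Weyr characteristic of $H(s)$ is $(\mathbf W,\mathbf r_*,\mathbf s_* )$; decorated symbols ($\widehat w_i(\lambda)$, $\widehat r_i$, $\widehat s_i$) denote the components of the correspondingly decorated Weyr characteristic. *)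

theory Defs
  imports
    "Jordan_Normal_Form.DL_Submatrix"
    "Jordan_Normal_Form.Determinant"
    "Jordan_Normal_Form.Matrix_Kernel"
    "HOL-Computational_Algebra.Polynomial_Factorial"
    "HOL-Library.Multiset"
begin

section \<open>Matrix pencils and minors\<close>

definition matrix_pencil :: "nat \<Rightarrow> nat \<Rightarrow> 'a :: field poly mat \<Rightarrow> bool" where
  "matrix_pencil m n H \<longleftrightarrow>
     H \<in> carrier_mat m n \<and> (\<forall>i<m. \<forall>j<n. degree (H $$ (i, j)) \<le> 1)"

definition minors :: "nat \<Rightarrow> 'b :: comm_ring_1 mat \<Rightarrow> 'b set" where
  "minors k A = {det (submatrix A I J) | I J.
     I \<subseteq> {..<dim_row A} \<and> J \<subseteq> {..<dim_col A} \<and> card I = k \<and> card J = k}"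

text \<open>The minor of order 0 is 1, so the normal rank of a zero matrix is 0.\<close>

definition normal_rank :: "'b :: comm_ring_1 mat \<Rightarrow> nat" where
  "normal_rank A = Max {k. \<exists>d \<in> minors k A. d \<noteq> 0}"

section \<open>Homogeneous invariant factors and partial multiplicities\<close>

text \<open>
  The ring \<open>F[s,t]\<close> is represented by \<open>F[t][s]\<close>: in the type \<open>'a poly poly\<close> the outer variable
  is \<open>s\<close> and the inner one is \<open>t\<close>.  The pencil \<open>H\<^sub>0 + s H\<^sub>1\<close> has the homogenization
  \<open>t H\<^sub>0 + s H\<^sub>1\<close>.
\<close>

definition homogenize :: "'a :: field poly mat \<Rightarrow> 'a poly poly mat" where
  "homogenize H = map_mat (\<lambda>p. [: monom (coeff p 0) 1, [:coeff p 1:] :]) H"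

text \<open>
  Greatest common divisors are characterized by divisibility, since the library's \<open>gcd\<close> is
  available on polynomials only over types of class \<open>field_gcd\<close>.
\<close>

definition is_gcd_of :: "'b :: comm_semiring_1 set \<Rightarrow> 'b \<Rightarrow> bool" where
  "is_gcd_of S d \<longleftrightarrow> (\<forall>x\<in>S. d dvd x) \<and> (\<forall>e. (\<forall>x\<in>S. e dvd x) \<longrightarrow> e dvd d)"

text \<open>
  The determinantal divisors, hence the invariant factors, are determined up to nonzero
  constants, which do not affect the partial multiplicities.
\<close>

definition homog_det_divisor :: "'a :: field poly mat \<Rightarrow> nat \<Rightarrow> 'a poly poly" where
  "homog_det_divisor H k = (SOME d. is_gcd_of (minors k (homogenize H)) d)"

definition homog_inv_factor :: "'a :: field poly mat \<Rightarrow> nat \<Rightarrow> 'a poly poly" where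
  "homog_inv_factor H k = homog_det_divisor H k div homog_det_divisor H (k - 1)"

text \<open>The field with a point at infinity adjoined.\<close>

datatype 'a ext = Finite 'a | Infinity

text \<open>The linear form belonging to a point: \<open>s - \<mu> t\<close>, respectively \<open>t\<close>.\<close>

fun linear_form :: "'a :: field ext \<Rightarrow> 'a poly poly" where
  "linear_form (Finite \<mu>) = [: monom (- \<mu>) 1, 1 :]"
| "linear_form Infinity = [: monom 1 1 :]"

text \<open>
  \<open>part_mult H \<mu> i\<close> is \<open>z\<^sub>i(\<mu>)\<close>, the exponent of the prime \<open>linear_form \<mu>\<close> in the factorization
  of the nonzero form \<open>\<pi>\<^bsub>\<rho>-i+1\<^esub>\<close>; it is meaningful for \<open>i \<ge> 1\<close>.  The exponent is spelled out
  because \<open>multiplicity\<close> has class constraints that \<open>'a poly poly\<close> need not satisfy.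
\<close>

definition part_mult :: "'a :: field poly mat \<Rightarrow> 'a ext \<Rightarrow> nat \<Rightarrow> nat" where
  "part_mult H \<mu> i =
     (if i \<le> normal_rank H
      then GREATEST e. linear_form \<mu> ^ e dvd homog_inv_factor H (normal_rank H - i + 1)
      else 0)"

section \<open>Minimal indices\<close>

definition vec_degree :: "'a :: zero poly vec \<Rightarrow> nat" where
  "vec_degree x = Max (insert 0 ((\<lambda>i. degree (x $ i)) ` {..<dim_vec x}))"

text \<open>
  A set of polynomial vectors that is a basis of the right null space of \<open>H\<close> over the field of
  rational functions.
\<close>

definition polynomial_null_basis :: "'a :: field poly mat \<Rightarrow> 'a poly vec set \<Rightarrow> bool" where
  "polynomial_null_basis H X \<longleftrightarrow>
     finite X \<and> X \<subseteq> carrier_vec (dim_col H) \<and>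
     kernel.basis (dim_col H) (map_mat to_fract H) (map_vec to_fract ` X)"

definition minimal_null_basis :: "'a :: field poly mat \<Rightarrow> 'a poly vec set \<Rightarrow> bool" where
  "minimal_null_basis H X \<longleftrightarrow>
     polynomial_null_basis H X \<and>
     (\<forall>Y. polynomial_null_basis H Y \<longrightarrow> sum vec_degree X \<le> sum vec_degree Y)"

text \<open>
  All minimal bases have the same degrees, so the result does not depend on the choice.  The list
  is nonincreasing.
\<close>

definition col_min_indices :: "'a :: field poly mat \<Rightarrow> nat list" where
  "col_min_indices H =
     rev (sorted_list_of_multiset
       (image_mset vec_degree (mset_set (SOME X. minimal_null_basis H X))))"

definition row_min_indices :: "'a :: field poly mat \<Rightarrow> nat list" where
  "row_min_indices H = col_min_indices (transpose_mat H)"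

section \<open>Partitions and the Weyr characteristic\<close>

text \<open>
  The conjugate of a family \<open>c\<close> with index set \<open>I\<close>: \<open>{1..}\<close> for partitions,
  \<open>{..<length c}\<close> for lists.  The argument \<open>k\<close> is meant to be at least 1.
\<close>

definition conjugate :: "nat set \<Rightarrow> (nat \<Rightarrow> nat) \<Rightarrow> nat \<Rightarrow> nat" where
  "conjugate I c k = card {i \<in> I. c i \<ge> k}"

definition weyr :: "'a :: field poly mat \<Rightarrow> 'a ext \<Rightarrow> nat \<Rightarrow> nat" where
  "weyr H \<mu> = conjugate {1..} (part_mult H \<mu>)"

definition col_brunovsky :: "'a :: field poly mat \<Rightarrow> nat \<Rightarrow> nat" where
  "col_brunovsky H i =
     (if i = 0 then dim_col H - normal_rank H
      else conjugate {..<length (col_min_indices H)} ((!) (col_min_indices H)) i)"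

definition row_brunovsky :: "'a :: field poly mat \<Rightarrow> nat \<Rightarrow> nat" where
  "row_brunovsky H i =
     (if i = 0 then dim_row H - normal_rank H
      else conjugate {..<length (row_min_indices H)} ((!) (row_min_indices H)) i)"

definition weyr_characteristic ::
    "'a :: field poly mat \<Rightarrow> ('a ext \<Rightarrow> nat \<Rightarrow> nat) \<times> (nat \<Rightarrow> nat) \<times> (nat \<Rightarrow> nat)" where
  "weyr_characteristic H = (weyr H, col_brunovsky H, row_brunovsky H)"

text \<open>\<open>part_sum k a\<close> is the sum of the components \<open>a\<^sub>k, a\<^sub>k\<^sub>+\<^sub>1, \<dots>\<close>, almost all of which are zero.\<close>

definition part_sum :: "nat \<Rightarrow> (nat \<Rightarrow> nat) \<Rightarrow> nat" where
  "part_sum k a = (\<Sum>i | k \<le> i \<and> a i \<noteq> 0. a i)"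

end

theory Submission
  imports
    Defs
    "Berlekamp_Zassenhaus.Unique_Factorization_Poly"
    "HOL-Library.Function_Algebras"
begin

text \<open>
  The Weyr characteristic splits into three parts, and each is governed by one idea.

  Regular part. Let $p$ be the linear form of a point $\lambda$, and let $e_1 \le e_2 \le \dots \le
  e_\rho$ be the exponents of $p$ in the invariant factors. For $k \ge 1$ the number $N_k$ of
  exponents below $k$ is the least $q$ such that, up to a factor prime to $p$, the homogenized
  pencil is congruent modulo $p^k$ to a matrix that factors through dimension $q$
  (\<open>approximable_small_gaps\<close>, \<open>approximable_imp_small_gaps_le\<close>). Adding a rank-one matrix
  increases that dimension by at most one, so $N_k$ changes by at most one in either direction.
  Since $w_k(\lambda) = \rho - N_k$, the change of $w_k(\lambda)$ differs from the change of rank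
  by at most one, which gives the three ranges.

  Column part. As $v$ is constant, $H$ and $H + u v^T$ have the same null vectors inside the kernel
  of $v^T$. So both are compared with the pencil $G$ that has $v^T$ as an additional row. Let $r$
  and $g$ be the column Brunovsky partitions of $H$ and $G$. The space of polynomial null vectors
  of $H$ of degree below $K$ has dimension $\sum_{j<K} (r_0 - r_{j+1})$, because a minimal basis
  has the predictable degree property (\<open>dim_null_space\<close>). By rank and nullity, the difference of
  these dimensions for $H$ and $G$ is the dimension $E(K)$ of the image of the space under $v^T$.
  This image consists of polynomials of degree below $K$ and grows with $K$, so $0 \le E(K) \le K$
  and $E$ is monotone. Hence either $g = r$, or $g_0 = r_0 - 1$ and
  $g_k - r_k = E(k) - E(k-1) - 1 \ge -1$ with $|\mathbf g| \le |\mathbf r|$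
  (\<open>one_step_col_brunovsky\<close>).

  The square roots come from a counting argument. Put $\varepsilon = g_k - r_k + 1$. Then
  $\varepsilon \le k$ and $g_k \ge \varepsilon - 1$, and $g_1, \dots, g_k$ are all at least $g_k$, so
  $|\mathbf r| \ge |\mathbf g| \ge k g_k \ge \varepsilon (\varepsilon - 1)$; together with
  $r_0 = g_0 + 1 \ge \varepsilon$ this gives $\varepsilon^2 \le |\mathbf r_*|$. If the rank goes up,
  then $g$ is the new partition; if it goes down, then $g$ is the old one; if it stays the same and
  the partition changes, then both the old and the new one are related to $g$ in this way, and the
  change is the difference of two numbers $\varepsilon$.

  Row part. Transposition exchanges the roles of $u$ and $v$. As $u$ has degree at most one, the
  bound becomes $E(K) \le K + 1$, which accounts for the weaker inequalities.
\<close>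

section \<open>Minors over a domain with a prime\<close>

text \<open>
  Rows and columns are selected by index functions that need not be increasing or injective. This
  makes it possible to border a minor by one more row and column, and to delete one, without
  sorting; up to sign only the minors themselves and 0 arise (\<open>det_select_cases\<close>).
\<close>

definition select :: "'b mat \<Rightarrow> nat \<Rightarrow> (nat \<Rightarrow> nat) \<Rightarrow> (nat \<Rightarrow> nat) \<Rightarrow> 'b mat" where
  "select A k f g = mat k k (\<lambda>(a, b). A $$ (f a, g b))"

lemma select_carrier [simp]: "select A k f g \<in> carrier_mat k k"
  by (simp add: select_def)

lemma mat_delete_select:
  "mat_delete (select A (Suc k) f g) i j =
    select A k (\<lambda>a. f (if a < i then a else Suc a)) (\<lambda>b. g (if b < j then b else Suc b))"
  by (rule eq_matI) (auto simp: select_def mat_delete_def)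

lemma det_permute_cols:
  assumes A: "A \<in> carrier_mat n n" and q: "q permutes {0..<n}"
  shows "det (mat n n (\<lambda>(i, j). A $$ (i, q j))) = signof q * det A"
proof -
  have "mat n n (\<lambda>(i, j). A $$ (i, q j)) = transpose_mat (mat n n (\<lambda>(i, j). transpose_mat A $$ (q i, j)))"
    by (rule eq_matI) (use A permutes_in_image[OF q] in auto)
  then have "det (mat n n (\<lambda>(i, j). A $$ (i, q j))) = det (mat n n (\<lambda>(i, j). transpose_mat A $$ (q i, j)))"
    by (simp add: det_transpose[of _ n])
  also have "\<dots> = signof q * det (transpose_mat A)"
    by (rule det_permute_rows) (use A q in auto)
  finally show ?thesis by (simp add: det_transpose[OF A])
qed

lemma pick_permutation:
  assumes "inj_on f {..<k}"
  obtains \<pi> where "\<pi> permutes {0..<k}" "\<And>a. a < k \<Longrightarrow> f a = pick (f ` {..<k}) (\<pi> a)"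
proof -
  let ?I = "f ` {..<k}"
  have card: "card ?I = k" using assms by (simp add: card_image)
  have pk: "pick ?I (card {x \<in> ?I. x < f a}) = f a" if "a < k" for a
    by (rule pick_card_in_set) (use that in auto)
  have lt: "card {x \<in> ?I. x < f a} < k" if "a < k" for a
  proof -
    have "{x \<in> ?I. x < f a} \<subset> ?I" using that by auto
    then show ?thesis using psubset_card_mono[of ?I] card by auto
  qed
  define \<pi> where "\<pi> = (\<lambda>a. if a < k then card {x \<in> ?I. x < f a} else a)"
  have f_eq: "f a = pick ?I (\<pi> a)" if "a < k" for a unfolding \<pi>_def using pk[OF that] that by simp
  have "inj_on \<pi> {0..<k}"
  proof (rule inj_onI)
    fix a b assume ab: "a \<in> {0..<k}" "b \<in> {0..<k}" "\<pi> a = \<pi> b"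
    then have "f a = f b" by (metis f_eq atLeastLessThan_iff)
    then show "a = b" using inj_onD[OF assms, of a b] ab by simp
  qed
  moreover have "\<pi> ` {0..<k} \<subseteq> {0..<k}" using lt by (auto simp: \<pi>_def)
  ultimately have "bij_betw \<pi> {0..<k} {0..<k}"
    unfolding bij_betw_def using endo_inj_surj[of "{0..<k}" \<pi>] by blast
  then have "\<pi> permutes {0..<k}"
    by (rule bij_imp_permutes) (simp add: \<pi>_def)
  then show ?thesis by (rule that) (rule f_eq)
qed

lemma det_select_cases:
  assumes A: "A \<in> carrier_mat m n" and f: "\<And>a. a < k \<Longrightarrow> f a < m" and g: "\<And>a. a < k \<Longrightarrow> g a < n"
  shows "det (select A k f g) = 0 \<or> (\<exists>d \<in> minors k A. det (select A k f g) = d \<or> det (select A k f g) = - d)"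
proof (cases "inj_on f {..<k} \<and> inj_on g {..<k}")
  case False
  then consider "\<not> inj_on f {..<k}" | "\<not> inj_on g {..<k}" by blast
  then have "det (select A k f g) = 0"
  proof cases
    case 1
    then obtain a b where "a < k" "b < k" "a \<noteq> b" "f a = f b" by (auto simp: inj_on_def)
    then show ?thesis
      by (intro det_identical_rows[OF select_carrier, of a b]) (auto simp: select_def row_def)
  next
    case 2
    then obtain a b where "a < k" "b < k" "a \<noteq> b" "g a = g b" by (auto simp: inj_on_def)
    then show ?thesis
      by (intro det_identical_columns[OF select_carrier, of a b]) (auto simp: select_def col_def)
  qed
  then show ?thesis ..
next
  case True
  let ?I = "f ` {..<k}" and ?J = "g ` {..<k}"
  obtain \<pi> where \<pi>: "\<pi> permutes {0..<k}" "\<And>a. a < k \<Longrightarrow> f a = pick ?I (\<pi> a)"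
    using True pick_permutation by blast
  obtain \<sigma> where \<sigma>: "\<sigma> permutes {0..<k}" "\<And>a. a < k \<Longrightarrow> g a = pick ?J (\<sigma> a)"
    using True pick_permutation by blast
  have card: "card ?I = k" "card ?J = k" using True by (simp_all add: card_image)
  have "{i. i < dim_row A \<and> i \<in> ?I} = ?I" "{i. i < dim_col A \<and> i \<in> ?J} = ?J" using f g A by auto
  then have B: "submatrix A ?I ?J = mat k k (\<lambda>(i, j). A $$ (pick ?I i, pick ?J j))"
    using card by (simp add: submatrix_def)
  have "submatrix A ?I ?J \<in> carrier_mat k k" by (simp add: B)
  have "det (submatrix A ?I ?J) \<in> minors k A"
    unfolding minors_def using card f g A by (intro CollectI exI[of _ ?I] exI[of _ ?J]) auto
  have S: "select A k f g = mat k k (\<lambda>(i, j). mat k k (\<lambda>(i, j). submatrix A ?I ?J $$ (i, \<sigma> j)) $$ (\<pi> i, j))"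
    using permutes_in_image[OF \<pi>(1)] permutes_in_image[OF \<sigma>(1)]
    by (intro eq_matI) (auto simp: select_def B \<pi>(2)[symmetric] \<sigma>(2)[symmetric])
  have "det (select A k f g) = signof \<pi> * (signof \<sigma> * det (submatrix A ?I ?J))"
    unfolding S by (subst det_permute_rows[OF _ \<pi>(1)], simp, subst det_permute_cols[OF _ \<sigma>(1)]) (simp_all add: B)
  then show ?thesis using \<open>det (submatrix A ?I ?J) \<in> minors k A\<close> by (auto simp: sign_def)
qed

lemma minor_eq_det_select:
  assumes A: "A \<in> carrier_mat m n" and d: "d \<in> minors k A"
  obtains f g where "\<And>a. a < k \<Longrightarrow> f a < m" "\<And>a. a < k \<Longrightarrow> g a < n" "d = det (select A k f g)"
proof -
  obtain I J where IJ: "I \<subseteq> {..<m}" "J \<subseteq> {..<n}" "card I = k" "card J = k" "d = det (submatrix A I J)"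
    using d A by (auto simp: minors_def)
  have "{i. i < dim_row A \<and> i \<in> I} = I" "{i. i < dim_col A \<and> i \<in> J} = J" using IJ A by auto
  then have "submatrix A I J = select A k (pick I) (pick J)" using IJ by (simp add: submatrix_def select_def)
  moreover have "pick I a < m" if "a < k" for a using pick_in_set_le[of a I] that IJ by auto
  moreover have "pick J a < n" if "a < k" for a using pick_in_set_le[of a J] that IJ by auto
  ultimately show ?thesis using that IJ(5) by metis
qed

definition divides_minors :: "'b :: comm_ring_1 \<Rightarrow> nat \<Rightarrow> 'b mat \<Rightarrow> bool" where
  "divides_minors x k A \<longleftrightarrow> (\<forall>d \<in> minors k A. x dvd d)"

lemma divides_minors_iff:
  assumes A: "A \<in> carrier_mat m n"
  shows "divides_minors x k A \<longleftrightarrow>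
    (\<forall>f g. (\<forall>a<k. f a < m) \<longrightarrow> (\<forall>a<k. g a < n) \<longrightarrow> x dvd det (select A k f g))"
proof
  assume *: "divides_minors x k A"
  show "\<forall>f g. (\<forall>a<k. f a < m) \<longrightarrow> (\<forall>a<k. g a < n) \<longrightarrow> x dvd det (select A k f g)"
  proof (intro allI impI)
    fix f g :: "nat \<Rightarrow> nat" assume "\<forall>a<k. f a < m" "\<forall>a<k. g a < n"
    then show "x dvd det (select A k f g)"
      using det_select_cases[OF A, of k f g] * by (auto simp: divides_minors_def)
  qed
next
  assume *: "\<forall>f g. (\<forall>a<k. f a < m) \<longrightarrow> (\<forall>a<k. g a < n) \<longrightarrow> x dvd det (select A k f g)"
  show "divides_minors x k A"
    unfolding divides_minors_def
  proof
    fix d assume "d \<in> minors k A"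
    then show "x dvd d" using * minor_eq_det_select[OF A] by metis
  qed
qed

lemma divides_minorsD:
  assumes "divides_minors x k A" "A \<in> carrier_mat m n" "\<And>a. a < k \<Longrightarrow> f a < m" "\<And>a. a < k \<Longrightarrow> g a < n"
  shows "x dvd det (select A k f g)"
  using assms divides_minors_iff by blast

lemma divides_cofactor_select:
  assumes A: "A \<in> carrier_mat m n" and "divides_minors x k A"
    and "\<And>a. a < Suc k \<Longrightarrow> f a < m" "\<And>a. a < Suc k \<Longrightarrow> g a < n"
  shows "x dvd cofactor (select A (Suc k) f g) i j"
proof -
  have "x dvd det (mat_delete (select A (Suc k) f g) i j)"
    unfolding mat_delete_select by (rule divides_minorsD[OF assms(2) A]) (use assms in auto)
  then show ?thesis by (simp add: cofactor_def)
qed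

text \<open>
  By Laplace expansion along the last column.
\<close>

lemma divides_minors_Suc:
  assumes A: "A \<in> carrier_mat m n" and x: "divides_minors x k A"
  shows "divides_minors x (Suc k) A"
  unfolding divides_minors_iff[OF A]
proof (intro allI impI)
  fix f g :: "nat \<Rightarrow> nat" assume fg: "\<forall>a<Suc k. f a < m" "\<forall>a<Suc k. g a < n"
  have "x dvd cofactor (select A (Suc k) f g) i k" for i
    using divides_cofactor_select[OF A x, of f g] fg by blast
  then have "x dvd (\<Sum>i<Suc k. select A (Suc k) f g $$ (i, k) * cofactor (select A (Suc k) f g) i k)"
    by (intro dvd_sum dvd_mult)
  then show "x dvd det (select A (Suc k) f g)"
    by (subst laplace_expansion_column[OF select_carrier, of k]) simp_all
qed

text \<open>
  A prime \<open>p\<close> for which every nonzero element has a finite order. These are the only properties of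
  the linear forms that the local analysis requires, so that there is no need to localize at \<open>p\<close>:
  units of the local ring are replaced by elements \<open>c\<close> that are prime to \<open>p\<close>.
\<close>

locale prime_order =
  fixes p :: "'b :: idom"
  assumes prime: "p dvd a * b \<Longrightarrow> p dvd a \<or> p dvd b"
    and bounded: "a \<noteq> 0 \<Longrightarrow> \<exists>e. \<not> p ^ e dvd a"
    and nonzero: "p \<noteq> 0"
begin

lemma power_dvd_cancel:
  assumes "\<not> p dvd c" "p ^ e dvd c * x"
  shows "p ^ e dvd x"
  using assms(2)
proof (induction e arbitrary: x)
  case (Suc e)
  then have "p dvd c * x" by (metis dvd_mult_left power_Suc)
  then obtain y where y: "x = p * y" using prime assms(1) by blast
  have "p * p ^ e dvd p * (c * y)" using Suc.prems by (simp add: y ac_simps)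
  then have "p ^ e dvd c * y" using nonzero by simp
  then show ?case using Suc.IH[of y] nonzero by (simp add: y)
qed simp

definition ord :: "'b \<Rightarrow> nat" where
  "ord a = (GREATEST e. p ^ e dvd a)"

lemma power_dvd_iff_le_ord:
  assumes "a \<noteq> 0"
  shows "p ^ e dvd a \<longleftrightarrow> e \<le> ord a"
proof -
  obtain b where b: "\<not> p ^ b dvd a" using bounded[OF assms] by blast
  have bd: "e \<le> b" if "p ^ e dvd a" for e
    using that b by (meson dvd_trans le_imp_power_dvd nat_le_linear)
  have "p ^ ord a dvd a"
    unfolding ord_def by (rule GreatestI_nat[of _ 0 b]) (use bd in auto)
  moreover have "e \<le> ord a" if "p ^ e dvd a" for e
    unfolding ord_def by (rule Greatest_le_nat[of _ e b]) (use bd that in auto)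
  ultimately show ?thesis by (meson dvd_trans le_imp_power_dvd)
qed

lemma ord_mult:
  assumes "a \<noteq> 0" "b \<noteq> 0"
  shows "ord (a * b) = ord a + ord b"
proof -
  obtain c where c: "a = p ^ ord a * c" using power_dvd_iff_le_ord[OF assms(1), of "ord a"] by auto
  obtain d where d: "b = p ^ ord b * d" using power_dvd_iff_le_ord[OF assms(2), of "ord b"] by auto
  have nc: "\<not> p dvd c"
  proof
    assume "p dvd c"
    then have "p ^ ord a * p dvd a" by (subst c) (rule mult_dvd_mono, auto)
    then show False using power_dvd_iff_le_ord[OF assms(1), of "Suc (ord a)"] by (simp add: mult.commute)
  qed
  have nd: "\<not> p dvd d"
  proof
    assume "p dvd d"
    then have "p ^ ord b * p dvd b" by (subst d) (rule mult_dvd_mono, auto)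
    then show False using power_dvd_iff_le_ord[OF assms(2), of "Suc (ord b)"] by (simp add: mult.commute)
  qed
  have ab: "a * b = p ^ (ord a + ord b) * (c * d)"
    by (subst c, subst d) (simp add: power_add ac_simps)
  have ab0: "a * b \<noteq> 0" using assms by simp
  have "ord a + ord b \<le> ord (a * b)"
    using power_dvd_iff_le_ord[OF ab0] ab by (metis dvd_triv_left)
  moreover have "\<not> p ^ Suc (ord a + ord b) dvd a * b"
  proof
    assume "p ^ Suc (ord a + ord b) dvd a * b"
    then have "p ^ (ord a + ord b) * p dvd p ^ (ord a + ord b) * (c * d)" by (subst (asm) ab) (simp add: mult.commute)
    then have "p dvd c * d" using nonzero by simp
    then show False using prime nc nd by blast
  qed
  ultimately show ?thesis using power_dvd_iff_le_ord[OF ab0, of "Suc (ord a + ord b)"] by simp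
qed

lemma primitive_multiple:
  assumes "i < k" "x i \<noteq> 0"
  obtains e y where "\<And>i. i < k \<Longrightarrow> x i = p ^ e * y i" "\<exists>i<k. \<not> p dvd y i"
proof -
  let ?P = "\<lambda>e. \<forall>j<k. p ^ e dvd x j"
  define e where "e = (GREATEST e. ?P e)"
  have bd: "e' \<le> ord (x i)" if "?P e'" for e' using that assms power_dvd_iff_le_ord by blast
  have "?P e" unfolding e_def by (rule GreatestI_nat[of _ 0 "ord (x i)"]) (use bd in auto)
  then have "\<forall>j\<in>{..<k}. \<exists>z. x j = p ^ e * z" by (auto elim: dvdE)
  from bchoice[OF this] obtain y where y: "\<And>j. j < k \<Longrightarrow> x j = p ^ e * y j" by auto
  have "\<exists>j<k. \<not> p dvd y j"
  proof (rule ccontr)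
    assume "\<not> (\<exists>j<k. \<not> p dvd y j)"
    then have "?P (Suc e)" by (auto simp: y)
    then have "Suc e \<le> e" unfolding e_def using bd by (intro Greatest_le_nat[of _ _ "ord (x i)"]) (auto simp del: power_Suc)
    then show False by simp
  qed
  then show ?thesis using that y by blast
qed

text \<open>
  Over the local ring at \<open>p\<close> this is a congruence modulo \<open>p ^ k\<close> to a matrix that factors through
  rank \<open>q\<close>; the factor \<open>c\<close> is the common denominator. Unlike the exponents of \<open>p\<close> in the invariant
  factors, this notion behaves obviously under rank-one updates.
\<close>

definition approximable :: "nat \<Rightarrow> nat \<Rightarrow> nat \<Rightarrow> nat \<Rightarrow> 'b mat \<Rightarrow> bool" where
  "approximable m n k q A \<longleftrightarrow> (\<exists>c X Y C. \<not> p dvd c \<and>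
     (\<forall>a<m. \<forall>b<n. c * A $$ (a, b) = (\<Sum>l<q. X a l * Y l b) + p ^ k * C a b))"

lemma approximable_rank_one_update:
  assumes "approximable m n k q A"
    and "\<And>a b. a < m \<Longrightarrow> b < n \<Longrightarrow> A' $$ (a, b) = A $$ (a, b) + x a * y b"
  shows "approximable m n k (Suc q) A'"
proof -
  obtain c X Y C where c: "\<not> p dvd c"
    and A: "\<forall>a<m. \<forall>b<n. c * A $$ (a, b) = (\<Sum>l<q. X a l * Y l b) + p ^ k * C a b"
    using assms(1) unfolding approximable_def by blast
  have "\<forall>a<m. \<forall>b<n. c * A' $$ (a, b) =
    (\<Sum>l<Suc q. (if l = q then c * x a else X a l) * (if l = q then y b else Y l b)) + p ^ k * C a b"
    using A assms(2) by (auto simp: algebra_simps)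
  then show ?thesis
    unfolding approximable_def using c
    by (intro exI[of _ c] exI[of _ "\<lambda>a l. if l = q then c * x a else X a l"]
      exI[of _ "\<lambda>l b. if l = q then y b else Y l b"] exI[of _ C]) simp
qed

text \<open>
  Let \<open>M\<close> be a square submatrix of order greater than \<open>q\<close>. The rows of \<open>X\<close> that belong to \<open>M\<close> are
  linearly dependent; a relation \<open>y\<close> between them with a coefficient prime to \<open>p\<close> turns
  \<open>c M \<equiv> X Y\<close> into \<open>y\<^sup>T (c M) \<equiv> 0\<close> modulo \<open>p ^ k\<close>. Multiplication by the adjugate of \<open>M\<close>, whose
  entries are minors of the next smaller order, bounds the order of \<open>det M\<close> from below.
\<close>

lemma approximable_imp_gap:
  assumes A: "A \<in> carrier_mat m n" and ap: "approximable m n k q A" and q: "q \<le> i"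
    and div: "divides_minors (p ^ e) i A"
  shows "divides_minors (p ^ (e + k)) (Suc i) A"
  unfolding divides_minors_iff[OF A]
proof (intro allI impI)
  fix f g :: "nat \<Rightarrow> nat" assume f: "\<forall>a<Suc i. f a < m" and g: "\<forall>a<Suc i. g a < n"
  obtain c X Y C where c: "\<not> p dvd c"
    and AX: "\<And>a b. a < m \<Longrightarrow> b < n \<Longrightarrow> c * A $$ (a, b) = (\<Sum>l<q. X a l * Y l b) + p ^ k * C a b"
    using ap unfolding approximable_def by blast
  define M where "M = select A (Suc i) f g"
  have M: "M \<in> carrier_mat (Suc i) (Suc i)" by (simp add: M_def)
  have Mab: "M $$ (a, b) = A $$ (f a, g b)" if "a < Suc i" "b < Suc i" for a b
    using that by (simp add: M_def select_def)
  define Z where "Z = mat (Suc i) (Suc i) (\<lambda>(l, a). if l < q then X (f a) l else 0)"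
  have Z: "Z \<in> carrier_mat (Suc i) (Suc i)" by (simp add: Z_def)
  have "det Z = 0"
    by (subst laplace_expansion_row[OF Z, of i]) (use q in \<open>auto simp: Z_def intro!: sum.neutral\<close>)
  then obtain v where v: "v \<in> carrier_vec (Suc i)" "v \<noteq> 0\<^sub>v (Suc i)" "Z *\<^sub>v v = 0\<^sub>v (Suc i)"
    using det_0_iff_vec_prod_zero[OF Z] by blast
  obtain a1 where a1: "a1 < Suc i" "v $ a1 \<noteq> 0" using v(1,2) by (metis eq_vecI carrier_vecD index_zero_vec)
  obtain e0 y where y: "\<And>a. a < Suc i \<Longrightarrow> v $ a = p ^ e0 * y a" and "\<exists>a<Suc i. \<not> p dvd y a"
    using primitive_multiple[of a1 "Suc i" "\<lambda>a. v $ a"] a1 by blast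
  then obtain a0 where a0: "a0 < Suc i" "\<not> p dvd y a0" by blast
  have null: "(\<Sum>a<Suc i. y a * X (f a) l) = 0" if "l < q" for l
  proof -
    have l: "l < Suc i" using that q by simp
    have "0 = (Z *\<^sub>v v) $ l" using v(3) l by simp
    also have "\<dots> = (\<Sum>a<Suc i. X (f a) l * v $ a)"
      using l that v(1) Z by (auto simp: scalar_prod_def Z_def atLeast0LessThan intro!: sum.cong)
    also have "\<dots> = p ^ e0 * (\<Sum>a<Suc i. y a * X (f a) l)"
      unfolding sum_distrib_left by (rule sum.cong) (auto simp: y)
    finally show ?thesis using nonzero by simp
  qed
  define z where "z = (\<lambda>b. \<Sum>a<Suc i. y a * C (f a) (g b))"
  have yM: "(\<Sum>a<Suc i. c * y a * M $$ (a, b)) = p ^ k * z b" if b: "b < Suc i" for b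
  proof -
    have "(\<Sum>a<Suc i. c * y a * M $$ (a, b)) =
        (\<Sum>a<Suc i. y a * ((\<Sum>l<q. X (f a) l * Y l (g b)) + p ^ k * C (f a) (g b)))"
    proof (rule sum.cong[OF refl])
      fix a assume a: "a \<in> {..<Suc i}"
      then have "c * y a * M $$ (a, b) = y a * (c * A $$ (f a, g b))" using b by (simp add: Mab ac_simps)
      also have "c * A $$ (f a, g b) = (\<Sum>l<q. X (f a) l * Y l (g b)) + p ^ k * C (f a) (g b)"
        by (rule AX) (use a b f g in auto)
      finally show "c * y a * M $$ (a, b) = y a * ((\<Sum>l<q. X (f a) l * Y l (g b)) + p ^ k * C (f a) (g b))" .
    qed
    also have "\<dots> = (\<Sum>a<Suc i. \<Sum>l<q. y a * (X (f a) l * Y l (g b))) + p ^ k * z b"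
      by (simp only: distrib_left sum.distrib z_def sum_distrib_left) (simp add: ac_simps)
    also have "(\<Sum>a<Suc i. \<Sum>l<q. y a * (X (f a) l * Y l (g b))) =
        (\<Sum>l<q. \<Sum>a<Suc i. y a * (X (f a) l * Y l (g b)))"
      by (rule sum.swap)
    also have "\<dots> = (\<Sum>l<q. (\<Sum>a<Suc i. y a * X (f a) l) * Y l (g b))"
      by (simp only: sum_distrib_right mult.assoc)
    also have "\<dots> = 0" by (rule sum.neutral) (simp add: null del: sum.lessThan_Suc)
    finally show ?thesis by simp
  qed
  have adj: "(\<Sum>b<Suc i. M $$ (a, b) * cofactor M a0 b) = (if a = a0 then det M else 0)" if a: "a < Suc i" for a
  proof -
    have "(M * adj_mat M) $$ (a, a0) = (\<Sum>b<Suc i. M $$ (a, b) * cofactor M a0 b)"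
      using a a0 M by (auto simp: scalar_prod_def adj_mat_def atLeast0LessThan intro!: sum.cong)
    then show ?thesis unfolding adj_mat(2)[OF M] using a a0
      by (cases "a = a0") (simp_all del: sum.lessThan_Suc)
  qed
  have "c * y a0 * det M = (\<Sum>a<Suc i. c * y a * (if a = a0 then det M else 0))"
    using a0 by (simp add: if_distrib[of "\<lambda>x. _ * x"] cong: if_cong del: sum.lessThan_Suc)
  also have "\<dots> = (\<Sum>a<Suc i. c * y a * (\<Sum>b<Suc i. M $$ (a, b) * cofactor M a0 b))"
    by (rule sum.cong) (auto simp: adj simp del: sum.lessThan_Suc)
  also have "\<dots> = (\<Sum>a<Suc i. \<Sum>b<Suc i. c * y a * M $$ (a, b) * cofactor M a0 b)"
    by (simp only: sum_distrib_left mult.assoc)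
  also have "\<dots> = (\<Sum>b<Suc i. \<Sum>a<Suc i. c * y a * M $$ (a, b) * cofactor M a0 b)"
    by (rule sum.swap)
  also have "\<dots> = (\<Sum>b<Suc i. p ^ k * z b * cofactor M a0 b)"
    by (rule sum.cong) (auto simp: yM sum_distrib_right[symmetric] simp del: sum.lessThan_Suc)
  also have "p ^ (e + k) dvd \<dots>"
  proof (rule dvd_sum)
    fix b assume "b \<in> {..<Suc i}"
    have "p ^ e dvd cofactor M a0 b"
      unfolding M_def by (rule divides_cofactor_select[OF A div]) (use f g in auto)
    then have "p ^ k * p ^ e dvd p ^ k * z b * cofactor M a0 b"
      by (intro mult_dvd_mono) auto
    then show "p ^ (e + k) dvd p ^ k * z b * cofactor M a0 b"
      by (simp add: power_add mult.commute)
  qed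
  finally have "p ^ (e + k) dvd c * (y a0 * det M)" by (simp add: mult.assoc)
  then show "p ^ (e + k) dvd det (select A (Suc i) f g)"
    using power_dvd_cancel c a0(2) unfolding M_def by blast
qed

text \<open>
  Choose a minor \<open>\<Delta>\<close> of order \<open>j\<close> on which \<open>p\<close> has the smallest exponent \<open>e\<close>. The Laplace
  expansion of the minor that borders \<open>\<Delta>\<close> with row \<open>x\<close> and column \<open>y\<close>, along column \<open>y\<close>, expresses
  \<open>\<Delta> A\<^sub>x\<^sub>y\<close> by that bordered minor and by the entries of column \<open>y\<close> in the \<open>j\<close> chosen rows. Both the
  coefficients and \<open>\<Delta>\<close> are divisible by \<open>p ^ e\<close>, and after division by \<open>p ^ e\<close> the bordered minor
  still carries the factor \<open>p ^ k\<close>.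
\<close>

lemma gap_imp_approximable:
  assumes A: "A \<in> carrier_mat m n"
    and div: "divides_minors (p ^ e) j A" and ndiv: "\<not> divides_minors (p ^ Suc e) j A"
    and gap: "divides_minors (p ^ (e + k)) (Suc j) A"
  shows "approximable m n k j A"
proof -
  obtain f g where f: "\<And>a. a < j \<Longrightarrow> f a < m" and g: "\<And>a. a < j \<Longrightarrow> g a < n"
    and nd: "\<not> p ^ Suc e dvd det (select A j f g)"
    using ndiv unfolding divides_minors_iff[OF A] by blast
  have "p ^ e dvd det (select A j f g)" by (rule divides_minorsD[OF div A f g])
  then obtain c where c: "det (select A j f g) = p ^ e * c" by blast
  have nc: "\<not> p dvd c"
  proof
    assume "p dvd c"
    then have "p ^ e * p dvd p ^ e * c" by (intro mult_dvd_mono) auto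
    then show False using nd c by (simp add: mult.commute)
  qed
  define M where "M = (\<lambda>x y. select A (Suc j) (f(j := x)) (g(j := y)))"
  define X0 where "X0 = (\<lambda>x i. (- 1) ^ (i + j) * det (select A j (\<lambda>a. (f(j := x)) (if a < i then a else Suc a)) g))"
  have ex1: "\<exists>z. X0 x i = p ^ e * z" if "x < m" for x i
  proof -
    have "p ^ e dvd det (select A j (\<lambda>a. (f(j := x)) (if a < i then a else Suc a)) g)"
      by (rule divides_minorsD[OF div A]) (use f g that in auto)
    then show ?thesis by (auto simp: X0_def elim!: dvdE)
  qed
  define X1 where "X1 = (\<lambda>x i. SOME z. X0 x i = p ^ e * z)"
  have X1: "X0 x i = p ^ e * X1 x i" if "x < m" for x i
    unfolding X1_def by (rule someI_ex[OF ex1[OF that]])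
  have ex2: "\<exists>z. det (M x y) = p ^ (e + k) * z" if "x < m" "y < n" for x y
  proof -
    have "p ^ (e + k) dvd det (M x y)"
      unfolding M_def by (rule divides_minorsD[OF gap A]) (use f g that in \<open>auto simp: less_Suc_eq\<close>)
    then show ?thesis by blast
  qed
  define C where "C = (\<lambda>x y. SOME z. det (M x y) = p ^ (e + k) * z)"
  have C: "det (M x y) = p ^ (e + k) * C x y" if "x < m" "y < n" for x y
    unfolding C_def by (rule someI_ex[OF ex2[OF that]])
  have "c * A $$ (x, y) = (\<Sum>i<j. - X1 x i * A $$ (f i, y)) + p ^ k * C x y" if xy: "x < m" "y < n" for x y
  proof -
    have cof: "cofactor (M x y) i j = X0 x i" for i
    proof -
      have "select A j (\<lambda>a. (f(j := x)) (if a < i then a else Suc a)) (\<lambda>b. (g(j := y)) (if b < j then b else Suc b))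
        = select A j (\<lambda>a. (f(j := x)) (if a < i then a else Suc a)) g"
        by (rule eq_matI) (auto simp: select_def)
      then show ?thesis by (simp add: cofactor_def M_def mat_delete_select X0_def)
    qed
    have "select A j (\<lambda>a. (f(j := x)) (if a < j then a else Suc a)) g = select A j f g"
      by (rule eq_matI) (auto simp: select_def)
    then have X0j: "X0 x j = p ^ e * c" by (simp add: X0_def c)
    have "p ^ (e + k) * C x y = det (M x y)" using C[OF xy] by simp
    also have "\<dots> = (\<Sum>i<Suc j. M x y $$ (i, j) * cofactor (M x y) i j)"
      by (rule laplace_expansion_column) (auto simp: M_def)
    also have "\<dots> = (\<Sum>i<j. M x y $$ (i, j) * X0 x i) + M x y $$ (j, j) * X0 x j"
      by (simp add: cof)
    also have "M x y $$ (j, j) = A $$ (x, y)" by (simp add: M_def select_def)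
    also have "(\<Sum>i<j. M x y $$ (i, j) * X0 x i) = p ^ e * (\<Sum>i<j. X1 x i * A $$ (f i, y))"
      unfolding sum_distrib_left
      by (rule sum.cong) (use X1[OF xy(1)] in \<open>auto simp: M_def select_def ac_simps\<close>)
    finally have "p ^ e * (p ^ k * C x y) = p ^ e * ((\<Sum>i<j. X1 x i * A $$ (f i, y)) + c * A $$ (x, y))"
      by (simp add: X0j power_add algebra_simps)
    then have "p ^ k * C x y = (\<Sum>i<j. X1 x i * A $$ (f i, y)) + c * A $$ (x, y)"
      using nonzero by simp
    then show ?thesis by (simp add: sum_negf)
  qed
  then have "\<forall>x<m. \<forall>y<n. c * A $$ (x, y) = (\<Sum>i<j. - X1 x i * A $$ (f i, y)) + p ^ k * C x y"
    by blast
  then show ?thesis unfolding approximable_def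
    by (intro exI[of _ c] exI[of _ "\<lambda>x i. - X1 x i"] exI[of _ "\<lambda>i y. A $$ (f i, y)"] exI[of _ C]
      conjI nc)
qed

text \<open>
  \<open>\<mu> j\<close> is the exponent of \<open>p\<close> in the \<open>j\<close>-th determinantal divisor, and \<open>\<rho>\<close> is the rank. The gaps
  \<open>\<mu> j - \<mu> (j - 1)\<close> are the exponents of \<open>p\<close> in the invariant factors.
\<close>

definition minor_orders :: "'b mat \<Rightarrow> nat \<Rightarrow> (nat \<Rightarrow> nat) \<Rightarrow> bool" where
  "minor_orders A \<rho> \<mu> \<longleftrightarrow>
     (\<forall>j\<le>\<rho>. \<forall>e. divides_minors (p ^ e) j A \<longleftrightarrow> e \<le> \<mu> j) \<and> (\<forall>j>\<rho>. divides_minors 0 j A)"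

definition small_gaps :: "nat \<Rightarrow> nat \<Rightarrow> (nat \<Rightarrow> nat) \<Rightarrow> nat" where
  "small_gaps k \<rho> \<mu> = card {j \<in> {1..\<rho>}. \<mu> j - \<mu> (j - 1) < k}"

lemma minor_orders_mono:
  assumes A: "A \<in> carrier_mat m n" and \<mu>: "minor_orders A \<rho> \<mu>" and "Suc j \<le> \<rho>"
  shows "\<mu> j \<le> \<mu> (Suc j)"
proof -
  have "divides_minors (p ^ \<mu> j) j A" using \<mu> assms(3) by (auto simp: minor_orders_def)
  then have "divides_minors (p ^ \<mu> j) (Suc j) A" by (rule divides_minors_Suc[OF A])
  then show ?thesis using \<mu> assms(3) by (auto simp: minor_orders_def)
qed

lemma approximable_imp_small_gaps_le:
  assumes A: "A \<in> carrier_mat m n" and \<mu>: "minor_orders A \<rho> \<mu>" and ap: "approximable m n k q A"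
  shows "small_gaps k \<rho> \<mu> \<le> q"
proof -
  have "{j \<in> {1..\<rho>}. \<mu> j - \<mu> (j - 1) < k} \<subseteq> {1..q}"
  proof clarsimp
    fix j assume j: "Suc 0 \<le> j" "j \<le> \<rho>" "\<mu> j - \<mu> (j - Suc 0) < k"
    show "j \<le> q"
    proof (rule ccontr)
      assume "\<not> j \<le> q"
      then obtain i where i: "j = Suc i" "q \<le> i" using j(1) by (cases j) auto
      have "divides_minors (p ^ \<mu> i) i A" using \<mu> i j(2) by (auto simp: minor_orders_def)
      then have "divides_minors (p ^ (\<mu> i + k)) (Suc i) A" by (rule approximable_imp_gap[OF A ap i(2)])
      then have "\<mu> i + k \<le> \<mu> j" using \<mu> i j(2) by (auto simp: minor_orders_def)
      then show False using j(3) i(1) by simp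
    qed
  qed
  then show ?thesis unfolding small_gaps_def using card_mono[of "{1..q}"] by fastforce
qed

text \<open>
  Up to the first gap of size at least \<open>k\<close> all gaps are small, and at this place
  \<open>gap_imp_approximable\<close> applies; if there is no such gap, it applies at the rank, since all larger
  minors vanish. By \<open>approximable_imp_small_gaps_le\<close> no later gap is small, which is the monotonicity
  of the exponents in disguise.
\<close>

lemma approximable_small_gaps:
  assumes A: "A \<in> carrier_mat m n" and \<mu>: "minor_orders A \<rho> \<mu>"
  shows "approximable m n k (small_gaps k \<rho> \<mu>) A"
proof -
  define q where "q = (LEAST j. j = \<rho> \<or> (j < \<rho> \<and> \<mu> j + k \<le> \<mu> (Suc j)))"
  have q: "q = \<rho> \<or> (q < \<rho> \<and> \<mu> q + k \<le> \<mu> (Suc q))"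
    unfolding q_def by (rule LeastI[of _ \<rho>]) simp
  have q_le: "q \<le> \<rho>" using q by auto
  have "divides_minors (p ^ (\<mu> q + k)) (Suc q) A"
  proof (cases "q = \<rho>")
    case True
    then have "divides_minors 0 (Suc q) A" using \<mu> unfolding minor_orders_def by blast
    then show ?thesis by (auto simp: divides_minors_def)
  next
    case False
    then show ?thesis using q \<mu> unfolding minor_orders_def by (metis Suc_leI)
  qed
  moreover have "divides_minors (p ^ \<mu> q) q A" "\<not> divides_minors (p ^ Suc (\<mu> q)) q A"
    using \<mu> q_le unfolding minor_orders_def by (meson order_refl, meson Suc_n_not_le_n)
  ultimately have ap: "approximable m n k q A" using gap_imp_approximable[OF A] by blast
  have "{1..q} \<subseteq> {j \<in> {1..\<rho>}. \<mu> j - \<mu> (j - 1) < k}"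
  proof clarify
    fix j assume j: "j \<in> {1..q}"
    then have "j - 1 < q" by auto
    then have "\<not> (j - 1 = \<rho> \<or> (j - 1 < \<rho> \<and> \<mu> (j - 1) + k \<le> \<mu> (Suc (j - 1))))"
      unfolding q_def by (rule not_less_Least)
    moreover have j': "Suc (j - 1) = j" "j \<le> \<rho>" using j q_le by auto
    moreover have "\<mu> (j - 1) \<le> \<mu> j" using minor_orders_mono[OF A \<mu>, of "j - 1"] j' by simp
    ultimately show "j \<in> {1..\<rho>} \<and> \<mu> j - \<mu> (j - 1) < k" using j by auto
  qed
  then have "q \<le> small_gaps k \<rho> \<mu>" unfolding small_gaps_def
    using card_mono[of "{j \<in> {1..\<rho>}. \<mu> j - \<mu> (j - 1) < k}" "{1..q}"] by simp
  then have "small_gaps k \<rho> \<mu> = q" using approximable_imp_small_gaps_le[OF A \<mu> ap] by simp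
  then show ?thesis using ap by simp
qed

lemma small_gaps_rank_one_update:
  assumes A: "A \<in> carrier_mat m n" and A': "A' \<in> carrier_mat m n"
    and "minor_orders A \<rho> \<mu>" "minor_orders A' \<rho>' \<mu>'"
    and "\<And>a b. a < m \<Longrightarrow> b < n \<Longrightarrow> A' $$ (a, b) = A $$ (a, b) + x a * y b"
  shows "small_gaps k \<rho>' \<mu>' \<le> Suc (small_gaps k \<rho> \<mu>)"
  using approximable_rank_one_update[OF approximable_small_gaps[OF A assms(3)] assms(5)]
    approximable_imp_small_gaps_le[OF A' assms(4)] by blast

end

section \<open>Homogeneous invariant factors\<close>

lemma minors_0: "minors 0 A = {1}"
  by (auto simp: minors_def submatrix_def finite_subset[OF _ finite_lessThan] det_def card_eq_0_iff
    intro!: exI[of _ "{}"])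

lemma minors_large:
  assumes "A \<in> carrier_mat m n" "m < k"
  shows "minors k A = {}"
proof -
  have "card I \<le> m" if "I \<subseteq> {..<dim_row A}" for I
    using card_mono[OF finite_lessThan that] assms(1) by simp
  then have "card I \<noteq> k" if "I \<subseteq> {..<dim_row A}" for I using that assms(2) by (metis leD)
  then show ?thesis unfolding minors_def by blast
qed

lemma finite_minors: "finite (minors k A)"
proof -
  have "minors k A \<subseteq> (\<lambda>(I, J). det (submatrix A I J)) ` (Pow {..<dim_row A} \<times> Pow {..<dim_col A})"
    by (auto simp: minors_def)
  then show ?thesis by (rule finite_subset) auto
qed

lemma divides_minors_mono:
  assumes A: "A \<in> carrier_mat m n" and "divides_minors x j A" "j \<le> k"
  shows "divides_minors x k A"
  using assms(3,2) by (induction k rule: dec_induct) (auto intro: divides_minors_Suc[OF A])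

lemma normal_rank_less_iff:
  assumes A: "A \<in> carrier_mat m n"
  shows "normal_rank A < j \<longleftrightarrow> divides_minors 0 j A"
proof -
  let ?S = "{k. \<exists>d \<in> minors k A. d \<noteq> 0}"
  have S: "j \<in> ?S \<longleftrightarrow> \<not> divides_minors 0 j A" for j by (auto simp: divides_minors_def)
  have "?S \<subseteq> {..m}" using minors_large[OF A] by (force simp: not_less[symmetric])
  then have fin: "finite ?S" by (rule finite_subset) simp
  have ne: "?S \<noteq> {}" using minors_0[of A] by (metis (mono_tags, lifting) empty_iff insertI1 mem_Collect_eq zero_neq_one)
  have "normal_rank A < j \<longleftrightarrow> (\<forall>k\<in>?S. k < j)"
    unfolding normal_rank_def by (rule Max_less_iff[OF fin ne])
  also have "\<dots> \<longleftrightarrow> divides_minors 0 j A"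
    using S divides_minors_mono[OF A] by (meson linorder_not_less order_refl)
  finally show ?thesis .
qed

lemma normal_rank_le_dims:
  assumes A: "A \<in> carrier_mat m n"
  shows "normal_rank A \<le> m" "normal_rank A \<le> n"
proof -
  have "divides_minors 0 (Suc m) A" by (simp add: divides_minors_def minors_large[OF A])
  then show "normal_rank A \<le> m" using normal_rank_less_iff[OF A] by (meson less_Suc_eq_le)
  have "minors (Suc n) A = {}"
  proof -
    have "card I \<le> n" if "I \<subseteq> {..<dim_col A}" for I
      using card_mono[OF finite_lessThan that] A by simp
    then have "card I \<noteq> Suc n" if "I \<subseteq> {..<dim_col A}" for I using that by (metis not_less_eq_eq order_refl)
    then show ?thesis unfolding minors_def by blast
  qed
  then have "divides_minors 0 (Suc n) A" by (simp add: divides_minors_def)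
  then show "normal_rank A \<le> n" using normal_rank_less_iff[OF A] by (meson less_Suc_eq_le)
qed

lemma gcd_exists:
  fixes S :: "'b :: ufd set"
  assumes "finite S"
  shows "\<exists>d. is_gcd_of S d"
proof -
  obtain xs where "set xs = S" using finite_list[OF assms] by blast
  then show ?thesis
    using some_gcd.listgcd[of _ xs] some_gcd.listgcd_greatest[of xs] unfolding is_gcd_of_def by blast
qed

lemma homog_det_divisor_is_gcd:
  "is_gcd_of (minors k (homogenize H)) (homog_det_divisor H k)"
  unfolding homog_det_divisor_def by (rule someI_ex) (rule gcd_exists[OF finite_minors])

lemma dvd_homog_det_divisor_iff:
  "x dvd homog_det_divisor H k \<longleftrightarrow> divides_minors x k (homogenize H)"
  using homog_det_divisor_is_gcd[of k H] unfolding is_gcd_of_def divides_minors_def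
  by (meson dvd_trans)

text \<open>
  The form \<open>s - \<mu> t\<close> is monic of degree one in the outer variable, so divisibility by it means
  vanishing of the value at \<open>s = \<mu> t\<close>; the form \<open>t\<close> is a prime constant.
\<close>

lemma linear_form_prime_order: "prime_order (linear_form \<mu>)"
proof (cases \<mu>)
  case (Finite c)
  have f: "linear_form \<mu> = [:- monom c 1, 1:]" by (simp add: Finite minus_monom)
  show ?thesis
  proof
    show "linear_form \<mu> dvd a \<or> linear_form \<mu> dvd b" if "linear_form \<mu> dvd a * b" for a b
      using that unfolding f poly_eq_0_iff_dvd[symmetric] by simp
    show "\<exists>e. \<not> linear_form \<mu> ^ e dvd a" if "a \<noteq> 0" for a
    proof (intro exI notI)
      assume "linear_form \<mu> ^ Suc (degree a) dvd a"
      then have "degree (linear_form \<mu> ^ Suc (degree a)) \<le> degree a"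
        by (rule dvd_imp_degree_le) (rule that)
      then show False unfolding f degree_linear_power by simp
    qed
    show "linear_form \<mu> \<noteq> 0" by (simp add: f)
  qed
next
  case Infinity
  have f: "linear_form \<mu> = [:[:0, 1:]:]" by (simp add: Infinity monom_altdef)
  have dvd: "[:0, 1:] dvd q \<longleftrightarrow> poly q 0 = 0" for q :: "'a poly" using poly_eq_0_iff_dvd[of q 0] by simp
  have "prime_elem ([:0, 1:] :: 'a poly)" 
    by (rule prime_elemI) (simp_all only: dvd, simp_all)
  then have prime: "prime_elem (linear_form \<mu>)" unfolding f by (rule lift_prime_elem_poly)
  show ?thesis
  proof
    show "linear_form \<mu> dvd a \<or> linear_form \<mu> dvd b" if "linear_form \<mu> dvd a * b" for a b
      using prime that by (rule prime_elem_dvd_multD)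
    show "\<exists>e. \<not> linear_form \<mu> ^ e dvd a" if "a \<noteq> 0" for a
    proof (intro exI notI)
      let ?e = "Suc (degree (lead_coeff a))"
      assume "linear_form \<mu> ^ ?e dvd a"
      then have "[:[:0, 1:] ^ ?e:] dvd a" by (simp only: f poly_const_pow)
      then have "[:0, 1:] ^ ?e dvd lead_coeff a" by (simp only: const_poly_dvd_iff)
      then have "degree ([:0, 1:] ^ ?e :: 'a poly) \<le> degree (lead_coeff a)"
        by (rule dvd_imp_degree_le) (use that in simp)
      then show False unfolding degree_linear_power by simp
    qed
    show "linear_form \<mu> \<noteq> 0" by (simp add: f)
  qed
qed

text \<open>
  Homogeneity of degree \<open>k\<close>. A form that vanishes at \<open>t = 1\<close> is zero, hence homogenization
  preserves the vanishing of minors and thus the normal rank.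
\<close>

definition form :: "nat \<Rightarrow> 'a :: field poly poly \<Rightarrow> bool" where
  "form k d \<longleftrightarrow> (\<forall>i j. coeff (coeff d i) j \<noteq> 0 \<longrightarrow> i + j = k)"

lemma form_one: "form 0 (1 :: 'a :: field poly poly)"
  unfolding form_def
proof (intro allI impI)
  fix i j assume "coeff (coeff (1 :: 'a poly poly) i) j \<noteq> 0"
  then show "i + j = 0" by (cases "i = 0"; cases "j = 0") simp_all
qed

lemma form_mult:
  assumes "form k a" "form l b"
  shows "form (k + l) (a * b)"
  unfolding form_def
proof (intro allI impI)
  fix i j assume "coeff (coeff (a * b) i) j \<noteq> 0"
  then have "(\<Sum>x\<le>i. \<Sum>y\<le>j. coeff (coeff a x) y * coeff (coeff b (i - x)) (j - y)) \<noteq> 0"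
    by (simp add: coeff_mult coeff_sum)
  then obtain x y where xy: "x \<le> i" "y \<le> j" and "coeff (coeff a x) y * coeff (coeff b (i - x)) (j - y) \<noteq> 0"
    by (meson atMost_iff sum.not_neutral_contains_not_neutral)
  then have "x + y = k" "(i - x) + (j - y) = l" using assms unfolding form_def by auto
  then show "i + j = k + l" using xy by simp
qed

lemma form_prod:
  assumes "finite S" "\<And>x. x \<in> S \<Longrightarrow> form 1 (h x)"
  shows "form (card S) (prod h S)"
  using assms
proof (induction S)
  case empty
  show ?case by (simp add: form_one)
next
  case (insert x S)
  then have "form (1 + card S) (h x * prod h S)" by (intro form_mult) auto
  then show ?case using insert by simp
qed

lemma form_sum:
  assumes "\<And>x. x \<in> S \<Longrightarrow> form k (h x)"
  shows "form k (sum h S)"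
  unfolding form_def
proof (intro allI impI)
  fix i j assume "coeff (coeff (sum h S) i) j \<noteq> 0"
  then have "(\<Sum>x\<in>S. coeff (coeff (h x) i) j) \<noteq> 0" by (simp add: coeff_sum)
  then obtain x where "x \<in> S" "coeff (coeff (h x) i) j \<noteq> 0" by (meson sum.not_neutral_contains_not_neutral)
  then show "i + j = k" using assms unfolding form_def by blast
qed

lemma form_det:
  assumes M: "M \<in> carrier_mat k k" and "\<And>i j. i < k \<Longrightarrow> j < k \<Longrightarrow> form 1 (M $$ (i, j))"
  shows "form k (det M)"
  unfolding det_def'[OF M]
proof (rule form_sum)
  fix q assume "q \<in> {q. q permutes {0..<k}}"
  then have "form 1 (M $$ (i, q i))" if "i \<in> {0..<k}" for i
    using assms(2) that permutes_in_image[of q "{0..<k}" i] by auto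
  then have "form (card {0..<k}) (\<Prod>i = 0..<k. M $$ (i, q i))" by (intro form_prod) auto
  then show "form k (signof q * (\<Prod>i = 0..<k. M $$ (i, q i)))"
    by (cases "sign q = 1") (auto simp: form_def sign_def)
qed

definition dehomogenize :: "'a :: field poly poly \<Rightarrow> 'a poly" where
  "dehomogenize = map_poly (\<lambda>q. poly q 1)"

lemma dehomogenize_hom: "comm_ring_hom (dehomogenize :: 'a :: field poly poly \<Rightarrow> 'a poly)"
proof -
  interpret h: comm_ring_hom "\<lambda>q :: 'a poly. poly q 1" by standard auto
  interpret hp: map_poly_comm_ring_hom "\<lambda>q :: 'a poly. poly q 1" ..
  show ?thesis unfolding dehomogenize_def by (rule hp.comm_ring_hom_axioms)
qed

lemma form_dehomogenize_eq_0_iff: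
  assumes "form k d"
  shows "dehomogenize d = 0 \<longleftrightarrow> d = 0"
proof
  assume "dehomogenize d = 0"
  have "coeff d i = 0" for i
  proof -
    have "coeff d i = monom (coeff (coeff d i) (k - i)) (k - i)"
    proof (rule poly_eqI)
      fix j
      show "coeff (coeff d i) j = coeff (monom (coeff (coeff d i) (k - i)) (k - i)) j"
        using assms unfolding form_def by (metis add_diff_cancel_left' coeff_monom)
    qed
    moreover have "poly (coeff d i) 1 = 0"
      using \<open>dehomogenize d = 0\<close> by (metis coeff_0 coeff_map_poly dehomogenize_def poly_0)
    ultimately show ?thesis by (metis monom_eq_0_iff mult.right_neutral poly_monom power_one)
  qed
  then show "d = 0" by (simp add: poly_eq_iff)
qed (simp add: dehomogenize_def)

lemma dehomogenize_homogenized: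
  assumes "degree q \<le> 1"
  shows "dehomogenize [:monom (coeff q 0) 1, [:coeff q 1:]:] = q"
proof (rule poly_eqI)
  fix i show "coeff (dehomogenize [:monom (coeff q 0) 1, [:coeff q 1:]:]) i = coeff q i"
    using assms coeff_eq_0[of q i]
    by (auto simp: dehomogenize_def coeff_map_poly coeff_pCons poly_monom split: nat.splits)
qed

lemma det_select_homogenize_eq_0_iff:
  assumes H: "matrix_pencil m n H" and f: "\<And>a. a < k \<Longrightarrow> f a < m" and g: "\<And>a. a < k \<Longrightarrow> g a < n"
  shows "det (select (homogenize H) k f g) = 0 \<longleftrightarrow> det (select H k f g) = 0"
proof -
  interpret comm_ring_hom "dehomogenize :: 'a poly poly \<Rightarrow> 'a poly" by (rule dehomogenize_hom)
  let ?M = "select (homogenize H) k f g"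
  have H': "H \<in> carrier_mat m n" "\<And>i j. i < m \<Longrightarrow> j < n \<Longrightarrow> degree (H $$ (i, j)) \<le> 1"
    using H by (auto simp: matrix_pencil_def)
  have "map_mat dehomogenize ?M = select H k f g"
    by (rule eq_matI) (use H' f g in \<open>auto simp: select_def homogenize_def dehomogenize_homogenized simp del: One_nat_def\<close>)
  then have "dehomogenize (det ?M) = det (select H k f g)" by (metis hom_det)
  moreover have "form k (det ?M)"
    by (rule form_det) (use H' f g in \<open>auto simp: select_def homogenize_def form_def coeff_pCons split: nat.splits if_splits\<close>)
  ultimately show ?thesis using form_dehomogenize_eq_0_iff by metis
qed

lemma normal_rank_homogenize:
  assumes H: "matrix_pencil m n H"
  shows "normal_rank H < j \<longleftrightarrow> divides_minors 0 j (homogenize H)"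
proof -
  have H': "H \<in> carrier_mat m n" "homogenize H \<in> carrier_mat m n"
    using H by (auto simp: matrix_pencil_def homogenize_def)
  show ?thesis
    unfolding normal_rank_less_iff[OF H'(1)] divides_minors_iff[OF H'(1)] divides_minors_iff[OF H'(2)]
    using det_select_homogenize_eq_0_iff[OF H] by (auto simp: dvd_0_left_iff)
qed

lemma minor_orders_homogenize:
  assumes H: "matrix_pencil m n H"
  shows "prime_order.minor_orders (linear_form \<mu>) (homogenize H) (normal_rank H)
    (\<lambda>j. prime_order.ord (linear_form \<mu>) (homog_det_divisor H j))"
proof -
  interpret prime_order "linear_form \<mu>" by (rule linear_form_prime_order)
  show ?thesis
    unfolding minor_orders_def
  proof (intro conjI allI impI)
    fix j e assume "j \<le> normal_rank H"
    then have "\<not> 0 dvd homog_det_divisor H j"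
      using normal_rank_homogenize[OF H, of j] by (simp add: dvd_homog_det_divisor_iff)
    then have "homog_det_divisor H j \<noteq> 0" by auto
    then show "divides_minors (linear_form \<mu> ^ e) j (homogenize H) \<longleftrightarrow> e \<le> ord (homog_det_divisor H j)"
      by (simp add: power_dvd_iff_le_ord[symmetric] dvd_homog_det_divisor_iff)
  next
    fix j assume "normal_rank H < j"
    then show "divides_minors 0 j (homogenize H)" using normal_rank_homogenize[OF H] by blast
  qed
qed

text \<open>
  The partial multiplicities at \<open>\<mu>\<close> are the gaps in reverse order, so \<open>w\<^sub>i\<close> counts the gaps of size
  at least \<open>i\<close>.
\<close>

lemma weyr_eq:
  assumes H: "matrix_pencil m n H" and i: "i \<ge> 1"
  shows "weyr H \<mu> i + prime_order.small_gaps i (normal_rank H)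
    (\<lambda>j. prime_order.ord (linear_form \<mu>) (homog_det_divisor H j)) = normal_rank H"
proof -
  interpret prime_order "linear_form \<mu>" by (rule linear_form_prime_order)
  define \<rho> where "\<rho> = normal_rank H"
  define \<nu> where "\<nu> = (\<lambda>j. ord (homog_det_divisor H j))"
  have A: "homogenize H \<in> carrier_mat m n" using H by (simp add: matrix_pencil_def homogenize_def)
  have gap: "(GREATEST e. linear_form \<mu> ^ e dvd homog_inv_factor H j) = \<nu> j - \<nu> (j - 1)" if j: "j \<in> {1..\<rho>}" for j
  proof -
    let ?D = "homog_det_divisor H"
    have nz: "?D j \<noteq> 0" using j normal_rank_homogenize[OF H, of j] dvd_homog_det_divisor_iff[of 0 H j]
      by (auto simp: \<rho>_def)
    have "divides_minors (?D (j - 1)) (j - 1) (homogenize H)"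
      using dvd_homog_det_divisor_iff[of "?D (j - 1)" H "j - 1"] by simp
    then have "divides_minors (?D (j - 1)) j (homogenize H)"
      using divides_minors_mono[OF A] by (meson diff_le_self)
    then have "?D (j - 1) dvd ?D j" by (simp add: dvd_homog_det_divisor_iff)
    then have eq: "?D j = homog_inv_factor H j * ?D (j - 1)" by (simp add: homog_inv_factor_def)
    then have "\<nu> j = ord (homog_inv_factor H j) + \<nu> (j - 1)"
      unfolding \<nu>_def using ord_mult[of "homog_inv_factor H j" "?D (j - 1)"] nz by auto
    then show ?thesis by (simp add: ord_def)
  qed
  have "weyr H \<mu> i = card {k \<in> {1..}. i \<le> part_mult H \<mu> k}" by (simp add: weyr_def conjugate_def)
  also have "{k \<in> {1..}. i \<le> part_mult H \<mu> k} = {k \<in> {1..\<rho>}. i \<le> \<nu> (\<rho> - k + 1) - \<nu> (\<rho> - k)}"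
  proof -
    have "part_mult H \<mu> k = \<nu> (\<rho> - k + 1) - \<nu> (\<rho> - k)" if "k \<in> {1..\<rho>}" for k
      using gap[of "\<rho> - k + 1"] that by (auto simp: part_mult_def \<rho>_def)
    moreover have "part_mult H \<mu> k = 0" if "\<rho> < k" for k using that by (simp add: part_mult_def \<rho>_def)
    moreover have "k \<in> {1..\<rho>} \<or> \<rho> < k" if "k \<in> {1..}" for k using that by auto
    ultimately show ?thesis using i by fastforce
  qed
  also have "card \<dots> = card {j \<in> {1..\<rho>}. i \<le> \<nu> j - \<nu> (j - 1)}"
  proof (rule bij_betw_same_card[of "\<lambda>k. \<rho> - k + 1"])
    show "bij_betw (\<lambda>k. \<rho> - k + 1) {k \<in> {1..\<rho>}. i \<le> \<nu> (\<rho> - k + 1) - \<nu> (\<rho> - k)} {j \<in> {1..\<rho>}. i \<le> \<nu> j - \<nu> (j - 1)}"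
      by (rule bij_betw_byWitness[where f' = "\<lambda>k. \<rho> - k + 1"]) (auto simp: Suc_diff_Suc)
  qed
  finally have w: "weyr H \<mu> i = card {j \<in> {1..\<rho>}. i \<le> \<nu> j - \<nu> (j - 1)}" .
  let ?A = "{j \<in> {1..\<rho>}. i \<le> \<nu> j - \<nu> (j - 1)}" and ?B = "{j \<in> {1..\<rho>}. \<nu> j - \<nu> (j - 1) < i}"
  have "card ?A + card ?B = card (?A \<union> ?B)"
    by (rule card_Un_disjoint[symmetric]) (simp, simp, auto)
  also have "?A \<union> ?B = {1..\<rho>}" by auto
  finally have "card ?A + card ?B = \<rho>" by simp
  then show ?thesis by (simp add: w small_gaps_def \<rho>_def \<nu>_def)
qed

lemma weyr_rank_one_update:
  assumes H: "matrix_pencil m n H" and H': "matrix_pencil m n H'" and i: "i \<ge> 1"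
    and eq: "\<And>a b. a < m \<Longrightarrow> b < n \<Longrightarrow> H' $$ (a, b) = H $$ (a, b) + x a * [:y b:]"
  shows "int (weyr H \<mu> i) - int (normal_rank H) \<le> int (weyr H' \<mu> i) - int (normal_rank H') + 1"
proof -
  interpret prime_order "linear_form \<mu>" by (rule linear_form_prime_order)
  have A: "homogenize H \<in> carrier_mat m n" "homogenize H' \<in> carrier_mat m n"
    using H H' by (auto simp: matrix_pencil_def homogenize_def)
  have "small_gaps i (normal_rank H') (\<lambda>j. ord (homog_det_divisor H' j))
    \<le> Suc (small_gaps i (normal_rank H) (\<lambda>j. ord (homog_det_divisor H j)))"
  proof (rule small_gaps_rank_one_update[OF A minor_orders_homogenize[OF H] minor_orders_homogenize[OF H']])
    fix a b assume ab: "a < m" "b < n"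
    show "homogenize H' $$ (a, b) = homogenize H $$ (a, b) + [:monom (coeff (x a) 0) 1, [:coeff (x a) 1:]:] * [:[:y b:]:]"
      using H H' ab by (auto simp: matrix_pencil_def homogenize_def eq add_monom[symmetric] smult_monom
        mult.commute[of "y b"])
  qed
  then show ?thesis using weyr_eq[OF H i, of \<mu>] weyr_eq[OF H' i, of \<mu>] by linarith
qed

section \<open>Polynomial null bases\<close>

definition lin_indep :: "nat \<Rightarrow> 'b :: comm_ring_1 vec set \<Rightarrow> bool" where
  "lin_indep n X \<longleftrightarrow> (\<forall>a. (\<forall>i<n. (\<Sum>x\<in>X. a x * x $ i) = 0) \<longrightarrow> (\<forall>x\<in>X. a x = 0))"

text \<open>
  A basis of the null space over the field of fractions, described without fractions.
\<close>

definition quasi_basis :: "'b :: comm_ring_1 mat \<Rightarrow> 'b vec set \<Rightarrow> bool" where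
  "quasi_basis A X \<longleftrightarrow> finite X \<and> X \<subseteq> mat_kernel A \<and> lin_indep (dim_col A) X \<and>
     (\<forall>y \<in> mat_kernel A. \<exists>q a. q \<noteq> 0 \<and> (\<forall>i<dim_col A. q * y $ i = (\<Sum>x\<in>X. a x * x $ i)))"

lemma lin_indepD:
  assumes "lin_indep n X" "\<And>i. i < n \<Longrightarrow> (\<Sum>x\<in>X. a x * x $ i) = 0" "x \<in> X"
  shows "a x = 0"
  using assms unfolding lin_indep_def by blast

lemma kernel_basis_iff_quasi_basis:
  fixes A :: "'k :: field mat"
  assumes A: "A \<in> carrier_mat nr n" and X: "finite X"
  shows "kernel.basis n A X \<longleftrightarrow> quasi_basis A X"
proof -
  interpret kernel nr n A by standard (rule A)
  have n: "dim_col A = n" using A by simp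
  have lc: "lincomb a X = 0\<^sub>v n \<longleftrightarrow> (\<forall>i<n. (\<Sum>x\<in>X. a x * x $ i) = 0)" if "X \<subseteq> mat_kernel A" for a
  proof -
    have "lincomb a X \<in> mat_kernel A" by (rule Ker.lincomb_closed[OF that]) simp
    then have "lincomb a X \<in> carrier_vec n" using mat_kernel_carrier[OF A] by auto
    then have "lincomb a X = 0\<^sub>v n \<longleftrightarrow> (\<forall>i<n. lincomb a X $ i = 0)"
      by (metis carrier_vecD eq_vecI index_zero_vec(1) index_zero_vec(2))
    then show ?thesis using lincomb_index[OF _ that] by auto
  qed
  have indpt: "lin_indpt X \<longleftrightarrow> lin_indep n X" if sub: "X \<subseteq> mat_kernel A"
  proof
    assume li: "lin_indpt X"
    show "lin_indep n X" unfolding lin_indep_def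
    proof (intro allI impI ballI)
      fix a x assume "\<forall>i<n. (\<Sum>x\<in>X. a x * x $ i) = 0" "x \<in> X"
      then have "lincomb a X = 0\<^sub>v n" using lc[OF sub] by blast
      then show "a x = 0" using li \<open>x \<in> X\<close> X unfolding Ker.lin_dep_def by auto
    qed
  next
    assume li: "lin_indep n X"
    show "lin_indpt X"
    proof (rule Ker.finite_lin_indpt2[OF X sub])
      fix a assume "lincomb a X = 0\<^sub>v n"
      then show "\<forall>v\<in>X. a v = 0" using lc[OF sub] li unfolding lin_indep_def by blast
    qed
  qed
  have gen: "Ker.span X = mat_kernel A \<longleftrightarrow>
      (\<forall>y \<in> mat_kernel A. \<exists>q a. q \<noteq> 0 \<and> (\<forall>i<n. q * y $ i = (\<Sum>x\<in>X. a x * x $ i)))"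
    if sub: "X \<subseteq> mat_kernel A"
  proof
    assume sp: "Ker.span X = mat_kernel A"
    show "\<forall>y \<in> mat_kernel A. \<exists>q a. q \<noteq> 0 \<and> (\<forall>i<n. q * y $ i = (\<Sum>x\<in>X. a x * x $ i))"
    proof
      fix y assume "y \<in> mat_kernel A"
      then obtain a where "lincomb a X = y" using Ker.finite_in_span[OF X sub] sp by blast
      then have "\<forall>i<n. 1 * y $ i = (\<Sum>x\<in>X. a x * x $ i)" using lincomb_index[OF _ sub] by auto
      then show "\<exists>q a. q \<noteq> 0 \<and> (\<forall>i<n. q * y $ i = (\<Sum>x\<in>X. a x * x $ i))"
        by (intro exI[of _ 1] exI[of _ a]) simp
    qed
  next
    assume g: "\<forall>y \<in> mat_kernel A. \<exists>q a. q \<noteq> 0 \<and> (\<forall>i<n. q * y $ i = (\<Sum>x\<in>X. a x * x $ i))"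
    show "Ker.span X = mat_kernel A"
    proof
      show "Ker.span X \<subseteq> mat_kernel A" by (rule Ker.span_is_subset2[OF sub])
      show "mat_kernel A \<subseteq> Ker.span X"
      proof
        fix y assume y: "y \<in> mat_kernel A"
        then obtain q a where q: "q \<noteq> 0" "\<And>i. i < n \<Longrightarrow> q * y $ i = (\<Sum>x\<in>X. a x * x $ i)"
          using g by blast
        have "lincomb (\<lambda>x. a x / q) X = y"
        proof (rule eq_vecI)
          have "lincomb (\<lambda>x. a x / q) X \<in> mat_kernel A" by (rule Ker.lincomb_closed[OF sub]) simp
          then show d: "dim_vec (lincomb (\<lambda>x. a x / q) X) = dim_vec y"
            using y mat_kernel_carrier[OF A] by (metis carrier_vecD subsetD)
          fix i assume "i < dim_vec y"
          then have i: "i < n" using y mat_kernel_carrier[OF A] by auto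
          have "q * (\<Sum>x\<in>X. a x / q * x $ i) = (\<Sum>x\<in>X. a x * x $ i)"
            unfolding sum_distrib_left by (rule sum.cong) (use q in auto)
          then have "q * (\<Sum>x\<in>X. a x / q * x $ i) = q * y $ i" using q(2)[OF i] by simp
          then show "lincomb (\<lambda>x. a x / q) X $ i = y $ i"
            using q(1) lincomb_index[OF i sub] by simp
        qed
        moreover have "lincomb (\<lambda>x. a x / q) X \<in> Ker.span X"
          unfolding Ker.finite_span[OF X sub] by auto
        ultimately show "y \<in> Ker.span X" by simp
      qed
    qed
  qed
  show ?thesis
    unfolding Ker.basis_def quasi_basis_def n using X indpt gen by blast
qed

lemma card_kernel_basis_unique:
  fixes A :: "'k :: field mat"
  assumes A: "A \<in> carrier_mat nr n" and "finite X" "finite Y" "kernel.basis n A X" "kernel.basis n A Y"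
  shows "card X = card Y"
proof -
  interpret kernel nr n A by standard (rule A)
  show ?thesis using Ker.dim_basis assms by metis
qed

lemma common_denominator:
  fixes f :: "'c \<Rightarrow> 'b :: idom fract"
  assumes "finite S"
  obtains q g where "q \<noteq> 0" "\<And>x. x \<in> S \<Longrightarrow> to_fract q * f x = to_fract (g x)"
proof -
  have "\<exists>q. q \<noteq> 0 \<and> (\<forall>x\<in>S. \<exists>b. to_fract q * f x = to_fract b)"
    using assms
  proof (induction S)
    case empty
    show ?case by (rule exI[of _ 1]) simp
  next
    case (insert y S)
    then obtain q where q: "q \<noteq> 0" "\<forall>x\<in>S. \<exists>b. to_fract q * f x = to_fract b" by blast
    obtain u v where uv: "v \<noteq> 0" "f y = to_fract u / to_fract v"
      by (cases "f y") (auto simp: Fract_conv_to_fract)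
    have "\<exists>b. to_fract (q * v) * f x = to_fract b" if "x \<in> insert y S" for x
    proof (cases "x = y")
      case True
      have "to_fract (q * v) * f x = to_fract (q * u)" using uv True by (simp add: to_fract_eq_0_iff)
      then show ?thesis ..
    next
      case False
      then obtain b where "to_fract q * f x = to_fract b" using q \<open>x \<in> _\<close> by blast
      moreover have "to_fract (q * v) * f x = to_fract v * (to_fract q * f x)"
        by (simp add: to_fract_hom.hom_mult)
      ultimately have "to_fract (q * v) * f x = to_fract (v * b)"
        by (simp add: to_fract_hom.hom_mult)
      then show ?thesis ..
    qed
    then show ?case using q uv by (intro exI[of _ "q * v"]) simp
  qed
  then obtain q where q: "q \<noteq> 0" "\<forall>x\<in>S. \<exists>b. to_fract q * f x = to_fract b" by blast
  from bchoice[OF q(2)] show ?thesis using that q(1) by blast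
qed

lemma map_vec_to_fract_inj: "map_vec to_fract x = map_vec to_fract y \<longleftrightarrow> x = y"
  by (auto simp: vec_eq_iff)

lemma map_vec_to_fract_mem_kernel:
  assumes "x \<in> carrier_vec (dim_col H)"
  shows "map_vec to_fract x \<in> mat_kernel (map_mat to_fract H) \<longleftrightarrow> x \<in> mat_kernel H"
proof -
  have "map_mat to_fract H *\<^sub>v map_vec to_fract x = map_vec to_fract (H *\<^sub>v x)"
    using to_fract_hom.mult_mat_vec_hom[of H "dim_row H" "dim_col H" x] assms by auto
  moreover have "0\<^sub>v (dim_row H) = map_vec to_fract (0\<^sub>v (dim_row H))" by auto
  ultimately show ?thesis
    using assms unfolding mat_kernel_def by (simp add: map_vec_to_fract_inj)
qed

text \<open>
  Clear denominators.
\<close>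

lemma quasi_basis_map_to_fract:
  fixes H :: "'b :: idom mat"
  assumes X: "finite X" "X \<subseteq> carrier_vec (dim_col H)"
  shows "quasi_basis (map_mat to_fract H) (map_vec to_fract ` X) \<longleftrightarrow> quasi_basis H X"
proof -
  let ?n = "dim_col H" and ?h = "map_vec to_fract :: 'b vec \<Rightarrow> _"
  have inj: "inj_on ?h X" by (simp add: inj_on_def map_vec_to_fract_inj)
  have sum: "(\<Sum>x\<in>?h ` X. a x * x $ i) = (\<Sum>x\<in>X. a (?h x) * to_fract (x $ i))" if "i < ?n" for a i
    unfolding sum.reindex[OF inj] using X that by (auto intro!: sum.cong)
  have sub: "?h ` X \<subseteq> mat_kernel (map_mat to_fract H) \<longleftrightarrow> X \<subseteq> mat_kernel H"
    using map_vec_to_fract_mem_kernel[of _ H] X by blast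
  have indep: "lin_indep ?n (?h ` X) \<longleftrightarrow> lin_indep ?n X"
  proof
    assume L: "lin_indep ?n (?h ` X)"
    show "lin_indep ?n X" unfolding lin_indep_def
    proof (intro allI impI ballI)
      fix a x assume a: "\<forall>i<?n. (\<Sum>x\<in>X. a x * x $ i) = 0" and x: "x \<in> X"
      define a' where "a' = (\<lambda>y. to_fract (a (the_inv_into X ?h y)))"
      have a': "a' (?h x) = to_fract (a x)" if "x \<in> X" for x
        by (simp add: a'_def the_inv_into_f_f[OF inj that])
      have "(\<Sum>x\<in>?h ` X. a' x * x $ i) = 0" if "i < ?n" for i
      proof -
        have "(\<Sum>x\<in>?h ` X. a' x * x $ i) = to_fract (\<Sum>x\<in>X. a x * x $ i)"
          unfolding sum[OF that] to_fract_hom.hom_sum by (rule sum.cong) (auto simp: a' to_fract_hom.hom_mult)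
        then show ?thesis using a that by simp
      qed
      then have "a' (?h x) = 0" by (rule lin_indepD[OF L]) (use x in auto)
      then show "a x = 0" using a'[OF x] by simp
    qed
  next
    assume L: "lin_indep ?n X"
    show "lin_indep ?n (?h ` X)" unfolding lin_indep_def
    proof (intro allI impI ballI)
      fix a y assume a: "\<forall>i<?n. (\<Sum>x\<in>?h ` X. a x * x $ i) = 0" and "y \<in> ?h ` X"
      then obtain x where x: "x \<in> X" "y = ?h x" by blast
      obtain q b where q: "q \<noteq> 0" "\<And>x. x \<in> X \<Longrightarrow> to_fract q * a (?h x) = to_fract (b x)"
        using common_denominator[OF X(1), of "\<lambda>x. a (?h x)"] by blast
      have "(\<Sum>x\<in>X. b x * x $ i) = 0" if "i < ?n" for i
      proof -
        have "to_fract (\<Sum>x\<in>X. b x * x $ i) = (\<Sum>x\<in>X. to_fract q * a (?h x) * to_fract (x $ i))"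
          unfolding to_fract_hom.hom_sum by (rule sum.cong) (auto simp: q(2) to_fract_hom.hom_mult)
        also have "\<dots> = to_fract q * (\<Sum>x\<in>?h ` X. a x * x $ i)"
          unfolding sum[OF that] by (simp add: sum_distrib_left mult.assoc)
        also have "\<dots> = 0" using a that by simp
        finally show ?thesis by (simp only: to_fract_eq_0_iff)
      qed
      then have "b x = 0" by (rule lin_indepD[OF L]) (use x in auto)
      then show "a y = 0" using q(1) q(2)[OF x(1)] x(2) by simp
    qed
  qed
  have gen: "(\<forall>y \<in> mat_kernel (map_mat to_fract H). \<exists>q a. q \<noteq> 0 \<and>
        (\<forall>i<?n. q * y $ i = (\<Sum>x\<in>?h ` X. a x * x $ i))) \<longleftrightarrow>
      (\<forall>y \<in> mat_kernel H. \<exists>q a. q \<noteq> 0 \<and> (\<forall>i<?n. q * y $ i = (\<Sum>x\<in>X. a x * x $ i)))" (is "?L \<longleftrightarrow> ?R")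
  proof
    assume L: ?L
    show ?R
    proof
      fix y assume y: "y \<in> mat_kernel H"
      then have yc: "y \<in> carrier_vec ?n" by (auto simp: mat_kernel_def)
      then have "?h y \<in> mat_kernel (map_mat to_fract H)" using y map_vec_to_fract_mem_kernel by blast
      then obtain q a where q: "q \<noteq> 0" "\<And>i. i < ?n \<Longrightarrow> q * ?h y $ i = (\<Sum>x\<in>?h ` X. a x * x $ i)"
        using L by blast
      obtain q' b where q': "q' \<noteq> 0" "\<And>x. x \<in> insert None (Some ` X) \<Longrightarrow>
          to_fract q' * (case x of None \<Rightarrow> q | Some x \<Rightarrow> a (?h x)) = to_fract (b x)"
        using common_denominator[of "insert None (Some ` X)" "\<lambda>x. case x of None \<Rightarrow> q | Some x \<Rightarrow> a (?h x)"] X(1)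
        by blast
      have bN: "to_fract (b None) = to_fract q' * q" using q'(2)[of None] by simp
      have bS: "to_fract (b (Some x)) = to_fract q' * a (?h x)" if "x \<in> X" for x
        using q'(2)[of "Some x"] that by simp
      have "b None \<noteq> 0" using bN q(1) q'(1) by auto
      moreover have "b None * y $ i = (\<Sum>x\<in>X. b (Some x) * x $ i)" if i: "i < ?n" for i
      proof -
        have "to_fract (b None * y $ i) = to_fract q' * (q * ?h y $ i)"
          using i yc by (simp add: to_fract_hom.hom_mult bN mult.assoc)
        also have "\<dots> = (\<Sum>x\<in>X. to_fract q' * a (?h x) * to_fract (x $ i))"
          unfolding q(2)[OF i] sum[OF i] by (simp add: sum_distrib_left mult.assoc)
        also have "\<dots> = to_fract (\<Sum>x\<in>X. b (Some x) * x $ i)"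
          unfolding to_fract_hom.hom_sum by (rule sum.cong) (auto simp: bS to_fract_hom.hom_mult)
        finally show ?thesis by (simp only: to_fract_eq_iff)
      qed
      ultimately show "\<exists>q a. q \<noteq> 0 \<and> (\<forall>i<?n. q * y $ i = (\<Sum>x\<in>X. a x * x $ i))"
        by (intro exI[of _ "b None"] exI[of _ "\<lambda>x. b (Some x)"]) blast
    qed
  next
    assume R: ?R
    show ?L
    proof
      fix y assume y: "y \<in> mat_kernel (map_mat to_fract H)"
      then have yc: "y \<in> carrier_vec ?n" by (auto simp: mat_kernel_def)
      obtain q' b where q': "q' \<noteq> 0" "\<And>i. i \<in> {..<?n} \<Longrightarrow> to_fract q' * y $ i = to_fract (b i)"
        using common_denominator[of "{..<?n}" "\<lambda>i. y $ i"] by blast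
      have hb: "?h (vec ?n b) = to_fract q' \<cdot>\<^sub>v y"
        by (rule eq_vecI) (use yc q'(2) in auto)
      have "?h (vec ?n b) \<in> mat_kernel (map_mat to_fract H)"
        unfolding hb by (rule mat_kernel_smult[OF _ y]) auto
      then have "vec ?n b \<in> mat_kernel H" using map_vec_to_fract_mem_kernel[of "vec ?n b" H] by simp
      then obtain q a where q: "q \<noteq> 0" "\<And>i. i < ?n \<Longrightarrow> q * vec ?n b $ i = (\<Sum>x\<in>X. a x * x $ i)"
        using R by blast
      define a' where "a' = (\<lambda>y. to_fract (a (the_inv_into X ?h y)))"
      have a': "a' (?h x) = to_fract (a x)" if "x \<in> X" for x
        by (simp add: a'_def the_inv_into_f_f[OF inj that])
      have "to_fract (q * q') * y $ i = (\<Sum>x\<in>?h ` X. a' x * x $ i)" if i: "i < ?n" for i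
      proof -
        have "to_fract (q * q') * y $ i = to_fract q * (to_fract q' * y $ i)" by (simp add: to_fract_hom.hom_mult mult.assoc)
        also have "\<dots> = to_fract (q * vec ?n b $ i)" using i q'(2)[of i] by (simp add: to_fract_hom.hom_mult)
        also have "\<dots> = (\<Sum>x\<in>?h ` X. a' x * x $ i)"
          unfolding q(2)[OF i] sum[OF i] to_fract_hom.hom_sum by (rule sum.cong) (auto simp: a' to_fract_hom.hom_mult)
        finally show ?thesis .
      qed
      then show "\<exists>q a. q \<noteq> 0 \<and> (\<forall>i<?n. q * y $ i = (\<Sum>x\<in>?h ` X. a x * x $ i))"
        using q(1) q'(1) by (intro exI[of _ "to_fract (q * q')"] exI[of _ a']) simp
    qed
  qed
  show ?thesis unfolding quasi_basis_def using X sub indep gen by (simp add: finite_imageI)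
qed

lemma polynomial_null_basis_iff:
  "polynomial_null_basis H X \<longleftrightarrow> quasi_basis H X"
proof (cases "finite X \<and> X \<subseteq> carrier_vec (dim_col H)")
  case True
  have "map_mat to_fract H \<in> carrier_mat (dim_row H) (dim_col H)" by simp
  from kernel_basis_iff_quasi_basis[OF this] True show ?thesis
    unfolding polynomial_null_basis_def by (simp add: quasi_basis_map_to_fract)
next
  case False
  then show ?thesis unfolding polynomial_null_basis_def quasi_basis_def by (auto simp: mat_kernel_def)
qed

lemma card_quasi_basis_unique:
  fixes H :: "'a :: field poly mat"
  assumes X: "quasi_basis H X" and Y: "quasi_basis H Y"
  shows "card X = card Y"
proof -
  have "polynomial_null_basis H X" "polynomial_null_basis H Y" using X Y polynomial_null_basis_iff by blast+
  then have "card (map_vec to_fract ` X) = card (map_vec to_fract ` Y)"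
    unfolding polynomial_null_basis_def
    by (intro card_kernel_basis_unique[of "map_mat to_fract H" "dim_row H" "dim_col H"]) auto
  moreover have "card (map_vec to_fract ` Z) = card Z" for Z :: "'a poly vec set"
    by (rule card_image) (simp add: inj_on_def map_vec_to_fract_inj)
  ultimately show ?thesis by simp
qed

section \<open>Cramer's rule and the size of a null basis\<close>

lemma mem_mat_kernel_iff:
  assumes A: "A \<in> carrier_mat m n"
  shows "x \<in> mat_kernel A \<longleftrightarrow> x \<in> carrier_vec n \<and> (\<forall>a<m. (\<Sum>j<n. A $$ (a, j) * x $ j) = 0)"
proof (cases "x \<in> carrier_vec n")
  case True
  have "(A *\<^sub>v x) $ a = (\<Sum>j<n. A $$ (a, j) * x $ j)" if "a < m" for a
    using that A True by (auto simp: scalar_prod_def atLeast0LessThan intro!: sum.cong)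
  then have "A *\<^sub>v x = 0\<^sub>v m \<longleftrightarrow> (\<forall>a<m. (\<Sum>j<n. A $$ (a, j) * x $ j) = 0)"
    using A by (auto simp: vec_eq_iff)
  then show ?thesis using True A by (auto simp: mat_kernel_def)
qed (use A in \<open>auto simp: mat_kernel_def\<close>)

text \<open>
  Fix a nonzero minor \<open>\<Delta>\<close> of maximal order, with columns \<open>J\<close>. For every column \<open>y\<close> outside \<open>J\<close>,
  the bordered minors with column \<open>y\<close> vanish; their expansions along the added row have
  coefficients that do not depend on this row, so these coefficients form a null vector supported
  on \<open>J\<close> and \<open>y\<close>, with entry \<open>\<Delta>\<close> at \<open>y\<close>. Subtracting a combination of these vectors from \<open>\<Delta> z\<close>,
  for a null vector \<open>z\<close>, leaves a null vector supported on \<open>J\<close>, and this is zero.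
\<close>

lemma cramer_quasi_basis:
  fixes H :: "'b :: idom mat"
  assumes H: "H \<in> carrier_mat m n"
  obtains X where "quasi_basis H X" "card X = n - normal_rank H"
proof -
  define \<rho> where "\<rho> = normal_rank H"
  have "\<not> divides_minors 0 \<rho> H" using normal_rank_less_iff[OF H, of \<rho>] by (simp add: \<rho>_def)
  then obtain f g where f: "\<And>a. a < \<rho> \<Longrightarrow> f a < m" and g: "\<And>a. a < \<rho> \<Longrightarrow> g a < n"
    and W: "det (select H \<rho> f g) \<noteq> 0"
    unfolding divides_minors_iff[OF H] by auto
  have inj: "inj_on g {..<\<rho>}"
  proof (rule inj_onI, rule ccontr)
    fix a b assume ab: "a \<in> {..<\<rho>}" "b \<in> {..<\<rho>}" "g a = g b" "a \<noteq> b"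
    then have "det (select H \<rho> f g) = 0"
      by (intro det_identical_columns[OF select_carrier, of a b]) (auto simp: select_def col_def)
    then show False using W by simp
  qed
  define J where "J = g ` {..<\<rho>}"
  have J: "J \<subseteq> {..<n}" "card J = \<rho>" using g inj by (auto simp: J_def card_image)
  define cof where "cof = (\<lambda>y b. (- 1) ^ (\<rho> + b) * det (select H \<rho> f (\<lambda>c. (g(\<rho> := y)) (if c < b then c else Suc c))))"
  have cof_last: "cof y \<rho> = det (select H \<rho> f g)" for y
  proof -
    have "select H \<rho> f (\<lambda>c. (g(\<rho> := y)) (if c < \<rho> then c else Suc c)) = select H \<rho> f g"
      by (rule eq_matI) (auto simp: select_def)
    then show ?thesis by (simp add: cof_def)
  qed
  have border: "(\<Sum>b<\<rho>. H $$ (x, g b) * cof y b) + H $$ (x, y) * cof y \<rho> = 0" if xy: "x < m" "y < n" for x y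
  proof -
    let ?M = "select H (Suc \<rho>) (f(\<rho> := x)) (g(\<rho> := y))"
    have "divides_minors 0 (Suc \<rho>) H" using normal_rank_less_iff[OF H, of "Suc \<rho>"] by (simp add: \<rho>_def)
    then have "0 dvd det ?M"
      by (rule divides_minorsD[OF _ H]) (use xy f g in \<open>auto simp: less_Suc_eq\<close>)
    then have "0 = (\<Sum>b<Suc \<rho>. ?M $$ (\<rho>, b) * cofactor ?M \<rho> b)"
      using laplace_expansion_row[OF select_carrier, of \<rho> "Suc \<rho>" H "f(\<rho> := x)" "g(\<rho> := y)"] by simp
    also have "\<dots> = (\<Sum>b<Suc \<rho>. H $$ (x, (g(\<rho> := y)) b) * cof y b)"
    proof (rule sum.cong[OF refl])
      fix b assume b: "b \<in> {..<Suc \<rho>}"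
      have "select H \<rho> (\<lambda>a. (f(\<rho> := x)) (if a < \<rho> then a else Suc a)) (\<lambda>c. (g(\<rho> := y)) (if c < b then c else Suc c)) =
        select H \<rho> f (\<lambda>c. (g(\<rho> := y)) (if c < b then c else Suc c))"
        by (rule eq_matI) (auto simp: select_def)
      then have "cofactor ?M \<rho> b = cof y b" by (simp add: cofactor_def mat_delete_select cof_def)
      moreover have "?M $$ (\<rho>, b) = H $$ (x, (g(\<rho> := y)) b)" using b by (simp add: select_def)
      ultimately show "?M $$ (\<rho>, b) * cofactor ?M \<rho> b = H $$ (x, (g(\<rho> := y)) b) * cof y b" by simp
    qed
    finally show ?thesis by (simp add: less_imp_neq)
  qed
  define w where "w = (\<lambda>y. vec n (\<lambda>c. if c = y then cof y \<rho> else if c \<in> J then cof y (the_inv_into {..<\<rho>} g c) else 0))"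
  have wy: "w y $ y' = (if y' = y then det (select H \<rho> f g) else 0)"
    if "y \<in> {..<n} - J" "y' \<in> {..<n} - J" for y y'
    using that by (auto simp: w_def cof_last)
  have ker: "w y \<in> mat_kernel H" if y: "y \<in> {..<n} - J" for y
    unfolding mem_mat_kernel_iff[OF H]
  proof (intro conjI allI impI)
    fix x assume x: "x < m"
    have "(\<Sum>j<n. H $$ (x, j) * w y $ j) = (\<Sum>j\<in>insert y J. H $$ (x, j) * w y $ j)"
      by (rule sum.mono_neutral_right) (use J y in \<open>auto simp: w_def\<close>)
    also have "\<dots> = H $$ (x, y) * w y $ y + (\<Sum>j\<in>J. H $$ (x, j) * w y $ j)"
      by (rule sum.insert) (use J y in \<open>auto intro: finite_subset\<close>)
    also have "(\<Sum>j\<in>J. H $$ (x, j) * w y $ j) = (\<Sum>b<\<rho>. H $$ (x, g b) * w y $ g b)"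
      unfolding J_def by (subst sum.reindex[OF inj]) simp
    also have "\<dots> = (\<Sum>b<\<rho>. H $$ (x, g b) * cof y b)"
      by (rule sum.cong) (use y g in \<open>auto simp: w_def J_def the_inv_into_f_f[OF inj]\<close>)
    also have "w y $ y = cof y \<rho>" using y by (simp add: w_def)
    finally show "(\<Sum>j<n. H $$ (x, j) * w y $ j) = 0" using border[OF x, of y] y by (simp add: add.commute)
  qed (simp add: w_def)
  let ?X = "w ` ({..<n} - J)"
  have injw: "inj_on w ({..<n} - J)"
  proof (rule inj_onI, rule ccontr)
    fix y y' assume y: "y \<in> {..<n} - J" "y' \<in> {..<n} - J" "w y = w y'" "y \<noteq> y'"
    then have "w y $ y = w y' $ y" by simp
    then show False using wy[OF y(1,1)] wy[OF y(2,1)] y(4) W by simp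
  qed
  have sumw: "(\<Sum>x\<in>?X. a x * x $ i) = (\<Sum>y\<in>{..<n} - J. a (w y) * w y $ i)" for a i
    by (subst sum.reindex[OF injw]) simp
  have comp: "(\<Sum>y\<in>{..<n} - J. c y * w y $ z) = c z * det (select H \<rho> f g)" if z: "z \<in> {..<n} - J" for c z
  proof -
    have "(\<Sum>y\<in>{..<n} - J. c y * w y $ z) = (\<Sum>y\<in>{..<n} - J. if y = z then c y * det (select H \<rho> f g) else 0)"
      by (rule sum.cong) (use z in \<open>auto simp: wy\<close>)
    then show ?thesis using z by simp
  qed
  have "quasi_basis H ?X"
    unfolding quasi_basis_def
  proof (intro conjI ballI)
    show "lin_indep (dim_col H) ?X" unfolding lin_indep_def
    proof (intro allI impI ballI)
      fix a x assume a: "\<forall>i<dim_col H. (\<Sum>x\<in>?X. a x * x $ i) = 0" and "x \<in> ?X"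
      then obtain z where z: "z \<in> {..<n} - J" "x = w z" by blast
      have "(\<Sum>y\<in>{..<n} - J. a (w y) * w y $ z) = 0" using a z H sumw by auto
      then show "a x = 0" using comp[OF z(1), of "\<lambda>y. a (w y)"] W z(2) by simp
    qed
  next
    fix y assume "y \<in> mat_kernel H"
    then have yc: "y \<in> carrier_vec n" and yk: "\<And>x. x < m \<Longrightarrow> (\<Sum>j<n. H $$ (x, j) * y $ j) = 0"
      unfolding mem_mat_kernel_iff[OF H] by auto
    let ?\<Delta> = "det (select H \<rho> f g)"
    define z where "z = (\<lambda>j. ?\<Delta> * y $ j - (\<Sum>c\<in>{..<n} - J. y $ c * w c $ j))"
    have z0: "z j = 0" if "j \<in> {..<n} - J" for j
      using comp[OF that, of "\<lambda>c. y $ c"] by (simp add: z_def mult.commute)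
    have zk: "(\<Sum>j<n. H $$ (x, j) * z j) = 0" if x: "x < m" for x
    proof -
      have "(\<Sum>j<n. H $$ (x, j) * (\<Sum>c\<in>{..<n} - J. y $ c * w c $ j)) =
          (\<Sum>j<n. \<Sum>c\<in>{..<n} - J. y $ c * (H $$ (x, j) * w c $ j))"
        by (simp add: sum_distrib_left mult.left_commute)
      also have "\<dots> = (\<Sum>c\<in>{..<n} - J. y $ c * (\<Sum>j<n. H $$ (x, j) * w c $ j))"
        by (subst sum.swap) (simp add: sum_distrib_left)
      also have "\<dots> = 0"
        by (rule sum.neutral) (use ker x in \<open>auto simp: mem_mat_kernel_iff[OF H]\<close>)
      finally have e: "(\<Sum>j<n. H $$ (x, j) * (\<Sum>c\<in>{..<n} - J. y $ c * w c $ j)) = 0" .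
      have "(\<Sum>j<n. H $$ (x, j) * z j) = ?\<Delta> * (\<Sum>j<n. H $$ (x, j) * y $ j)
          - (\<Sum>j<n. H $$ (x, j) * (\<Sum>c\<in>{..<n} - J. y $ c * w c $ j))"
        by (simp add: z_def right_diff_distrib sum_subtractf sum_distrib_left mult.left_commute)
      then show ?thesis using e yk[OF x] by simp
    qed
    have zJ: "z (g b) = 0" if b: "b < \<rho>" for b
    proof -
      have "select H \<rho> f g *\<^sub>v vec \<rho> (\<lambda>b. z (g b)) = 0\<^sub>v \<rho>"
      proof (rule eq_vecI)
        fix a assume "a < dim_vec (0\<^sub>v \<rho> :: 'b vec)"
        then have a: "a < \<rho>" by simp
        have "(select H \<rho> f g *\<^sub>v vec \<rho> (\<lambda>b. z (g b))) $ a = (\<Sum>b<\<rho>. H $$ (f a, g b) * z (g b))"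
          using a by (auto simp: select_def scalar_prod_def atLeast0LessThan intro!: sum.cong)
        also have "\<dots> = (\<Sum>j\<in>J. H $$ (f a, j) * z j)"
          unfolding J_def by (subst sum.reindex[OF inj]) simp
        also have "\<dots> = (\<Sum>j<n. H $$ (f a, j) * z j)"
          by (rule sum.mono_neutral_left) (use J z0 in auto)
        also have "\<dots> = 0" by (rule zk) (rule f[OF a])
        finally show "(select H \<rho> f g *\<^sub>v vec \<rho> (\<lambda>b. z (g b))) $ a = 0\<^sub>v \<rho> $ a" using a by simp
      qed (simp add: select_def)
      then have "vec \<rho> (\<lambda>b. z (g b)) = 0\<^sub>v \<rho>"
        using W det_0_iff_vec_prod_zero[OF select_carrier, of H \<rho> f g] vec_carrier by blast
      then show ?thesis using b by (metis index_vec index_zero_vec(1))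
    qed
    have "z j = 0" if "j < n" for j
      using z0[of j] zJ that by (cases "j \<in> J") (auto simp: J_def)
    then have "?\<Delta> * y $ j = (\<Sum>c\<in>{..<n} - J. y $ c * w c $ j)" if "j < n" for j
      using that by (simp add: z_def)
    moreover have "(\<Sum>x\<in>?X. y $ (the_inv_into ({..<n} - J) w x) * x $ j) = (\<Sum>c\<in>{..<n} - J. y $ c * w c $ j)" for j
      unfolding sumw by (rule sum.cong) (auto simp: the_inv_into_f_f[OF injw])
    ultimately show "\<exists>q a. q \<noteq> 0 \<and> (\<forall>i<dim_col H. q * y $ i = (\<Sum>x\<in>?X. a x * x $ i))"
      using W H by (intro exI[of _ ?\<Delta>] exI[of _ "\<lambda>x. y $ (the_inv_into ({..<n} - J) w x)"]) auto
  qed (use ker in auto)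
  moreover have "card ?X = n - \<rho>"
    using J by (simp add: card_image[OF injw] card_Diff_subset finite_subset)
  ultimately show ?thesis using that unfolding \<rho>_def by blast
qed

lemma minimal_null_basis_exists: "\<exists>X. minimal_null_basis H X"
proof -
  obtain X where "quasi_basis H X" using cramer_quasi_basis[of H "dim_row H" "dim_col H"] by auto
  then have "polynomial_null_basis H X" by (simp add: polynomial_null_basis_iff)
  then show ?thesis
    using ex_has_least_nat[of "polynomial_null_basis H" X "sum vec_degree"] unfolding minimal_null_basis_def by blast
qed

lemma card_quasi_basis:
  fixes H :: "'a :: field poly mat"
  assumes H: "H \<in> carrier_mat m n" and "quasi_basis H X"
  shows "card X = n - normal_rank H"
  using cramer_quasi_basis[OF H] card_quasi_basis_unique[OF assms(2)] by metis

section \<open>Minimal bases\<close>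

lemma degree_le_vec_degree:
  assumes "i < dim_vec x"
  shows "degree (x $ i) \<le> vec_degree x"
  unfolding vec_degree_def by (rule Max_ge) (use assms in auto)

lemma vec_degree_less:
  assumes "0 < d" "\<And>i. i < dim_vec x \<Longrightarrow> degree (x $ i) < d"
  shows "vec_degree x < d"
  unfolding vec_degree_def using assms by (subst Max_less_iff) auto

lemma kernel_lincomb:
  assumes H: "H \<in> carrier_mat m n" and X: "X \<subseteq> mat_kernel H"
  shows "vec n (\<lambda>i. \<Sum>x\<in>X. a x * x $ i) \<in> mat_kernel H"
  unfolding mem_mat_kernel_iff[OF H]
proof (intro conjI allI impI)
  fix r assume r: "r < m"
  have "(\<Sum>j<n. H $$ (r, j) * vec n (\<lambda>i. \<Sum>x\<in>X. a x * x $ i) $ j) =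
      (\<Sum>j<n. \<Sum>x\<in>X. a x * (H $$ (r, j) * x $ j))"
    by (simp add: sum_distrib_left mult.left_commute)
  also have "\<dots> = (\<Sum>x\<in>X. a x * (\<Sum>j<n. H $$ (r, j) * x $ j))"
    by (subst sum.swap) (simp add: sum_distrib_left)
  also have "\<dots> = 0"
    by (rule sum.neutral) (use X r in \<open>auto simp: mem_mat_kernel_iff[OF H]\<close>)
  finally show "(\<Sum>j<n. H $$ (r, j) * vec n (\<lambda>i. \<Sum>x\<in>X. a x * x $ i) $ j) = 0" .
qed simp

text \<open>
  The Steinitz exchange step.
\<close>

lemma quasi_basis_exchange:
  fixes H :: "'b :: idom mat"
  assumes X: "quasi_basis H X" and x0: "x0 \<in> X" and y: "y \<in> mat_kernel H"
    and q: "q \<noteq> 0" "\<And>i. i < dim_col H \<Longrightarrow> q * y $ i = (\<Sum>x\<in>X. a x * x $ i)" and a: "a x0 \<noteq> 0"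
  shows "y \<notin> X - {x0}" and "quasi_basis H (insert y (X - {x0}))"
proof -
  let ?n = "dim_col H" and ?Y = "X - {x0}"
  have fin: "finite X" and sub: "X \<subseteq> mat_kernel H" and ind: "lin_indep ?n X"
    and gen: "\<forall>y \<in> mat_kernel H. \<exists>q a. q \<noteq> 0 \<and> (\<forall>i<?n. q * y $ i = (\<Sum>x\<in>X. a x * x $ i))"
    using X unfolding quasi_basis_def by blast+
  have split: "(\<Sum>x\<in>X. h x) = h x0 + (\<Sum>x\<in>?Y. h x)" for h :: "'b vec \<Rightarrow> 'b"
    by (rule sum.remove[OF fin x0])
  show nin: "y \<notin> ?Y"
  proof
    assume yY: "y \<in> ?Y"
    have "(\<Sum>x\<in>X. (a x - (if x = y then q else 0)) * x $ i) = 0" if "i < ?n" for i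
    proof -
      have "(\<Sum>x\<in>X. (a x - (if x = y then q else 0)) * x $ i)
          = (\<Sum>x\<in>X. a x * x $ i) - (\<Sum>x\<in>X. if x = y then q * y $ i else 0)"
        by (simp add: left_diff_distrib sum_subtractf if_distrib[of "\<lambda>c. c * _"] cong: if_cong)
      also have "(\<Sum>x\<in>X. if x = y then q * y $ i else 0) = q * y $ i"
        using yY fin by simp
      finally show ?thesis using q(2)[OF that] by simp
    qed
    then have "a x0 - (if x0 = y then q else 0) = 0"
      by (rule lin_indepD[OF ind _ x0])
    then show False using a yY by auto
  qed
  have ins: "(\<Sum>x\<in>insert y ?Y. h x) = h y + (\<Sum>x\<in>?Y. h x)" for h :: "'b vec \<Rightarrow> 'b"
    by (rule sum.insert) (use fin nin in auto)
  show "quasi_basis H (insert y ?Y)"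
    unfolding quasi_basis_def
  proof (intro conjI ballI)
    show "lin_indep ?n (insert y ?Y)" unfolding lin_indep_def
    proof (intro allI impI)
      fix b assume b: "\<forall>i<?n. (\<Sum>x\<in>insert y ?Y. b x * x $ i) = 0"
      have all: "b y * a x + (if x = x0 then 0 else q * b x) = 0" if "x \<in> X" for x
      proof (rule lin_indepD[OF ind _ that])
        fix i assume i: "i < ?n"
        have "(\<Sum>x\<in>X. (b y * a x + (if x = x0 then 0 else q * b x)) * x $ i) =
            b y * (\<Sum>x\<in>X. a x * x $ i) + (\<Sum>x\<in>X. (if x = x0 then 0 else q * b x) * x $ i)"
          by (simp add: distrib_right sum.distrib sum_distrib_left mult.assoc)
        also have "(\<Sum>x\<in>X. (if x = x0 then 0 else q * b x) * x $ i) = (\<Sum>x\<in>?Y. q * b x * x $ i)"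
          unfolding split by (simp cong: sum.cong_simp)
        also have "b y * (\<Sum>x\<in>X. a x * x $ i) + (\<Sum>x\<in>?Y. q * b x * x $ i) = q * (\<Sum>x\<in>insert y ?Y. b x * x $ i)"
          unfolding ins q(2)[OF i, symmetric] by (simp add: distrib_left sum_distrib_left ac_simps)
        also have "\<dots> = 0" using b i by simp
        finally show "(\<Sum>x\<in>X. (b y * a x + (if x = x0 then 0 else q * b x)) * x $ i) = 0" .
      qed
      have by0: "b y = 0" using all[OF x0] a by simp
      show "\<forall>x\<in>insert y ?Y. b x = 0"
      proof
        fix x assume "x \<in> insert y ?Y"
        then show "b x = 0" using all[of x] by0 q(1) by auto
      qed
    qed
  next
    fix z assume "z \<in> mat_kernel H"
    then obtain p c where p: "p \<noteq> 0" "\<And>i. i < ?n \<Longrightarrow> p * z $ i = (\<Sum>x\<in>X. c x * x $ i)"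
      using gen by blast
    define d where "d = (\<lambda>x. if x = y then c x0 * q else a x0 * c x - c x0 * a x)"
    have "a x0 * p * z $ i = (\<Sum>x\<in>insert y ?Y. d x * x $ i)" if i: "i < ?n" for i
    proof -
      have "(\<Sum>x\<in>?Y. d x * x $ i) = (\<Sum>x\<in>?Y. a x0 * (c x * x $ i) - c x0 * (a x * x $ i))"
        by (rule sum.cong) (use nin in \<open>auto simp: d_def algebra_simps\<close>)
      also have "\<dots> = a x0 * (\<Sum>x\<in>?Y. c x * x $ i) - c x0 * (\<Sum>x\<in>?Y. a x * x $ i)"
        by (simp add: sum_subtractf sum_distrib_left)
      finally have "(\<Sum>x\<in>insert y ?Y. d x * x $ i) =
          c x0 * (q * y $ i) + (a x0 * (\<Sum>x\<in>?Y. c x * x $ i) - c x0 * (\<Sum>x\<in>?Y. a x * x $ i))"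
        unfolding ins by (simp add: d_def mult.assoc)
      also have "\<dots> = a x0 * (\<Sum>x\<in>X. c x * x $ i)"
        unfolding q(2)[OF i] split by (simp add: algebra_simps)
      finally show ?thesis using p(2)[OF i] by (simp add: mult.assoc)
    qed
    then show "\<exists>q a. q \<noteq> 0 \<and> (\<forall>i<?n. q * z $ i = (\<Sum>x\<in>insert y ?Y. a x * x $ i))"
      using a p(1) by (intro exI[of _ "a x0 * p"] exI[of _ d]) simp
  qed (use fin sub y in auto)
qed

lemma minimal_basisD:
  assumes "minimal_null_basis H X"
  shows "quasi_basis H X" "finite X" "X \<subseteq> mat_kernel H" "lin_indep (dim_col H) X"
  using assms unfolding minimal_null_basis_def polynomial_null_basis_iff quasi_basis_def by auto

text \<open>
  Otherwise the exchange of \<open>x0\<close> for \<open>y\<close> would decrease the sum of the degrees.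
\<close>

lemma minimal_basis_no_descent:
  assumes X: "minimal_null_basis H X" and x0: "x0 \<in> X" and y: "y \<in> mat_kernel H"
    and q: "q \<noteq> 0" "\<And>i. i < dim_col H \<Longrightarrow> q * y $ i = (\<Sum>x\<in>X. a x * x $ i)" and a: "a x0 \<noteq> 0"
  shows "vec_degree x0 \<le> vec_degree y"
proof (rule ccontr)
  assume "\<not> vec_degree x0 \<le> vec_degree y"
  note ex = quasi_basis_exchange[OF minimal_basisD(1)[OF X] x0 y q a]
  have fin: "finite X" by (rule minimal_basisD(2)[OF X])
  have "sum vec_degree X \<le> sum vec_degree (insert y (X - {x0}))"
    using X ex(2) unfolding minimal_null_basis_def polynomial_null_basis_iff by blast
  also have "\<dots> = vec_degree y + sum vec_degree (X - {x0})"
    by (rule sum.insert) (use fin ex(1) in auto)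
  also have "\<dots> < vec_degree x0 + sum vec_degree (X - {x0})"
    using \<open>\<not> vec_degree x0 \<le> vec_degree y\<close> by simp
  also have "\<dots> = sum vec_degree X" by (rule sum.remove[OF fin x0, symmetric])
  finally show False by simp
qed

lemma ex_max_vec_degree:
  assumes "finite X" "x \<in> X" "\<alpha> x \<noteq> 0"
  obtains x0 where "x0 \<in> X" "\<alpha> x0 \<noteq> 0"
    "\<And>x. x \<in> X \<Longrightarrow> \<alpha> x \<noteq> 0 \<Longrightarrow> vec_degree x \<le> vec_degree x0"
proof -
  let ?S = "{x \<in> X. \<alpha> x \<noteq> 0}"
  have "Max (vec_degree ` ?S) \<in> vec_degree ` ?S" using assms by (intro Max_in) auto
  then obtain x0 where "x0 \<in> ?S" and x0: "vec_degree x0 = Max (vec_degree ` ?S)" by auto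
  moreover have "vec_degree x \<le> vec_degree x0" if "x \<in> X" "\<alpha> x \<noteq> 0" for x
    unfolding x0 by (rule Max_ge) (use that assms(1) in auto)
  ultimately show ?thesis using that by blast
qed

text \<open>
  If a constant combination vanishes at \<open>l\<close>, its quotient by \<open>s - l\<close> is a null vector of smaller
  degree than the vector of largest degree involved, against \<open>minimal_basis_no_descent\<close>.
\<close>

lemma minimal_basis_values_independent:
  fixes H :: "'a :: field poly mat"
  assumes X: "minimal_null_basis H X"
    and z: "\<And>i. i < dim_col H \<Longrightarrow> (\<Sum>x\<in>X. \<alpha> x * poly (x $ i) l) = 0" and x: "x \<in> X"
  shows "\<alpha> x = 0"
proof (rule ccontr)
  let ?n = "dim_col H"
  assume "\<alpha> x \<noteq> 0"
  then obtain x0 where x0: "x0 \<in> X" "\<alpha> x0 \<noteq> 0"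
    and max: "\<And>x. x \<in> X \<Longrightarrow> \<alpha> x \<noteq> 0 \<Longrightarrow> vec_degree x \<le> vec_degree x0"
    using ex_max_vec_degree[OF minimal_basisD(2)[OF X] x] by blast
  have H: "H \<in> carrier_mat (dim_row H) ?n" by simp
  have dimx: "dim_vec x = ?n" if "x \<in> X" for x
    using that minimal_basisD(3)[OF X] by (auto simp: mat_kernel_def)
  define p where "p = [:- l, 1:]"
  define s where "s = (\<lambda>i. \<Sum>x\<in>X. [:\<alpha> x:] * x $ i)"
  have p0: "p \<noteq> 0" by (simp add: p_def)
  have "p dvd s i" if "i < ?n" for i
    unfolding p_def poly_eq_0_iff_dvd[symmetric] using z[OF that] by (simp add: s_def poly_sum)
  then have "\<forall>i\<in>{..<?n}. \<exists>y. s i = p * y" by (auto elim: dvdE)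
  from bchoice[OF this] obtain y where y: "\<And>i. i < ?n \<Longrightarrow> s i = p * y i" by auto
  have yk: "vec ?n y \<in> mat_kernel H"
    unfolding mem_mat_kernel_iff[OF H]
  proof (intro conjI allI impI)
    fix r assume r: "r < dim_row H"
    have "p * (\<Sum>j<?n. H $$ (r, j) * vec ?n y $ j) = (\<Sum>j<?n. H $$ (r, j) * vec ?n s $ j)"
      unfolding sum_distrib_left by (rule sum.cong) (auto simp: y)
    also have "\<dots> = 0"
      using kernel_lincomb[OF H minimal_basisD(3)[OF X], of "\<lambda>x. [:\<alpha> x:]"] r
      unfolding mem_mat_kernel_iff[OF H] s_def by blast
    finally show "(\<Sum>j<?n. H $$ (r, j) * vec ?n y $ j) = 0" using p0 by simp
  qed simp
  have deg: "degree (y i) < vec_degree x0" if i: "i < ?n" "y i \<noteq> 0" for i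
  proof -
    have "degree (s i) \<le> vec_degree x0"
      unfolding s_def
    proof (rule degree_sum_le[OF minimal_basisD(2)[OF X]])
      fix x assume x: "x \<in> X"
      show "degree ([:\<alpha> x:] * x $ i) \<le> vec_degree x0"
      proof (cases "\<alpha> x = 0")
        case False
        then have "degree (x $ i) \<le> vec_degree x0"
          using max[OF x] degree_le_vec_degree[of i x] dimx[OF x] i(1) by simp
        then show ?thesis using degree_smult_le[of "\<alpha> x" "x $ i"] by simp
      qed simp
    qed
    moreover have "degree (s i) = Suc (degree (y i))"
      using i p0 by (simp add: y degree_mult_eq) (simp add: p_def)
    ultimately show ?thesis by simp
  qed
  have "\<exists>i<?n. y i \<noteq> 0"
  proof (rule ccontr)
    assume "\<not> ?thesis"
    then have "(\<Sum>x\<in>X. [:\<alpha> x:] * x $ i) = 0" if "i < ?n" for i using y[OF that] that by (simp add: s_def)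
    then have "[:\<alpha> x0:] = 0" by (rule lin_indepD[OF minimal_basisD(4)[OF X] _ x0(1)])
    then show False using x0(2) by simp
  qed
  then have pos: "0 < vec_degree x0" using deg by fastforce
  have "degree (y i) < vec_degree x0" if "i < ?n" for i using deg[OF that] pos by (cases "y i = 0") auto
  then have "vec_degree (vec ?n y) < vec_degree x0" by (intro vec_degree_less pos) simp
  moreover have "vec_degree x0 \<le> vec_degree (vec ?n y)"
    by (rule minimal_basis_no_descent[OF X x0(1) yk p0, of "\<lambda>x. [:\<alpha> x:]"]) (use y x0(2) in \<open>auto simp: s_def\<close>)
  ultimately show False by simp
qed

text \<open>
  If a combination of the leading coefficient vectors vanishes, multiply the basis vectors by powers
  of \<open>s\<close> that raise them to the largest degree involved; in the same combination of these the
  leading terms cancel, again against \<open>minimal_basis_no_descent\<close>.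
\<close>

lemma minimal_basis_leading_independent:
  fixes H :: "'a :: field poly mat"
  assumes X: "minimal_null_basis H X"
    and z: "\<And>i. i < dim_col H \<Longrightarrow> (\<Sum>x\<in>X. \<alpha> x * coeff (x $ i) (vec_degree x)) = 0" and x: "x \<in> X"
  shows "\<alpha> x = 0"
proof (rule ccontr)
  let ?n = "dim_col H"
  assume "\<alpha> x \<noteq> 0"
  then obtain x0 where x0: "x0 \<in> X" "\<alpha> x0 \<noteq> 0"
    and max: "\<And>x. x \<in> X \<Longrightarrow> \<alpha> x \<noteq> 0 \<Longrightarrow> vec_degree x \<le> vec_degree x0"
    using ex_max_vec_degree[OF minimal_basisD(2)[OF X] x] by blast
  have H: "H \<in> carrier_mat (dim_row H) ?n" by simp
  have dimx: "dim_vec x = ?n" if "x \<in> X" for x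
    using that minimal_basisD(3)[OF X] by (auto simp: mat_kernel_def)
  let ?d = "vec_degree x0"
  define a where "a = (\<lambda>x. monom (\<alpha> x) (?d - vec_degree x))"
  define y where "y = (\<lambda>i. \<Sum>x\<in>X. a x * x $ i)"
  have yk: "vec ?n y \<in> mat_kernel H"
    unfolding y_def by (rule kernel_lincomb[OF H minimal_basisD(3)[OF X]])
  have deg: "degree (y i) < ?d" if i: "i < ?n" "y i \<noteq> 0" for i
  proof -
    have top: "coeff (a x * x $ i) j = (if j = ?d then \<alpha> x * coeff (x $ i) (vec_degree x) else 0)"
      if x: "x \<in> X" and j: "?d \<le> j" for x j
    proof (cases "\<alpha> x = 0")
      case False
      have le: "vec_degree x \<le> ?d" by (rule max[OF x False])
      have "degree (x $ i) \<le> vec_degree x" using degree_le_vec_degree[of i x] dimx[OF x] i(1) by simp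
      then have "coeff (x $ i) (j - (?d - vec_degree x)) = 0" if "j \<noteq> ?d"
        by (intro coeff_eq_0) (use that le j in linarith)
      then show ?thesis using le j by (auto simp: a_def coeff_monom_mult)
    qed (simp add: a_def)
    have "coeff (y i) j = 0" if j: "?d \<le> j" for j
    proof -
      have "coeff (y i) j = (\<Sum>x\<in>X. if j = ?d then \<alpha> x * coeff (x $ i) (vec_degree x) else 0)"
        unfolding y_def coeff_sum by (rule sum.cong) (use top j in auto)
      then show ?thesis using z[OF i(1)] by (cases "j = ?d") auto
    qed
    then show ?thesis using i(2) by (metis leading_coeff_0_iff not_le)
  qed
  have "\<exists>i<?n. y i \<noteq> 0"
  proof (rule ccontr)
    assume "\<not> ?thesis"
    then have "(\<Sum>x\<in>X. a x * x $ i) = 0" if "i < ?n" for i using that by (simp add: y_def)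
    then have "a x0 = 0" by (rule lin_indepD[OF minimal_basisD(4)[OF X] _ x0(1)])
    then show False using x0(2) by (simp add: a_def)
  qed
  then have pos: "0 < ?d" using deg by fastforce
  have "degree (y i) < ?d" if "i < ?n" for i using deg[OF that] pos by (cases "y i = 0") auto
  then have "vec_degree (vec ?n y) < ?d" by (intro vec_degree_less pos) simp
  moreover have "?d \<le> vec_degree (vec ?n y)"
    by (rule minimal_basis_no_descent[OF X x0(1) yk, of 1 a]) (use x0(2) in \<open>auto simp: y_def a_def\<close>)
  ultimately show False by simp
qed

text \<open>
  A denominator \<open>q\<close> of positive degree has a root. As the values of the basis vectors there are
  independent, all numerators vanish at this root, so that a linear factor cancels.
\<close>

lemma minimal_basis_generates:
  fixes H :: "'a :: alg_closed_field poly mat"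
  assumes X: "minimal_null_basis H X" and z: "z \<in> mat_kernel H"
  obtains a where "\<And>i. i < dim_col H \<Longrightarrow> z $ i = (\<Sum>x\<in>X. a x * x $ i)"
proof -
  let ?n = "dim_col H"
  have "\<exists>a. \<forall>i<?n. z $ i = (\<Sum>x\<in>X. a x * x $ i)"
    if "q \<noteq> 0" "\<And>i. i < ?n \<Longrightarrow> q * z $ i = (\<Sum>x\<in>X. a x * x $ i)" for q a
    using that
  proof (induction "degree q" arbitrary: q a)
    case 0
    then obtain c where c: "q = [:c:]" "c \<noteq> 0" by (metis degree_eq_zeroE pCons_0_0)
    have "z $ i = (\<Sum>x\<in>X. smult (inverse c) (a x) * x $ i)" if "i < ?n" for i
    proof -
      have "z $ i = smult (inverse c) (q * z $ i)" using c by simp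
      also have "\<dots> = (\<Sum>x\<in>X. smult (inverse c) (a x) * x $ i)"
        unfolding 0(3)[OF that] by (simp add: smult_sum2)
      finally show ?thesis .
    qed
    then show ?case by (intro exI[of _ "\<lambda>x. smult (inverse c) (a x)"]) blast
  next
    case (Suc k)
    then obtain l where l: "poly q l = 0" using alg_closed_imp_poly_has_root[of q] by auto
    then obtain q1 where q1: "q = [:- l, 1:] * q1" unfolding poly_eq_0_iff_dvd by (elim dvdE)
    have "poly (a x) l = 0" if "x \<in> X" for x
    proof (rule minimal_basis_values_independent[OF X _ that])
      fix i assume i: "i < ?n"
      have "(\<Sum>x\<in>X. poly (a x) l * poly (x $ i) l) = poly (q * z $ i) l"
        unfolding Suc.prems(2)[OF i] by (simp add: poly_sum)
      then show "(\<Sum>x\<in>X. poly (a x) l * poly (x $ i) l) = 0" using l by simp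
    qed
    then have "\<forall>x\<in>X. \<exists>b. a x = [:- l, 1:] * b" unfolding poly_eq_0_iff_dvd dvd_def by blast
    from bchoice[OF this] obtain b where b: "\<And>x. x \<in> X \<Longrightarrow> a x = [:- l, 1:] * b x" by auto
    have q10: "q1 \<noteq> 0" using q1 Suc.prems(1) by auto
    have "degree q = Suc (degree q1)" unfolding q1 using q10 by (subst degree_mult_eq) auto
    then have "k = degree q1" using Suc.hyps(2) by simp
    moreover have "q1 * z $ i = (\<Sum>x\<in>X. b x * x $ i)" if i: "i < ?n" for i
    proof -
      have "[:- l, 1:] * (q1 * z $ i) = (\<Sum>x\<in>X. a x * x $ i)"
        using Suc.prems(2)[OF i] unfolding q1 by (simp only: mult.assoc)
      also have "\<dots> = [:- l, 1:] * (\<Sum>x\<in>X. b x * x $ i)"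
        unfolding sum_distrib_left by (rule sum.cong) (auto simp: b simp del: mult_pCons_left)
      finally show ?thesis by (simp del: mult_pCons_left)
    qed
    ultimately show ?case using Suc.hyps(1)[of q1 b] q10 by blast
  qed
  moreover obtain q a where "q \<noteq> 0" "\<forall>i<?n. q * z $ i = (\<Sum>x\<in>X. a x * x $ i)"
    using minimal_basisD(1)[OF X] z unfolding quasi_basis_def by blast
  ultimately have "\<exists>a. \<forall>i<?n. z $ i = (\<Sum>x\<in>X. a x * x $ i)" by blast
  then show ?thesis using that by blast
qed

lemma coeff_mult_degree_bounds:
  fixes p q :: "'a :: comm_semiring_0 poly"
  assumes "degree p \<le> e" "degree q \<le> f"
  shows "coeff (p * q) (e + f) = coeff p e * coeff q f"
proof -
  have "coeff (p * q) (e + f) = (\<Sum>i\<le>e + f. coeff p i * coeff q (e + f - i))" by (rule coeff_mult)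
  also have "\<dots> = (\<Sum>i\<in>{e}. coeff p i * coeff q (e + f - i))"
  proof (rule sum.mono_neutral_right)
    show "\<forall>i\<in>{..e + f} - {e}. coeff p i * coeff q (e + f - i) = 0"
    proof
      fix i assume i: "i \<in> {..e + f} - {e}"
      show "coeff p i * coeff q (e + f - i) = 0"
      proof (cases "i < e")
        case True
        then have "coeff q (e + f - i) = 0" using assms(2) by (intro coeff_eq_0) linarith
        then show ?thesis by simp
      next
        case False
        then have "coeff p i = 0" using assms(1) i by (intro coeff_eq_0) auto
        then show ?thesis by simp
      qed
    qed
  qed auto
  finally show ?thesis by simp
qed

text \<open>
  The terms of highest degree in a combination of the basis vectors cannot cancel, because the
  leading coefficient vectors are independent.
\<close>

lemma minimal_basis_predictable_degree:
  fixes H :: "'a :: field poly mat"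
  assumes X: "minimal_null_basis H X"
    and z: "\<And>i. i < dim_col H \<Longrightarrow> z i = (\<Sum>x\<in>X. a x * x $ i)"
    and deg: "\<And>i j. i < dim_col H \<Longrightarrow> k \<le> j \<Longrightarrow> coeff (z i) j = 0"
    and x: "x \<in> X" "a x \<noteq> 0"
  shows "degree (a x) + vec_degree x < k"
proof (rule ccontr)
  let ?n = "dim_col H"
  let ?S = "{x \<in> X. a x \<noteq> 0}"
  define D where "D = Max ((\<lambda>x. degree (a x) + vec_degree x) ` ?S)"
  assume "\<not> degree (a x) + vec_degree x < k"
  have fin: "finite X" by (rule minimal_basisD(2)[OF X])
  have le: "degree (a x) + vec_degree x \<le> D" if "x \<in> X" "a x \<noteq> 0" for x
    unfolding D_def by (rule Max_ge) (use that fin in auto)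
  have "k \<le> D" using le[OF x] \<open>\<not> _ < k\<close> by linarith
  have "D \<in> (\<lambda>x. degree (a x) + vec_degree x) ` ?S"
    unfolding D_def by (rule Max_in) (use fin x in auto)
  then obtain x1 where x1: "x1 \<in> X" "a x1 \<noteq> 0" "D = degree (a x1) + vec_degree x1" by auto
  have dimx: "dim_vec x = ?n" if "x \<in> X" for x
    using that minimal_basisD(3)[OF X] by (auto simp: mat_kernel_def)
  define \<alpha> where "\<alpha> = (\<lambda>x. if vec_degree x \<le> D then coeff (a x) (D - vec_degree x) else 0)"
  have "\<alpha> x1 = 0"
  proof (rule minimal_basis_leading_independent[OF X _ x1(1)])
    fix i assume i: "i < ?n"
    have "(\<Sum>x\<in>X. \<alpha> x * coeff (x $ i) (vec_degree x)) = (\<Sum>x\<in>X. coeff (a x * x $ i) D)"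
    proof (rule sum.cong[OF refl])
      fix x assume x: "x \<in> X"
      show "\<alpha> x * coeff (x $ i) (vec_degree x) = coeff (a x * x $ i) D"
      proof (cases "a x = 0")
        case False
        have "coeff (a x * x $ i) (D - vec_degree x + vec_degree x)
            = coeff (a x) (D - vec_degree x) * coeff (x $ i) (vec_degree x)"
          by (rule coeff_mult_degree_bounds)
            (use le[OF x False] degree_le_vec_degree[of i x] dimx[OF x] i in auto)
        moreover have "vec_degree x \<le> D" using le[OF x False] by simp
        ultimately show ?thesis by (simp add: \<alpha>_def)
      qed (simp add: \<alpha>_def)
    qed
    also have "\<dots> = coeff (z i) D" by (simp add: z[OF i] coeff_sum)
    also have "\<dots> = 0" by (rule deg[OF i \<open>k \<le> D\<close>])
    finally show "(\<Sum>x\<in>X. \<alpha> x * coeff (x $ i) (vec_degree x)) = 0" .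
  qed
  then show False using x1 by (simp add: \<alpha>_def)
qed

section \<open>Inequalities between partitions\<close>

definition is_partition :: "(nat \<Rightarrow> nat) \<Rightarrow> bool" where
  "is_partition r \<longleftrightarrow> (\<forall>k. r (Suc k) \<le> r k) \<and> (\<exists>N. \<forall>k\<ge>N. r k = 0)"

lemma partition_antimono:
  assumes "is_partition r" "i \<le> j" shows "r j \<le> r i"
  using assms(1) lift_Suc_antimono_le[of r i j] assms(2) unfolding is_partition_def by blast

lemma part_sum_eq_sum:
  assumes "\<forall>k\<ge>N. r k = 0"
  shows "part_sum a r = (\<Sum>i=a..<N. r i)"
proof -
  have "i < N" if "r i \<noteq> 0" for i using assms that leI by metis
  then have "{i. a \<le> i \<and> r i \<noteq> 0} \<subseteq> {a..<N}" by auto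
  have "part_sum a r = sum r {i. a \<le> i \<and> r i \<noteq> 0}" by (simp add: part_sum_def)
  also have "\<dots> = (\<Sum>i=a..<N. r i)"
    by (rule sum.mono_neutral_left) (use \<open>{i. a \<le> i \<and> r i \<noteq> 0} \<subseteq> {a..<N}\<close> in auto)
  finally show ?thesis .
qed

lemma part_sum_0:
  assumes "is_partition r"
  shows "part_sum 0 r = r 0 + part_sum 1 r"
proof -
  obtain N where N: "\<forall>k\<ge>N. r k = 0" using assms by (auto simp: is_partition_def)
  then have N': "\<forall>k\<ge>Suc N. r k = 0" by auto
  show ?thesis
    unfolding part_sum_eq_sum[OF N'] by (simp add: sum.atLeast_Suc_lessThan)
qed

lemma mult_le_part_sum:
  assumes "is_partition r"
  shows "k * r k \<le> part_sum 1 r"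
proof -
  obtain N where N: "\<forall>k\<ge>N. r k = 0" using assms by (auto simp: is_partition_def)
  then have N': "\<forall>i\<ge>N + Suc k. r i = 0" by auto
  have "k * r k = (\<Sum>i=1..<Suc k. r k)" by simp
  also have "\<dots> \<le> (\<Sum>i=1..<Suc k. r i)"
    by (rule sum_mono) (use partition_antimono[OF assms] in auto)
  also have "\<dots> \<le> (\<Sum>i=1..<N + Suc k. r i)"
    by (rule sum_mono2) auto
  finally show ?thesis by (simp add: part_sum_eq_sum[OF N'])
qed

lemma part_sum_1_eq_0_iff:
  assumes "is_partition r"
  shows "part_sum 1 r = 0 \<longleftrightarrow> (\<forall>k\<ge>1. r k = 0)"
proof
  assume "part_sum 1 r = 0"
  then show "\<forall>k\<ge>1. r k = 0" using mult_le_part_sum[OF assms] by (metis le_zero_eq mult_is_0 not_one_le_zero)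
qed (auto simp: part_sum_def)

lemma le_floor_sqrt:
  fixes x :: int and y :: nat
  assumes "x * x \<le> int y"
  shows "x \<le> \<lfloor>sqrt (real y)\<rfloor>"
proof -
  have "(real_of_int x)\<^sup>2 = real_of_int (x * x)" by (simp add: power2_eq_square)
  also have "\<dots> \<le> real_of_int (int y)" using assms by (simp only: of_int_le_iff)
  finally have "real_of_int x \<le> sqrt (real y)" by (intro real_le_rsqrt) simp
  then show ?thesis by (simp add: le_floor_iff)
qed

text \<open>
  The relation between the Brunovsky partitions \<open>r\<close> of a pencil and \<open>g\<close> of the pencil with an
  additional row of degree at most \<open>d\<close>, in case the row restricts the null space. It is what
  remains of \<open>r\<close> and \<open>g\<close> after the dimension function is eliminated in \<open>one_stepI\<close>.
\<close>

definition one_step :: "nat \<Rightarrow> (nat \<Rightarrow> nat) \<Rightarrow> (nat \<Rightarrow> nat) \<Rightarrow> bool" where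
  "one_step d r g \<longleftrightarrow> g 0 + 1 = r 0 \<and> (\<forall>k\<ge>1. r k \<le> g k + 1 \<and> g k + 1 \<le> r k + k + d) \<and>
     part_sum 1 g \<le> part_sum 1 r + d"

text \<open>
  Here \<open>\<epsilon>\<close> satisfies \<open>\<epsilon> \<le> k\<close> and \<open>\<epsilon> - 1 \<le> g k\<close>, so \<open>\<epsilon> (\<epsilon> - 1) \<le> k g\<^sub>k\<close> is at most the sum of
  \<open>g\<^sub>1, g\<^sub>2, \<dots>\<close>, and the missing summand \<open>\<epsilon>\<close> is at most \<open>g\<^sub>0 + 1\<close>.
\<close>

lemma one_step_0_bounds:
  assumes "is_partition r" "is_partition g" "one_step 0 r g" "k \<ge> 1"
  defines "\<epsilon> \<equiv> int (g k) + 1 - int (r k)"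
  shows "0 \<le> \<epsilon>" "\<epsilon> * \<epsilon> \<le> int (part_sum 0 g) + 1" "\<epsilon> * \<epsilon> \<le> int (part_sum 0 r)"
proof -
  have step: "g 0 + 1 = r 0" "r k \<le> g k + 1" "g k + 1 \<le> r k + k" "part_sum 1 g \<le> part_sum 1 r"
    using assms(3,4) unfolding one_step_def by auto
  show e0: "0 \<le> \<epsilon>" using step by (simp add: \<epsilon>_def)
  have "\<epsilon> * \<epsilon> \<le> int k * int (g k) + int (g k) + 1"
  proof (cases "\<epsilon> = 0")
    case False
    then have "\<epsilon> * (\<epsilon> - 1) \<le> int k * int (g k)"
      using e0 step by (intro mult_mono) (auto simp: \<epsilon>_def)
    moreover have "\<epsilon> \<le> int (g k) + 1" by (simp add: \<epsilon>_def)
    ultimately show ?thesis by (simp add: algebra_simps)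
  qed simp
  also have "\<dots> \<le> int (part_sum 1 g) + int (g 0) + 1"
  proof -
    have "k * g k \<le> part_sum 1 g" "g k \<le> g 0"
      using mult_le_part_sum[OF assms(2), of k] partition_antimono[OF assms(2), of 0 k] by auto
    then have "int (k * g k) \<le> int (part_sum 1 g)" "int (g k) \<le> int (g 0)" by (simp_all only: of_nat_le_iff)
    then show ?thesis by simp
  qed
  finally have *: "\<epsilon> * \<epsilon> \<le> int (part_sum 1 g) + int (g 0) + 1" .
  then show "\<epsilon> * \<epsilon> \<le> int (part_sum 0 g) + 1" by (simp add: part_sum_0[OF assms(2)])
  show "\<epsilon> * \<epsilon> \<le> int (part_sum 0 r)" using * step by (simp add: part_sum_0[OF assms(1)])
qed

lemma one_step_1_bounds:
  assumes "is_partition g" "one_step 1 r g" "k \<ge> 1"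
  shows "int (r k) - 1 \<le> int (g k)" "0 \<le> int (g k) - int (r k) \<Longrightarrow> 
    (int (g k) - int (r k)) * (int (g k) - int (r k)) \<le> int k * (int (g k) - int (r k))"
    "k * g k \<le> part_sum 1 g" "part_sum 1 g \<le> part_sum 1 r + 1" 
  using assms mult_le_part_sum[OF assms(1), of k] unfolding one_step_def 
  by (auto intro!: mult_right_mono)

lemma col_bounds_equal_rank:
  assumes P: "is_partition r" "is_partition r'" "is_partition g"
    and S: "one_step 0 r g" "one_step 0 r' g"
  shows "\<bar>int (r' k) - int (r k)\<bar> \<le> \<lfloor>sqrt (real (part_sum 0 r))\<rfloor>"
    and "\<forall>i\<ge>1. r i = 0 \<Longrightarrow> int (r' k) - int (r k) \<in> {0..1}"
proof -
  have 0: "r' 0 = r 0" using S unfolding one_step_def by auto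
  have g: "part_sum 0 g + 1 \<le> part_sum 0 r"
    using S(1) unfolding one_step_def part_sum_0[OF P(1)] part_sum_0[OF P(3)] by auto
  show "\<bar>int (r' k) - int (r k)\<bar> \<le> \<lfloor>sqrt (real (part_sum 0 r))\<rfloor>"
  proof (cases "k \<ge> 1")
    case True
    note b = one_step_0_bounds[OF P(1,3) S(1) True] and b' = one_step_0_bounds[OF P(2,3) S(2) True]
    have "int (g k) + 1 - int (r k) \<le> \<lfloor>sqrt (real (part_sum 0 r))\<rfloor>"
      using b by (intro le_floor_sqrt) simp
    moreover have "int (g k) + 1 - int (r' k) \<le> \<lfloor>sqrt (real (part_sum 0 r))\<rfloor>"
      using b' g by (intro le_floor_sqrt) simp
    ultimately show ?thesis using b(1) b'(1) by linarith
  qed (use 0 in \<open>simp add: not_le\<close>)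
  assume z: "\<forall>i\<ge>1. r i = 0"
  show "int (r' k) - int (r k) \<in> {0..1}"
  proof (cases "k \<ge> 1")
    case True
    have "part_sum 1 g = 0" using S(1) part_sum_1_eq_0_iff[OF P(1)] z unfolding one_step_def by auto
    then have "g k = 0" using part_sum_1_eq_0_iff[OF P(3)] True by auto
    moreover have "r' k \<le> g k + 1" using S(2) True unfolding one_step_def by blast
    moreover have "r k = 0" using z True by simp
    ultimately show ?thesis by simp
  qed (use 0 in \<open>simp add: not_le\<close>)
qed

lemma col_bounds_rank_up:
  assumes P: "is_partition r" "is_partition g" and S: "one_step 0 r g"
  shows "int (g k) - int (r k) \<in> {- 1..- 1 + \<lfloor>sqrt (real (part_sum 0 r))\<rfloor>}"
proof (cases "k \<ge> 1")
  case True
  note b = one_step_0_bounds[OF P S True]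
  show ?thesis using b(1) le_floor_sqrt[OF b(3)] by simp
next
  case False
  have "int (r 0) > 0" using S unfolding one_step_def by linarith
  then have "1 \<le> \<lfloor>sqrt (real (part_sum 0 r))\<rfloor>" 
    by (intro le_floor_sqrt) (simp add: part_sum_0[OF P(1)])
  moreover have "int (g 0) - int (r 0) = -1" using S unfolding one_step_def by linarith
  moreover have "k = 0" using False by simp
  ultimately show ?thesis by (simp only: atLeastAtMost_iff) linarith
qed

lemma col_bounds_rank_down:
  assumes P: "is_partition r" "is_partition g" and S: "one_step 0 r g"
  shows "int (r k) - int (g k) \<in> {1 - \<lfloor>sqrt (real (part_sum 0 g) + 1)\<rfloor>..1}"
proof (cases "k \<ge> 1")
  case True
  note b = one_step_0_bounds[OF P S True]
  have "int (g k) + 1 - int (r k) \<le> \<lfloor>sqrt (real (part_sum 0 g + 1))\<rfloor>"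
    using b by (intro le_floor_sqrt) simp
  then show ?thesis using b(1) by (simp add: add.commute)
next
  case False
  have "int (r 0) - int (g 0) = 1" using S unfolding one_step_def by linarith
  then show ?thesis using False by (simp add: not_le le_floor_iff)
qed

text \<open>
  With \<open>a = g k - s k\<close> and \<open>b = g k - s' k\<close> the difference in question is \<open>a - b\<close>, where both
  numbers are at least \<open>- 1\<close>; the squares of \<open>a\<close> and \<open>b\<close>, if nonnegative, are at most
  \<open>part_sum 1 s + 1\<close> by the counting argument.
\<close>

lemma row_bounds_equal_rank:
  assumes P: "is_partition s" "is_partition s'" "is_partition g"
    and S: "one_step 1 s g" "one_step 1 s' g"
  shows "\<forall>i\<ge>1. s i = 0 \<Longrightarrow> int (s' k) - int (s k) \<in> {0..2}"
    and "\<not> (\<forall>i\<ge>1. s i = 0) \<Longrightarrow> int (s' k) - int (s k) \<in>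
      {- \<lfloor>sqrt (real (part_sum 1 s))\<rfloor> - 1..\<lfloor>sqrt (real (part_sum 1 s) - 1)\<rfloor> + 2}"
proof -
  have 0: "s' 0 = s 0" using S unfolding one_step_def by auto
  {
    assume z: "\<forall>i\<ge>1. s i = 0"
    show "int (s' k) - int (s k) \<in> {0..2}"
    proof (cases "k \<ge> 1")
      case True
      have "part_sum 1 g \<le> 1" using S(1) part_sum_1_eq_0_iff[OF P(1)] z unfolding one_step_def by auto
      then have "g k \<le> 1" using mult_le_part_sum[OF P(3), of k] True
        by (metis dual_order.trans mult_le_mono1 nat_mult_1)
      moreover have "s' k \<le> g k + 1" using S(2) True unfolding one_step_def by blast
      moreover have "s k = 0" using z True by simp
      ultimately show ?thesis by simp
    qed (use 0 in \<open>simp add: not_le\<close>)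
  }
  assume nz: "\<not> (\<forall>i\<ge>1. s i = 0)"
  then have s1: "part_sum 1 s \<ge> 1" using part_sum_1_eq_0_iff[OF P(1)] by (metis One_nat_def Suc_leI gr0I)
  have sq: "sqrt (real (part_sum 1 s) - 1) = sqrt (real (part_sum 1 s - 1))" using s1 by (simp add: of_nat_diff)
  show "int (s' k) - int (s k) \<in>
      {- \<lfloor>sqrt (real (part_sum 1 s))\<rfloor> - 1..\<lfloor>sqrt (real (part_sum 1 s) - 1)\<rfloor> + 2}"
  proof (cases "k \<ge> 1")
    case True
    define a where "a = int (g k) - int (s k)"
    define b where "b = int (g k) - int (s' k)"
    note B = one_step_1_bounds[OF P(3) S(1) True] and B' = one_step_1_bounds[OF P(3) S(2) True]
    have ks: "k * s k \<le> part_sum 1 s" by (rule mult_le_part_sum[OF P(1)])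
    have kg: "int k * int (g k) \<le> int (part_sum 1 s) + 1"
    proof -
      have "int (k * g k) \<le> int (part_sum 1 s + 1)" using B(3,4) by (simp only: of_nat_le_iff)
      then show ?thesis by simp
    qed
    have "- 1 \<le> a" "- 1 \<le> b" using B(1) B'(1) by (auto simp: a_def b_def)
    have sqle: "c * c \<le> int (part_sum 1 s) + 1" 
      if "0 \<le> c" "c * c \<le> int k * c" "c \<le> int (g k)" for c
    proof -
      have "int k * c \<le> int k * int (g k)" using that by (intro mult_left_mono) auto
      then show ?thesis using that kg by linarith
    qed
    have "a - 1 \<le> \<lfloor>sqrt (real (part_sum 1 s - 1))\<rfloor>"
    proof (cases "a \<ge> 2")
      case True
      have "a * a \<le> int (part_sum 1 s) + 1"
        using sqle[of a] B(2) True by (simp add: a_def)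
      then have "(a - 1) * (a - 1) \<le> int (part_sum 1 s - 1)"
        using True s1 by (simp add: algebra_simps of_nat_diff)
      then show ?thesis by (rule le_floor_sqrt)
    next
      case False
      have "0 \<le> \<lfloor>sqrt (real (part_sum 1 s - 1))\<rfloor>" by simp
      then show ?thesis using False by linarith
    qed
    then have up: "a - b \<le> \<lfloor>sqrt (real (part_sum 1 s) - 1)\<rfloor> + 2"
      using \<open>- 1 \<le> b\<close> unfolding sq by linarith
    \<comment> \<open>If \<open>a = - 1\<close>, the estimate \<open>b * b \<le> part_sum 1 s + 1\<close> is too weak by one;
      then \<open>s k\<close> exceeds \<open>g k\<close>, and the counting argument is applied to \<open>s\<close> itself.\<close>
    have "b - a - 1 \<le> \<lfloor>sqrt (real (part_sum 1 s))\<rfloor>"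
    proof (cases "b \<ge> 1")
      case True
      have bk: "b * b \<le> int k * b" using B'(2) True by (simp add: b_def)
      then have bk': "b \<le> int k" using True by simp
      show ?thesis
      proof (cases "a = - 1")
        case True
        then have "int (s k) = int (g k) + 1" by (simp add: a_def)
        then have "b \<le> int (s k)" by (simp add: b_def)
        then have "b * b \<le> int k * int (s k)" using bk' \<open>b \<ge> 1\<close> by (intro mult_mono) auto
        also have "\<dots> \<le> int (part_sum 1 s)" using ks by (simp only: of_nat_mult[symmetric] of_nat_le_iff)
        finally have "b \<le> \<lfloor>sqrt (real (part_sum 1 s))\<rfloor>" by (rule le_floor_sqrt)
        then show ?thesis using True by linarith
      next
        case False
        have "b * b \<le> int (part_sum 1 s) + 1"
          using sqle[of b] bk True by (simp add: b_def)
        then have "(b - 1) * (b - 1) \<le> int (part_sum 1 s)"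
          using True by (simp add: algebra_simps)
        then have "b - 1 \<le> \<lfloor>sqrt (real (part_sum 1 s))\<rfloor>" by (rule le_floor_sqrt)
        then show ?thesis using False \<open>- 1 \<le> a\<close> by linarith
      qed
    next
      case False
      have "0 \<le> \<lfloor>sqrt (real (part_sum 1 s))\<rfloor>" by simp
      then show ?thesis using False \<open>- 1 \<le> a\<close> by linarith
    qed
    then show ?thesis using up by (simp add: a_def b_def)
  next
    case False
    have "0 \<le> \<lfloor>sqrt (real (part_sum 1 s))\<rfloor>" "0 \<le> \<lfloor>sqrt (real (part_sum 1 s - 1))\<rfloor>" by simp_all
    then have "- \<lfloor>sqrt (real (part_sum 1 s))\<rfloor> - 1 \<le> 0" "0 \<le> \<lfloor>sqrt (real (part_sum 1 s) - 1)\<rfloor> + 2"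
      unfolding sq by linarith+
    then show ?thesis using False 0 by (simp add: not_le)
  qed
qed

lemma row_bounds_rank_up:
  assumes P: "is_partition s" "is_partition g" and S: "one_step 1 s g"
  shows "int (g k) - int (s k) \<in> {- 1..\<lfloor>sqrt (real (part_sum 1 s) + 1)\<rfloor>}"
    and "int (s k) - int (g k) \<in> {- \<lfloor>sqrt (real (part_sum 1 g))\<rfloor>..1}"
proof -
  have "- 1 \<le> int (g k) - int (s k)" 
  proof (cases "k = 0")
    case True
    have "s 0 = g 0 + 1" using S unfolding one_step_def by simp
    then show ?thesis using True by simp
  next
    case False
    then show ?thesis using one_step_1_bounds(1)[OF P(2) S, of k] by simp
  qed
  moreover have "int (g k) - int (s k) \<le> \<lfloor>sqrt (real (part_sum 1 g))\<rfloor>"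
  proof (cases "int (g k) - int (s k) \<ge> 0")
    case True
    then have k: "k \<ge> 1" using S unfolding one_step_def by (cases "k = 0") auto
    note B = one_step_1_bounds[OF P(2) S k]
    have "(int (g k) - int (s k)) * (int (g k) - int (s k)) \<le> int k * (int (g k) - int (s k))"
      by (rule B(2)[OF True])
    also have "\<dots> \<le> int k * int (g k)" by (intro mult_left_mono) auto
    also have "\<dots> \<le> int (part_sum 1 g)" using B(3) by (simp only: of_nat_mult[symmetric] of_nat_le_iff)
    finally show ?thesis by (rule le_floor_sqrt)
  next
    case False
    have "0 \<le> \<lfloor>sqrt (real (part_sum 1 g))\<rfloor>" by simp
    then show ?thesis using False by linarith
  qed
  moreover have "sqrt (real (part_sum 1 g)) \<le> sqrt (real (part_sum 1 s) + 1)"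
    using S unfolding one_step_def by simp
  then have "\<lfloor>sqrt (real (part_sum 1 g))\<rfloor> \<le> \<lfloor>sqrt (real (part_sum 1 s) + 1)\<rfloor>" by (rule floor_mono)
  ultimately have "- 1 \<le> int (g k) - int (s k) \<and> int (g k) - int (s k) \<le> \<lfloor>sqrt (real (part_sum 1 g))\<rfloor>
      \<and> int (g k) - int (s k) \<le> \<lfloor>sqrt (real (part_sum 1 s) + 1)\<rfloor>"
    by linarith
  then show "int (g k) - int (s k) \<in> {- 1..\<lfloor>sqrt (real (part_sum 1 s) + 1)\<rfloor>}"
    and "int (s k) - int (g k) \<in> {- \<lfloor>sqrt (real (part_sum 1 g))\<rfloor>..1}"
    by auto
qed

text \<open>
  For large \<open>K\<close> the function \<open>E\<close> is affine with slope \<open>r 0 - g 0\<close>. The bounds on \<open>E\<close> force the slope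
  to be 0 or 1; in the first case \<open>E\<close> is bounded, hence zero.
\<close>

lemma one_stepI:
  fixes r g E :: "nat \<Rightarrow> nat"
  assumes P: "is_partition r" "is_partition g"
    and E: "\<And>K. int (E K) = (\<Sum>j<K. (int (r 0) - int (r (Suc j))) - (int (g 0) - int (g (Suc j))))"
    and mono: "\<And>K. E K \<le> E (Suc K)" and le: "\<And>K. E K \<le> K + d"
    and unb: "(\<forall>K. E K = 0) \<or> (\<forall>B. \<exists>K. E K > B)"
  shows "g = r \<or> one_step d r g"
proof -
  obtain N1 where N1: "\<forall>k\<ge>N1. r k = 0" using P unfolding is_partition_def by blast
  obtain N2 where N2: "\<forall>k\<ge>N2. g k = 0" using P unfolding is_partition_def by blast
  define N where "N = max N1 N2"
  have N: "\<forall>k\<ge>Suc N. r k = 0" "\<forall>k\<ge>Suc N. g k = 0" using N1 N2 by (auto simp: N_def)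
  have inc: "int (E (Suc K)) - int (E K) = (int (r 0) - int (r (Suc K))) - (int (g 0) - int (g (Suc K)))" for K
    unfolding E by simp
  define c where "c = int (r 0) - int (g 0)"
  have EN: "int (E (N + j)) = int (E N) + int j * c" for j
  proof (induction j)
    case (Suc j)
    then show ?case using inc[of "N + j"] N by (simp add: c_def algebra_simps)
  qed simp
  have c0: "c \<ge> 0" using mono[of N] EN[of 1] by simp
  have "c \<le> 1"
  proof (rule ccontr)
    assume "\<not> c \<le> 1"
    define M where "M = N + d + 1"
    have "int M * 2 \<le> int M * c" using \<open>\<not> c \<le> 1\<close> by (intro mult_left_mono) auto
    moreover have "int (E (N + M)) \<le> int (N + M + d)" using le[of "N + M"] by (simp only: of_nat_le_iff)
    ultimately show False using EN[of M] by (simp add: M_def)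
  qed
  then consider "c = 0" | "c = 1" using c0 by linarith
  then show ?thesis
  proof cases
    case 1
    have "E K \<le> E N" for K
    proof (cases "K \<ge> N")
      case True
      then show ?thesis using EN[of "K - N"] 1 by simp
    next
      case False
      then show ?thesis using lift_Suc_mono_le[of E K N] mono by simp
    qed
    then have "\<forall>K. E K = 0" using unb by (meson not_le)
    then have "r (Suc K) = g (Suc K)" for K using inc[of K] 1 by (simp add: c_def)
    moreover have "r 0 = g 0" using 1 by (simp add: c_def)
    ultimately have "g = r" by (metis ext not0_implies_Suc)
    then show ?thesis ..
  next
    case 2
    then have 0: "g 0 + 1 = r 0" by (simp add: c_def)
    have k: "r k \<le> g k + 1 \<and> g k + 1 \<le> r k + k + d" if "k \<ge> 1" for k
    proof -
      obtain j where j: "k = Suc j" using \<open>k \<ge> 1\<close> by (cases k) auto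
      show ?thesis using inc[of j] mono[of j] le[of "Suc j"] 2 unfolding j c_def by linarith
    qed
    have "int (E N) = (\<Sum>j<N. 1 + (int (g (Suc j)) - int (r (Suc j))))"
      unfolding E by (rule sum.cong) (use 2 in \<open>auto simp: c_def\<close>)
    also have "\<dots> = int N + (\<Sum>j<N. int (g (Suc j))) - (\<Sum>j<N. int (r (Suc j)))"
      by (simp add: sum.distrib sum_subtractf)
    also have "(\<Sum>j<N. int (g (Suc j))) = int (part_sum 1 g)"
      unfolding part_sum_eq_sum[OF N(2)] by (simp add: sum.atLeast1_atMost_eq atLeastLessThanSuc_atLeastAtMost)
    also have "(\<Sum>j<N. int (r (Suc j))) = int (part_sum 1 r)"
      unfolding part_sum_eq_sum[OF N(1)] by (simp add: sum.atLeast1_atMost_eq atLeastLessThanSuc_atLeastAtMost)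
    finally have "part_sum 1 g \<le> part_sum 1 r + d" using le[of N] by linarith
    then show ?thesis using 0 k by (auto simp: one_step_def)
  qed
qed

section \<open>Brunovsky partitions as dimension counts\<close>

lemma (in vector_space) independent_family:
  assumes I: "finite I" and ind: "\<forall>c. (\<Sum>i\<in>I. c i *s b i) = 0 \<longrightarrow> (\<forall>i\<in>I. c i = 0)"
  shows "inj_on b I" "independent (b ` I)"
proof -
  show inj: "inj_on b I"
  proof (rule inj_onI, rule ccontr)
    fix i j assume ij: "i \<in> I" "j \<in> I" "b i = b j" "i \<noteq> j"
    define c where "c = (\<lambda>k. if k = i then 1 else if k = j then - 1 else (0 :: 'a))"
    have "(\<Sum>k\<in>I. c k *s b k) = (\<Sum>k\<in>{i, j}. c k *s b k)"
      by (rule sum.mono_neutral_right) (use ij I in \<open>auto simp: c_def\<close>)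
    also have "\<dots> = 0" using ij by (simp add: c_def)
    finally have "c i = 0" using ind ij(1) by blast
    then show False by (simp add: c_def)
  qed
  have fin: "finite (b ` I)" using I by simp
  show "independent (b ` I)"
    unfolding dependent_finite[OF fin]
  proof
    assume "\<exists>u. (\<exists>v\<in>b ` I. u v \<noteq> 0) \<and> (\<Sum>v\<in>b ` I. u v *s v) = 0"
    then obtain u i where u: "i \<in> I" "u (b i) \<noteq> 0" "(\<Sum>v\<in>b ` I. u v *s v) = 0" by blast
    have "(\<Sum>i\<in>I. u (b i) *s b i) = 0" using u(3) unfolding sum.reindex[OF inj] by simp
    then have "\<forall>i\<in>I. u (b i) = 0" using ind[rule_format, of "\<lambda>i. u (b i)"] by blast
    then show False using u by blast
  qed
qed

text \<open>
  Dimension by an indexed basis. The finite spanning set is part of the conclusion because \<open>dim\<close>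
  takes a default value on spaces of infinite dimension.
\<close>

lemma (in vector_space) dim_eq_card_family:
  assumes I: "finite I" and ind: "\<And>c i. (\<Sum>i\<in>I. c i *s b i) = 0 \<Longrightarrow> i \<in> I \<Longrightarrow> c i = 0"
    and mem: "\<And>i. i \<in> I \<Longrightarrow> b i \<in> V" and gen: "\<And>v. v \<in> V \<Longrightarrow> \<exists>c. v = (\<Sum>i\<in>I. c i *s b i)"
  shows "dim V = card I \<and> (\<exists>W. finite W \<and> V \<subseteq> span W)"
proof -
  have "\<forall>c. (\<Sum>i\<in>I. c i *s b i) = 0 \<longrightarrow> (\<forall>i\<in>I. c i = 0)" using ind by blast
  note indep = independent_family[OF I this]
  have sp: "V \<subseteq> span (b ` I)"
  proof
    fix v assume "v \<in> V"
    then obtain c where v: "v = (\<Sum>i\<in>I. c i *s b i)" using gen by blast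
    show "v \<in> span (b ` I)" unfolding v
      by (rule span_sum, rule span_scale, rule span_base) simp
  qed
  have "dim V = card I"
    by (rule dim_unique[OF _ sp]) (use mem indep in \<open>auto simp: card_image\<close>)
  moreover have "\<exists>W. finite W \<and> V \<subseteq> span W" using sp I by (intro exI[of _ "b ` I"]) simp
  ultimately show ?thesis ..
qed

lemma (in vector_space) finite_basis_of_finite_span:
  assumes "finite W" "V \<subseteq> span W"
  obtains B where "finite B" "B \<subseteq> V" "independent B" "V \<subseteq> span B" "card B = dim V"
proof -
  obtain B where B: "B \<subseteq> V" "independent B" "V \<subseteq> span B" "card B = dim V" by (rule basis_exists)
  have "B \<subseteq> span W" using B(1) assms(2) by (rule subset_trans)
  then have "finite B" using independent_span_bound[OF assms(1) B(2)] by blast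
  then show ?thesis using B that by blast
qed

lemma (in vector_space) card_family_le_dim:
  assumes I: "finite I" and ind: "\<And>c i. (\<Sum>i\<in>I. c i *s b i) = 0 \<Longrightarrow> i \<in> I \<Longrightarrow> c i = 0"
    and mem: "\<And>i. i \<in> I \<Longrightarrow> b i \<in> V" and W: "finite W" "V \<subseteq> span W"
  shows "card I \<le> dim V"
proof -
  obtain B where B: "finite B" "V \<subseteq> span B" "card B = dim V"
    using finite_basis_of_finite_span[OF W] by metis
  have "\<forall>c. (\<Sum>i\<in>I. c i *s b i) = 0 \<longrightarrow> (\<forall>i\<in>I. c i = 0)" using ind by blast
  note indep = independent_family[OF I this]
  have "b ` I \<subseteq> span B" using mem B(2) by blast
  then have "card (b ` I) \<le> card B" using independent_span_bound[OF B(1) indep(2)] by blast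
  then show ?thesis using card_image[OF indep(1)] B(3) by simp
qed

lemma (in vector_space) dim_mono_finite:
  assumes "S \<subseteq> T" and W: "finite W" "T \<subseteq> span W"
  shows "dim S \<le> dim T"
proof -
  obtain B where B: "finite B" "T \<subseteq> span B" "card B = dim T"
    using finite_basis_of_finite_span[OF W] by metis
  have "S \<subseteq> span B" using assms(1) B(2) by (rule subset_trans)
  then show ?thesis using dim_le_card[OF _ B(1)] B(3) by metis
qed

lemma (in Vector_Spaces.linear) dim_eq_dim_kernel_plus_dim_image:
  assumes V: "vs1.subspace V" and W: "finite W" "V \<subseteq> vs1.span W"
  shows "vs1.dim V = vs1.dim {x \<in> V. f x = 0} + vs2.dim (f ` V)"
proof -
  let ?K = "{x \<in> V. f x = 0}"
  obtain B0 where B0: "B0 \<subseteq> ?K" "vs1.independent B0" "?K \<subseteq> vs1.span B0" "card B0 = vs1.dim ?K"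
    by (rule vs1.basis_exists)
  have "B0 \<subseteq> V" using B0(1) by blast
  from vs1.maximal_independent_subset_extend[OF this B0(2)]
  obtain B where B: "B0 \<subseteq> B" "B \<subseteq> V" "vs1.independent B" "V \<subseteq> vs1.span B" by blast
  have "B \<subseteq> vs1.span W" using B(2) W(2) by (rule subset_trans)
  then have fin: "finite B" using vs1.independent_span_bound[OF W(1) B(3)] by blast
  then have fin0: "finite B0" using B(1) by (rule finite_subset[rotated])
  let ?C = "B - B0"
  have dimV: "vs1.dim V = card B" using vs1.basis_card_eq_dim[OF B(2,4,3)] by simp
  have "vs2.dim (f ` V) = card ?C \<and> (\<exists>W. finite W \<and> f ` V \<subseteq> vs2.span W)"
  proof (rule vs2.dim_eq_card_family[where b = f])
    show "finite ?C" using fin by simp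
  next
    fix c i assume c: "(\<Sum>i\<in>?C. s2 (c i) (f i)) = 0" and i: "i \<in> ?C"
    define y where "y = (\<Sum>i\<in>?C. s1 (c i) i)"
    have "f y = 0" using c by (simp add: y_def sum scale)
    moreover have "y \<in> V" unfolding y_def
      by (rule vs1.subspace_sum[OF V], rule vs1.subspace_scale[OF V]) (use B(2) in auto)
    ultimately have "y \<in> vs1.span B0" using B0(3) by blast
    then obtain u where u: "y = (\<Sum>b\<in>B0. s1 (u b) b)" unfolding vs1.span_finite[OF fin0] by blast
    define w where "w = (\<lambda>b. if b \<in> B0 then u b else - c b)"
    have "(\<Sum>b\<in>B. s1 (w b) b) = (\<Sum>b\<in>?C. s1 (w b) b) + (\<Sum>b\<in>B0. s1 (w b) b)"
      by (rule sum.subset_diff[OF B(1) fin])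
    also have "(\<Sum>b\<in>?C. s1 (w b) b) = - y"
      unfolding y_def sum_negf[symmetric] by (rule sum.cong) (auto simp: w_def)
    also have "(\<Sum>b\<in>B0. s1 (w b) b) = y" unfolding u by (rule sum.cong) (auto simp: w_def)
    finally have "(\<Sum>b\<in>B. s1 (w b) b) = 0" by simp
    then have "w i = 0" using vs1.independentD[OF B(3) fin order_refl] i by blast
    then show "c i = 0" using i by (simp add: w_def)
  next
    fix i assume "i \<in> ?C" then show "f i \<in> f ` V" using B(2) by blast
  next
    fix v assume "v \<in> f ` V"
    then obtain x where x: "x \<in> V" "v = f x" by blast
    then have "x \<in> vs1.span B" using B(4) by blast
    then obtain u where u: "x = (\<Sum>b\<in>B. s1 (u b) b)" unfolding vs1.span_finite[OF fin] by blast
    have "f x = (\<Sum>b\<in>B. s2 (u b) (f b))" unfolding u by (simp add: sum scale)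
    also have "\<dots> = (\<Sum>b\<in>?C. s2 (u b) (f b))"
      by (rule sum.mono_neutral_right[OF fin]) (use B0(1) in auto)
    finally show "\<exists>c. v = (\<Sum>i\<in>?C. s2 (c i) (f i))" using x(2) by blast
  qed
  moreover have "card B = card B0 + card ?C"
    using B(1) fin fin0 by (simp add: card_Diff_subset card_mono)
  ultimately show ?thesis using dimV B0(4) by simp
qed

definition componentwise_smult :: "'a :: field \<Rightarrow> (nat \<Rightarrow> 'a poly) \<Rightarrow> nat \<Rightarrow> 'a poly" where
  "componentwise_smult c \<phi> = (\<lambda>i. Polynomial.smult c (\<phi> i))"

interpretation fv: vector_space "componentwise_smult :: 'a :: field \<Rightarrow> _"
  by standard (auto simp: componentwise_smult_def fun_eq_iff smult_add_right smult_add_left)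

interpretation pv: vector_space "Polynomial.smult :: 'a :: field \<Rightarrow> _"
  by standard (auto simp: smult_add_right smult_add_left)

lemma sum_fun_apply: "(\<Sum>x\<in>S. h x) i = (\<Sum>x\<in>S. h x i)" for h :: "'c \<Rightarrow> nat \<Rightarrow> 'b :: comm_monoid_add"
  by (induction S rule: infinite_finite_induct) auto

text \<open>
  The null vectors are extended by zero to functions on \<open>nat\<close>, because these form a type with a
  vector space structure, whereas vectors of different dimensions cannot be added.
\<close>

definition null_space :: "'a :: field poly mat \<Rightarrow> nat \<Rightarrow> (nat \<Rightarrow> 'a poly) set" where
  "null_space H k = {\<phi>. (\<forall>i\<ge>dim_col H. \<phi> i = 0) \<and> vec (dim_col H) \<phi> \<in> mat_kernel H \<and>
     (\<forall>i j. k \<le> j \<longrightarrow> coeff (\<phi> i) j = 0)}"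

lemma poly_eq_sum_monom:
  assumes "\<And>j. k \<le> j \<Longrightarrow> coeff p j = 0"
  shows "p = (\<Sum>j<k. monom (coeff p j) j)"
proof (rule poly_eqI)
  fix l
  show "coeff p l = coeff (\<Sum>j<k. monom (coeff p j) j) l"
    using assms[of l] by (auto simp: coeff_sum)
qed

lemma coeff_sum_monom: "l < k \<Longrightarrow> coeff (\<Sum>j<k. monom (c j) j) l = c l"
  by (simp add: coeff_sum)

text \<open>
  A basis is given by the multiples \<open>s ^ j x\<close> of the minimal basis vectors \<open>x\<close> that stay below
  degree \<open>k\<close>.
\<close>

lemma null_space_dim:
  fixes H :: "'a :: alg_closed_field poly mat"
  assumes X: "minimal_null_basis H X"
  shows "fv.dim (null_space H k) = (\<Sum>x\<in>X. k - vec_degree x)"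
    and "\<exists>W. finite W \<and> null_space H k \<subseteq> fv.span W"
proof -
  let ?n = "dim_col H"
  define I where "I = (SIGMA x:X. {..<k - vec_degree x})"
  define b where "b = (\<lambda>(x, j) i. if i < ?n then monom 1 j * x $ i else (0 :: 'a poly))"
  have fin: "finite X" and sub: "X \<subseteq> mat_kernel H" by (rule minimal_basisD[OF X])+
  have I: "finite I" using fin by (simp add: I_def)
  have H: "H \<in> carrier_mat (dim_row H) ?n" by simp
  have dimx: "x \<in> carrier_vec ?n" if "x \<in> X" for x
    using that sub by (auto simp: mat_kernel_def)
  have sumI: "(\<Sum>p\<in>I. componentwise_smult (c p) (b p)) i = (\<Sum>x\<in>X. (\<Sum>j<k - vec_degree x. monom (c (x, j)) j) * x $ i)"
    if "i < ?n" for c i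
  proof -
    have "(\<Sum>p\<in>I. componentwise_smult (c p) (b p)) i = (\<Sum>x\<in>X. \<Sum>j<k - vec_degree x. componentwise_smult (c (x, j)) (b (x, j)) i)"
      unfolding I_def sum_fun_apply by (subst sum.Sigma) (use fin in \<open>auto simp: case_prod_beta\<close>)
    also have "\<dots> = (\<Sum>x\<in>X. (\<Sum>j<k - vec_degree x. monom (c (x, j)) j) * x $ i)"
      using that by (simp add: componentwise_smult_def b_def sum_distrib_right smult_monom mult_smult_left[symmetric] del: mult_smult_left)
    finally show ?thesis .
  qed
  have main: "fv.dim (null_space H k) = card I \<and> (\<exists>W. finite W \<and> null_space H k \<subseteq> fv.span W)"
  proof (rule fv.dim_eq_card_family[OF I, where b = b])
    fix c p assume c: "(\<Sum>p\<in>I. componentwise_smult (c p) (b p)) = 0" and "p \<in> I"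
    then obtain x j where p: "p = (x, j)" "x \<in> X" "j < k - vec_degree x" by (auto simp: I_def)
    have "(\<Sum>x\<in>X. (\<Sum>j<k - vec_degree x. monom (c (x, j)) j) * x $ i) = 0" if "i < ?n" for i
      using sumI[OF that, of c] c by simp
    then have "(\<Sum>j<k - vec_degree x. monom (c (x, j)) j) = 0"
      by (rule lin_indepD[OF minimal_basisD(4)[OF X] _ p(2)])
    then show "c p = 0" using coeff_sum_monom[OF p(3), of "\<lambda>j. c (x, j)"] p(1) by simp
  next
    fix p assume "p \<in> I"
    then obtain x j where p: "p = (x, j)" "x \<in> X" "j < k - vec_degree x" by (auto simp: I_def)
    have "vec ?n (b p) = monom 1 j \<cdot>\<^sub>v x"
      by (rule eq_vecI) (use dimx[OF p(2)] in \<open>auto simp: b_def p(1)\<close>)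
    then have "vec ?n (b p) \<in> mat_kernel H" using mat_kernel_smult[OF H] sub p(2) by auto
    moreover have "coeff (b p i) l = 0" if "k \<le> l" for i l
    proof (cases "i < ?n")
      case True
      then have "degree (x $ i) \<le> vec_degree x" using degree_le_vec_degree[of i x] dimx[OF p(2)] by simp
      then have "coeff (x $ i) (l - j) = 0" using that p(3) by (intro coeff_eq_0) linarith
      then show ?thesis using True by (simp add: b_def p(1) coeff_monom_mult)
    qed (simp add: b_def p(1))
    ultimately show "b p \<in> null_space H k" by (auto simp: null_space_def b_def p(1))
  next
    fix \<phi> assume \<phi>: "\<phi> \<in> null_space H k"
    then have "vec ?n \<phi> \<in> mat_kernel H" by (simp add: null_space_def)
    then obtain a where a: "\<And>i. i < ?n \<Longrightarrow> vec ?n \<phi> $ i = (\<Sum>x\<in>X. a x * x $ i)"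
      using minimal_basis_generates[OF X] by blast
    have deg: "degree (a x) + vec_degree x < k" if "x \<in> X" "a x \<noteq> 0" for x
      by (rule minimal_basis_predictable_degree[OF X a _ that]) (use \<phi> in \<open>auto simp: null_space_def\<close>)
    have mon: "(\<Sum>j<k - vec_degree x. monom (coeff (a x) j) j) = a x" if x: "x \<in> X" for x
    proof (rule poly_eq_sum_monom[symmetric])
      fix j assume j: "k - vec_degree x \<le> j"
      show "coeff (a x) j = 0"
      proof (cases "a x = 0")
        case False
        then show ?thesis using deg[OF x] j by (intro coeff_eq_0) linarith
      qed simp
    qed
    have "\<phi> = (\<Sum>p\<in>I. componentwise_smult ((\<lambda>(x, j). coeff (a x) j) p) (b p))"
    proof
      fix i
      show "\<phi> i = (\<Sum>p\<in>I. componentwise_smult ((\<lambda>(x, j). coeff (a x) j) p) (b p)) i"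
      proof (cases "i < ?n")
        case True
        then show ?thesis unfolding sumI[OF True] using a[OF True] by (simp add: mon cong: sum.cong_simp)
      next
        case False
        then have "(\<Sum>p\<in>I. componentwise_smult ((\<lambda>(x, j). coeff (a x) j) p) (b p)) i = 0"
          unfolding sum_fun_apply by (intro sum.neutral) (auto simp: componentwise_smult_def b_def)
        then show ?thesis using \<phi> False by (simp add: null_space_def)
      qed
    qed
    then show "\<exists>c. \<phi> = (\<Sum>p\<in>I. componentwise_smult (c p) (b p))" by blast
  qed
  show "fv.dim (null_space H k) = (\<Sum>x\<in>X. k - vec_degree x)"
    using main by (simp add: I_def card_SigmaI fin)
  show "\<exists>W. finite W \<and> null_space H k \<subseteq> fv.span W" using main by blast
qed

lemma conjugate_col_min_indices:
  assumes X: "X = (SOME X. minimal_null_basis H X)" "finite X"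
  shows "conjugate {..<length (col_min_indices H)} ((!) (col_min_indices H)) k = card {x \<in> X. k \<le> vec_degree x}"
proof -
  let ?c = "col_min_indices H"
  have ms: "mset ?c = image_mset vec_degree (mset_set X)"
    by (simp add: col_min_indices_def X(1)[symmetric])
  have "conjugate {..<length ?c} ((!) ?c) k = length (filter (\<lambda>d. k \<le> d) ?c)"
    unfolding conjugate_def length_filter_conv_card by (rule arg_cong[of _ _ card]) auto
  also have "\<dots> = size (filter_mset (\<lambda>d. k \<le> d) (mset ?c))" by (metis mset_filter size_mset)
  also have "\<dots> = card {x \<in> X. k \<le> vec_degree x}"
    unfolding ms filter_mset_image_mset by (simp add: o_def X(2) filter_mset_mset_set)
  finally show ?thesis .
qed

lemma col_brunovsky_eq:
  fixes H :: "'a :: field poly mat"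
  shows "\<exists>X. minimal_null_basis H X \<and> (\<forall>k. col_brunovsky H k = card {x \<in> X. k \<le> vec_degree x})"
proof -
  define X where "X = (SOME X. minimal_null_basis H X)"
  have X: "minimal_null_basis H X" unfolding X_def by (rule someI_ex) (rule minimal_null_basis_exists)
  have fin: "finite X" by (rule minimal_basisD(2)[OF X])
  have H: "H \<in> carrier_mat (dim_row H) (dim_col H)" by simp
  have "col_brunovsky H k = card {x \<in> X. k \<le> vec_degree x}" for k
    using conjugate_col_min_indices[OF X_def fin] card_quasi_basis[OF H minimal_basisD(1)[OF X]]
    by (cases "k = 0") (auto simp: col_brunovsky_def)
  then show ?thesis using X by blast
qed

lemma is_partition_col_brunovsky: "is_partition (col_brunovsky H)"
proof -
  obtain X where X: "minimal_null_basis H X" and r: "\<And>k. col_brunovsky H k = card {x \<in> X. k \<le> vec_degree x}"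
    using col_brunovsky_eq[of H] by blast
  have fin: "finite X" by (rule minimal_basisD(2)[OF X])
  show ?thesis unfolding is_partition_def r
  proof (intro conjI allI)
    fix k show "card {x \<in> X. Suc k \<le> vec_degree x} \<le> card {x \<in> X. k \<le> vec_degree x}"
      by (rule card_mono) (use fin in auto)
  next
    have "{x \<in> X. k \<le> vec_degree x} = {}" if k: "Suc (sum vec_degree X) \<le> k" for k
    proof -
      have "vec_degree x < k" if "x \<in> X" for x using member_le_sum[of x X vec_degree] fin that k by simp
      then show ?thesis by (auto simp: not_le)
    qed
    then show "\<exists>N. \<forall>k\<ge>N. card {x \<in> X. k \<le> vec_degree x} = 0" by (metis card.empty)
  qed
qed

text \<open>
  Double counting: \<open>k - vec_degree x\<close> is the number of \<open>j < k\<close> with \<open>vec_degree x \<le> j\<close>.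
\<close>

lemma dim_null_space:
  fixes H :: "'a :: alg_closed_field poly mat"
  shows "int (fv.dim (null_space H k)) = (\<Sum>j<k. int (col_brunovsky H 0) - int (col_brunovsky H (Suc j)))"
proof -
  obtain X where X: "minimal_null_basis H X" and r: "\<And>k. col_brunovsky H k = card {x \<in> X. k \<le> vec_degree x}"
    using col_brunovsky_eq[of H] by blast
  have fin: "finite X" by (rule minimal_basisD(2)[OF X])
  have diff: "int (card {x \<in> X. vec_degree x \<le> j}) = int (col_brunovsky H 0) - int (col_brunovsky H (Suc j))" for j
  proof -
    have "card {x \<in> X. vec_degree x \<le> j} + card {x \<in> X. Suc j \<le> vec_degree x}
        = card ({x \<in> X. vec_degree x \<le> j} \<union> {x \<in> X. Suc j \<le> vec_degree x})"
      by (rule card_Un_disjoint[symmetric]) (use fin in auto)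
    also have "{x \<in> X. vec_degree x \<le> j} \<union> {x \<in> X. Suc j \<le> vec_degree x} = X" by auto
    finally show ?thesis unfolding r by simp
  qed
  have "(\<Sum>x\<in>X. k - vec_degree x) = (\<Sum>x\<in>X. card {j \<in> {..<k}. vec_degree x \<le> j})"
  proof (rule sum.cong[OF refl])
    fix x
    have "{j \<in> {..<k}. vec_degree x \<le> j} = {vec_degree x..<k}" by auto
    then show "k - vec_degree x = card {j \<in> {..<k}. vec_degree x \<le> j}" by simp
  qed
  also have "\<dots> = (\<Sum>j<k. card {x \<in> X. vec_degree x \<le> j})"
    by (rule sum_multicount_gen) (use fin in auto)
  finally show ?thesis unfolding null_space_dim(1)[OF X] by (simp add: diff)
qed

text \<open>
  \<open>E k\<close> is the dimension of the image of the null vectors of degree below \<open>k\<close> under the additional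
  row. If some null vector \<open>\<phi>\<close> is not mapped to zero, then the multiples of \<open>\<phi>\<close> by powers of \<open>s\<close>
  have independent images, so \<open>E\<close> is unbounded.
\<close>

lemma one_step_col_brunovsky:
  fixes H G :: "'a :: alg_closed_field poly mat"
  assumes H: "H \<in> carrier_mat m n" and G: "G \<in> carrier_mat m' n"
    and ker: "\<And>x. x \<in> mat_kernel G \<longleftrightarrow> x \<in> mat_kernel H \<and> (\<Sum>i<n. F i * x $ i) = 0"
    and F: "\<And>i. i < n \<Longrightarrow> degree (F i) \<le> d"
  shows "col_brunovsky G = col_brunovsky H \<or> one_step d (col_brunovsky H) (col_brunovsky G)"
proof -
  define f where "f = (\<lambda>\<phi> :: nat \<Rightarrow> 'a poly. \<Sum>i<n. F i * \<phi> i)"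
  define E where "E = (\<lambda>k. pv.dim (f ` null_space H k))"
  interpret f: Vector_Spaces.linear componentwise_smult Polynomial.smult f
    by standard (auto simp: f_def componentwise_smult_def distrib_left sum.distrib smult_sum2)
  obtain X where X: "minimal_null_basis H X" using minimal_null_basis_exists by blast
  have sub: "fv.subspace (null_space H k)" for k
  proof (rule fv.subspaceI)
    show "0 \<in> null_space H k" using H by (auto simp: null_space_def mem_mat_kernel_iff[OF H])
    show "\<phi> + \<psi> \<in> null_space H k" if "\<phi> \<in> null_space H k" "\<psi> \<in> null_space H k" for \<phi> \<psi>
      using that H by (auto simp: null_space_def mem_mat_kernel_iff[OF H] distrib_left sum.distrib)
    show "componentwise_smult c \<phi> \<in> null_space H k" if "\<phi> \<in> null_space H k" for c \<phi>
      using that H by (auto simp: null_space_def mem_mat_kernel_iff[OF H] componentwise_smult_def smult_sum2[symmetric])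
  qed
  have K: "{\<phi> \<in> null_space H k. f \<phi> = 0} = null_space G k" for k
    using H G ker by (auto simp: null_space_def f_def)
  have dims: "fv.dim (null_space H k) = fv.dim (null_space G k) + E k" for k
  proof -
    obtain W where "finite W" "null_space H k \<subseteq> fv.span W" using null_space_dim(2)[OF X] by blast
    then show ?thesis using f.dim_eq_dim_kernel_plus_dim_image[OF sub] unfolding K E_def by blast
  qed
  have coeff_f: "coeff (f \<phi>) l = 0" if \<phi>: "\<phi> \<in> null_space H k" and l: "k + d \<le> l" for \<phi> k l
  proof -
    have "coeff (F i * \<phi> i) l = 0" if i: "i < n" for i
    proof (cases "\<phi> i = 0")
      case False
      have "degree (\<phi> i) < k" using \<phi> False by (simp add: null_space_def) (metis leading_coeff_0_iff not_le)
      then have "degree (F i * \<phi> i) < l" using degree_mult_le[of "F i" "\<phi> i"] F[OF i] l by linarith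
      then show ?thesis by (rule coeff_eq_0)
    qed simp
    then show ?thesis by (simp add: f_def coeff_sum)
  qed
  have img: "f ` null_space H k \<subseteq> pv.span ((\<lambda>j. monom 1 j) ` {..<k + d})" for k
  proof
    fix q assume "q \<in> f ` null_space H k"
    then have "q = (\<Sum>j<k + d. monom (coeff q j) j)" by (intro poly_eq_sum_monom) (auto intro: coeff_f)
    also have "\<dots> = (\<Sum>j<k + d. Polynomial.smult (coeff q j) (monom 1 j))" by (simp add: smult_monom)
    also have "\<dots> \<in> pv.span ((\<lambda>j. monom 1 j) ` {..<k + d})"
      by (intro pv.span_sum pv.span_scale pv.span_base) auto
    finally show "q \<in> pv.span ((\<lambda>j. monom 1 j) ` {..<k + d})" .
  qed
  have finm: "finite ((\<lambda>j. monom (1 :: 'a) j) ` {..<k + d})" for k by simp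
  show ?thesis
  proof (rule one_stepI[OF is_partition_col_brunovsky is_partition_col_brunovsky, where E = E])
    fix K
    have "int (E K) = int (fv.dim (null_space H K)) - int (fv.dim (null_space G K))" using dims[of K] by simp
    then show "int (E K) = (\<Sum>j<K. (int (col_brunovsky H 0) - int (col_brunovsky H (Suc j))) -
        (int (col_brunovsky G 0) - int (col_brunovsky G (Suc j))))"
      unfolding dim_null_space by (simp add: sum_subtractf)
    have "null_space H K \<subseteq> null_space H (Suc K)" by (auto simp: null_space_def)
    then show "E K \<le> E (Suc K)" unfolding E_def by (intro pv.dim_mono_finite[OF _ finm img] image_mono)
    have "E K \<le> card ((\<lambda>j. monom (1 :: 'a) j) ` {..<K + d})" unfolding E_def by (rule pv.dim_le_card[OF img finm])
    also have "\<dots> \<le> K + d" using card_image_le[of "{..<K + d}"] by simp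
    finally show "E K \<le> K + d" .
  next
    show "(\<forall>K. E K = 0) \<or> (\<forall>B. \<exists>K. B < E K)"
    proof (cases "\<forall>K. \<forall>\<phi> \<in> null_space H K. f \<phi> = 0")
      case True
      have "E K = 0" for K
      proof -
        have "f ` null_space H K \<subseteq> pv.span {}" using True by auto
        then have "E K \<le> card ({} :: 'a poly set)" unfolding E_def by (intro pv.dim_le_card) auto
        then show ?thesis by simp
      qed
      then show ?thesis by blast
    next
      case False
      then obtain L \<phi> where \<phi>: "\<phi> \<in> null_space H L" "f \<phi> \<noteq> 0" by blast
      have "\<exists>K. B < E K" for B
      proof
        have "card {..B} \<le> E (L + B)"
          unfolding E_def
        proof (rule pv.card_family_le_dim[where b = "\<lambda>j. monom 1 j * f \<phi>", OF _ _ _ finm img])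
          fix c :: "nat \<Rightarrow> 'a" and i assume c: "(\<Sum>j\<le>B. Polynomial.smult (c j) (monom 1 j * f \<phi>)) = 0" and i: "i \<in> {..B}"
          have "(\<Sum>j\<le>B. Polynomial.smult (c j) (monom 1 j * f \<phi>)) = (\<Sum>j<Suc B. monom (c j) j) * f \<phi>"
            unfolding sum_distrib_right lessThan_Suc_atMost
            by (simp add: smult_monom mult_smult_left[symmetric] del: mult_smult_left)
          then have "(\<Sum>j<Suc B. monom (c j) j) = 0" using c \<phi>(2) by simp
          then show "c i = 0" using coeff_sum_monom[of i "Suc B" c] i by (simp del: sum.lessThan_Suc)
        next
          fix j assume j: "j \<in> {..B}"
          have "vec n (\<lambda>i. monom 1 j * \<phi> i) \<in> mat_kernel H"
          proof -
            have "vec n (\<lambda>i. monom 1 j * \<phi> i) = monom 1 j \<cdot>\<^sub>v vec n \<phi>" by (rule eq_vecI) auto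
            then show ?thesis using mat_kernel_smult[OF H, of "vec n \<phi>"] \<phi>(1) H by (simp add: null_space_def)
          qed
          then have "(\<lambda>i. monom 1 j * \<phi> i) \<in> null_space H (L + B)"
            using \<phi>(1) H j by (auto simp: null_space_def coeff_monom_mult)
          moreover have "f (\<lambda>i. monom 1 j * \<phi> i) = monom 1 j * f \<phi>"
            by (simp add: f_def sum_distrib_left mult.left_commute)
          ultimately show "monom 1 j * f \<phi> \<in> f ` null_space H (L + B)" by (metis imageI)
        qed simp
        then show "B < E (L + B)" by simp
      qed
      then show ?thesis by blast
    qed
  qed
qed

section \<open>Rank-one perturbations\<close>

lemma normal_rank_transpose:
  assumes A: "A \<in> carrier_mat m n"
  shows "normal_rank (transpose_mat A) = normal_rank A"
proof -
  have A': "transpose_mat A \<in> carrier_mat n m" using A by simp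
  have det: "det (select (transpose_mat A) k f g) = det (select A k g f)"
    if "\<forall>a<k. f a < n" "\<forall>a<k. g a < m" for k f g
  proof -
    have "select (transpose_mat A) k f g = transpose_mat (select A k g f)"
      by (rule eq_matI) (use that A in \<open>auto simp: select_def\<close>)
    then show ?thesis by (simp add: det_transpose[OF select_carrier])
  qed
  have "divides_minors 0 k (transpose_mat A) \<longleftrightarrow> divides_minors 0 k A" for k
  proof
    assume *: "divides_minors 0 k (transpose_mat A)"
    show "divides_minors 0 k A" unfolding divides_minors_iff[OF A]
    proof (intro allI impI)
      fix f g :: "nat \<Rightarrow> nat" assume fg: "\<forall>a<k. f a < m" "\<forall>a<k. g a < n"
      then have "0 dvd det (select (transpose_mat A) k g f)" using * unfolding divides_minors_iff[OF A'] by blast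
      then show "0 dvd det (select A k f g)" unfolding det[OF fg(2,1)] .
    qed
  next
    assume *: "divides_minors 0 k A"
    show "divides_minors 0 k (transpose_mat A)" unfolding divides_minors_iff[OF A']
    proof (intro allI impI)
      fix f g :: "nat \<Rightarrow> nat" assume fg: "\<forall>a<k. f a < n" "\<forall>a<k. g a < m"
      then have "0 dvd det (select A k g f)" using * unfolding divides_minors_iff[OF A] by blast
      then show "0 dvd det (select (transpose_mat A) k f g)" unfolding det[OF fg] .
    qed
  qed
  then have less: "normal_rank (transpose_mat A) < k \<longleftrightarrow> normal_rank A < k" for k
    by (simp add: normal_rank_less_iff[OF A] normal_rank_less_iff[OF A'])
  from less[of "normal_rank A"] less[of "normal_rank (transpose_mat A)"] show ?thesis by simp
qed

lemma row_brunovsky_eq: "row_brunovsky H = col_brunovsky (transpose_mat H)"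
proof
  fix i
  have "H \<in> carrier_mat (dim_row H) (dim_col H)" by simp
  from normal_rank_transpose[OF this] show "row_brunovsky H i = col_brunovsky (transpose_mat H) i"
    by (simp add: row_brunovsky_def col_brunovsky_def row_min_indices_def)
qed

text \<open>
  On the kernel of the row \<open>F\<close> the two matrices agree, so appending \<open>F\<close> to either of them gives a
  matrix with the same null space.
\<close>

lemma common_one_step:
  fixes H H' :: "'a :: alg_closed_field poly mat"
  assumes H: "H \<in> carrier_mat m n" and H': "H' \<in> carrier_mat m n"
    and eq: "\<And>a b. a < m \<Longrightarrow> b < n \<Longrightarrow> H' $$ (a, b) = H $$ (a, b) + h a * F b"
    and F: "\<And>i. i < n \<Longrightarrow> degree (F i) \<le> d"
  obtains g where "is_partition g"
    "g = col_brunovsky H \<or> one_step d (col_brunovsky H) g"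
    "g = col_brunovsky H' \<or> one_step d (col_brunovsky H') g"
proof -
  define G where "G = mat (Suc m) n (\<lambda>(i, j). if i < m then H $$ (i, j) else F j)"
  have G: "G \<in> carrier_mat (Suc m) n" by (simp add: G_def)
  have ker: "x \<in> mat_kernel G \<longleftrightarrow> x \<in> mat_kernel H \<and> (\<Sum>i<n. F i * x $ i) = 0" for x
  proof -
    have "(\<Sum>j<n. G $$ (a, j) * x $ j) = (\<Sum>j<n. H $$ (a, j) * x $ j)" if "a < m" for a
      by (rule sum.cong) (use that in \<open>auto simp: G_def\<close>)
    moreover have "(\<Sum>j<n. G $$ (m, j) * x $ j) = (\<Sum>j<n. F j * x $ j)"
      by (rule sum.cong) (auto simp: G_def)
    ultimately show ?thesis
      unfolding mem_mat_kernel_iff[OF G] mem_mat_kernel_iff[OF H] by (auto simp: less_Suc_eq)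
  qed
  have ker': "x \<in> mat_kernel G \<longleftrightarrow> x \<in> mat_kernel H' \<and> (\<Sum>i<n. F i * x $ i) = 0" for x
  proof -
    have "(\<Sum>j<n. H' $$ (a, j) * x $ j) = (\<Sum>j<n. H $$ (a, j) * x $ j) + h a * (\<Sum>j<n. F j * x $ j)"
      if "a < m" for a
    proof -
      have "(\<Sum>j<n. H' $$ (a, j) * x $ j) = (\<Sum>j<n. H $$ (a, j) * x $ j + h a * (F j * x $ j))"
        by (rule sum.cong) (use eq that in \<open>auto simp: algebra_simps\<close>)
      then show ?thesis by (simp add: sum.distrib sum_distrib_left)
    qed
    then show ?thesis unfolding ker mem_mat_kernel_iff[OF H] mem_mat_kernel_iff[OF H'] by auto
  qed
  show ?thesis
    using that[OF is_partition_col_brunovsky one_step_col_brunovsky[OF H G ker F] one_step_col_brunovsky[OF H' G ker' F]]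
    by blast
qed

theorem corollary3p5:
  fixes H P u :: "'a :: alg_closed_field poly mat"
    and v :: "'a mat"
    and m n :: nat
    and w w' :: "'a ext \<Rightarrow> nat \<Rightarrow> nat"
    and r r' s s' :: "nat \<Rightarrow> nat"
  assumes "matrix_pencil m n H"
    and "matrix_pencil m n P"
    and "u \<in> carrier_mat m 1"
    and "v \<in> carrier_mat n 1"
    and "P = u * transpose_mat (map_mat (\<lambda>c. [:c:]) v)"
    and "weyr_characteristic H = (w, r, s)"
    and "weyr_characteristic (H + P) = (w', r', s')"
  shows
    "(normal_rank H = normal_rank (H + P) \<longrightarrow>
        (\<forall>i\<ge>1. \<forall>\<mu>. int (w' \<mu> i) - int (w \<mu> i) \<in> {- 1..1}) \<and>
        ((\<forall>i\<ge>1. r i = 0) \<longrightarrow>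
          (\<forall>i. int (r' i) - int (r i) \<in> {0..1})) \<and>
        (\<not> (\<forall>i\<ge>1. r i = 0) \<longrightarrow>
          (\<forall>i. int (r' i) - int (r i) \<in> {- \<lfloor>sqrt (real (part_sum 0 r))\<rfloor>..\<lfloor>sqrt (real (part_sum 0 r))\<rfloor>})) \<and>
        ((\<forall>i\<ge>1. s i = 0) \<longrightarrow>
          (\<forall>i. int (s' i) - int (s i) \<in> {0..2})) \<and>
        (\<not> (\<forall>i\<ge>1. s i = 0) \<longrightarrow>
          (\<forall>i. int (s' i) - int (s i) \<in> {- \<lfloor>sqrt (real (part_sum 1 s))\<rfloor> - 1..\<lfloor>sqrt (real (part_sum 1 s) - 1)\<rfloor> + 2}))) \<and>
     (int (normal_rank (H + P)) = int (normal_rank H) - 1 \<longrightarrow>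
        (\<forall>i\<ge>1. \<forall>\<mu>. int (w' \<mu> i) - int (w \<mu> i) \<in> {- 2..0}) \<and>
        (\<forall>i. int (r' i) - int (r i) \<in> {1 - \<lfloor>sqrt (real (part_sum 0 r) + 1)\<rfloor>..1}) \<and>
        (\<forall>i. int (s' i) - int (s i) \<in> {- \<lfloor>sqrt (real (part_sum 1 s))\<rfloor>..1})) \<and>
     (normal_rank (H + P) = normal_rank H + 1 \<longrightarrow>
        (\<forall>i\<ge>1. \<forall>\<mu>. int (w' \<mu> i) - int (w \<mu> i) \<in> {0..2}) \<and>
        (\<forall>i. int (r' i) - int (r i) \<in> {- 1..- 1 + \<lfloor>sqrt (real (part_sum 0 r))\<rfloor>}) \<and>
        (\<forall>i. int (s' i) - int (s i) \<in> {- 1..\<lfloor>sqrt (real (part_sum 1 s) + 1)\<rfloor>}))"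
proof -
  have H: "H \<in> carrier_mat m n" and P: "P \<in> carrier_mat m n"
    using assms(1,2) by (auto simp: matrix_pencil_def)
  have pencil': "matrix_pencil m n (H + P)"
    using assms(1,2) by (auto simp: matrix_pencil_def intro!: degree_add_le)
  have H': "H + P \<in> carrier_mat m n" using P by simp
  define y where "y = (\<lambda>b. v $$ (b, 0))"
  \<comment> \<open>If \<open>v = 0\<close>, the degree of \<open>u\<close> is arbitrary; then \<open>u\<close> may be replaced by zero.\<close>
  define x where "x = (\<lambda>a. if \<exists>b<n. y b \<noteq> 0 then u $$ (a, 0) else 0)"
  have Pxy: "P $$ (a, b) = x a * [:y b:]" if "a < m" "b < n" for a b
    using assms(3,4) that by (auto simp: assms(5) x_def y_def scalar_prod_def)
  have degx: "degree (x a) \<le> 1" if a: "a < m" for a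
  proof (cases "\<exists>b<n. y b \<noteq> 0")
    case True
    then obtain b where b: "b < n" "y b \<noteq> 0" by blast
    have "P $$ (a, b) = Polynomial.smult (y b) (x a)" using Pxy[OF a b(1)] by simp
    then have "degree (P $$ (a, b)) = degree (x a)" using b(2) by simp
    moreover have "degree (P $$ (a, b)) \<le> 1" using assms(2) a b(1) unfolding matrix_pencil_def by blast
    ultimately show ?thesis by simp
  qed (auto simp: x_def)
  have eq: "(H + P) $$ (a, b) = H $$ (a, b) + x a * [:y b:]" if "a < m" "b < n" for a b
    using that P Pxy by simp
  have wr: "w = weyr H" "w' = weyr (H + P)"
    and r: "r = col_brunovsky H" "r' = col_brunovsky (H + P)"
    and s: "s = col_brunovsky (transpose_mat H)" "s' = col_brunovsky (transpose_mat (H + P))"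
    using assms(6,7) by (simp_all add: weyr_characteristic_def row_brunovsky_eq)
  have W: "int (w \<mu> i) - int (normal_rank H) \<le> int (w' \<mu> i) - int (normal_rank (H + P)) + 1"
    "int (w' \<mu> i) - int (normal_rank (H + P)) \<le> int (w \<mu> i) - int (normal_rank H) + 1" if "i \<ge> 1" for \<mu> i
    unfolding wr
  proof -
    show "int (weyr H \<mu> i) - int (normal_rank H) \<le> int (weyr (H + P) \<mu> i) - int (normal_rank (H + P)) + 1"
      by (rule weyr_rank_one_update[OF assms(1) pencil' that eq])
    show "int (weyr (H + P) \<mu> i) - int (normal_rank (H + P)) \<le> int (weyr H \<mu> i) - int (normal_rank H) + 1"
      by (rule weyr_rank_one_update[OF pencil' assms(1) that, of "\<lambda>a. - x a" y]) (use eq in auto)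
  qed
  obtain g where g: "is_partition g" "g = r \<or> one_step 0 r g" "g = r' \<or> one_step 0 r' g"
    using common_one_step[OF H H' eq, of 0] unfolding r by auto
  have Ht: "transpose_mat H \<in> carrier_mat n m" "transpose_mat (H + P) \<in> carrier_mat n m" using H H' by auto
  have eqt: "transpose_mat (H + P) $$ (b, a) = transpose_mat H $$ (b, a) + [:y b:] * x a"
    if "b < n" "a < m" for b a
    using eq[OF that(2,1)] that H P by simp
  obtain h where h: "is_partition h" "h = s \<or> one_step 1 s h" "h = s' \<or> one_step 1 s' h"
    using common_one_step[OF Ht eqt degx] unfolding s by auto
  have parts: "is_partition r" "is_partition r'" "is_partition s" "is_partition s'"
    by (simp_all add: r s is_partition_col_brunovsky)
  have 0: "int (r 0) = int n - int (normal_rank H)" "int (r' 0) = int n - int (normal_rank (H + P))"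
    "int (s 0) = int m - int (normal_rank H)" "int (s' 0) = int m - int (normal_rank (H + P))"
    using H P normal_rank_le_dims[OF H] normal_rank_le_dims[OF H']
    by (simp_all add: r s col_brunovsky_def normal_rank_transpose[OF H] normal_rank_transpose[OF H'] of_nat_diff)
  have step0: "int (b 0) = int (a 0) - 1" if "one_step d a b" for d a b
    using that unfolding one_step_def by linarith
  show ?thesis
  proof (intro conjI impI)
    assume eqr: "normal_rank H = normal_rank (H + P)"
    show "\<forall>i\<ge>1. \<forall>\<mu>. int (w' \<mu> i) - int (w \<mu> i) \<in> {- 1..1}"
    proof (intro allI impI)
      fix i \<mu> assume "1 \<le> (i :: nat)"
      from W[OF this, of \<mu>] eqr show "int (w' \<mu> i) - int (w \<mu> i) \<in> {- 1..1}" by simp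
    qed
    have R: "r' = r \<or> one_step 0 r g \<and> one_step 0 r' g"
      using g(2,3) step0[of 0 r g] step0[of 0 r' g] 0 eqr by auto
    have S: "s' = s \<or> one_step 1 s h \<and> one_step 1 s' h"
      using h(2,3) step0[of 1 s h] step0[of 1 s' h] 0 eqr by auto
    show "\<forall>i. int (r' i) - int (r i) \<in> {0..1}" if z: "\<forall>i\<ge>1. r i = 0"
      using R col_bounds_equal_rank(2)[OF parts(1,2) g(1) _ _ z] by auto
    show "\<forall>i. int (r' i) - int (r i) \<in> {- \<lfloor>sqrt (real (part_sum 0 r))\<rfloor>..\<lfloor>sqrt (real (part_sum 0 r))\<rfloor>}"
    proof
      fix i
      have "\<bar>int (r' i) - int (r i)\<bar> \<le> \<lfloor>sqrt (real (part_sum 0 r))\<rfloor>"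
        using R col_bounds_equal_rank(1)[OF parts(1,2) g(1)] by auto
      then show "int (r' i) - int (r i) \<in> {- \<lfloor>sqrt (real (part_sum 0 r))\<rfloor>..\<lfloor>sqrt (real (part_sum 0 r))\<rfloor>}"
        by (simp only: atLeastAtMost_iff) linarith
    qed
    show "\<forall>i. int (s' i) - int (s i) \<in> {0..2}" if z: "\<forall>i\<ge>1. s i = 0"
      using S row_bounds_equal_rank(1)[OF parts(3,4) h(1) _ _ z] by auto
    show "\<forall>i. int (s' i) - int (s i) \<in> {- \<lfloor>sqrt (real (part_sum 1 s))\<rfloor> - 1..\<lfloor>sqrt (real (part_sum 1 s) - 1)\<rfloor> + 2}"
      if nz: "\<not> (\<forall>i\<ge>1. s i = 0)"
    proof (cases "s' = s")
      case True
      have "real (part_sum 1 s) \<ge> 1"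
        using nz part_sum_1_eq_0_iff[OF parts(3)] by (metis One_nat_def Suc_leI gr0I of_nat_1 of_nat_le_iff)
      then have "0 \<le> sqrt (real (part_sum 1 s))" "0 \<le> sqrt (real (part_sum 1 s) - 1)" by simp_all
      then have "0 \<le> \<lfloor>sqrt (real (part_sum 1 s))\<rfloor>" "0 \<le> \<lfloor>sqrt (real (part_sum 1 s) - 1)\<rfloor>"
        by (simp_all only: zero_le_floor)
      moreover have "int (s' i) - int (s i) = 0" for i using True by simp
      ultimately show ?thesis by (simp only: atLeastAtMost_iff) linarith
    next
      case False
      then show ?thesis using S row_bounds_equal_rank(2)[OF parts(3,4) h(1) _ _ nz] by blast
    qed
  next
    assume dn: "int (normal_rank (H + P)) = int (normal_rank H) - 1"
    show "\<forall>i\<ge>1. \<forall>\<mu>. int (w' \<mu> i) - int (w \<mu> i) \<in> {- 2..0}"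
    proof (intro allI impI)
      fix i \<mu> assume "1 \<le> (i :: nat)"
      from W[OF this, of \<mu>] dn show "int (w' \<mu> i) - int (w \<mu> i) \<in> {- 2..0}" by simp
    qed
    have "g = r \<and> one_step 0 r' g"
      using g(2,3) step0[of 0 r g] step0[of 0 r' g] 0 dn by auto
    then show "\<forall>i. int (r' i) - int (r i) \<in> {1 - \<lfloor>sqrt (real (part_sum 0 r) + 1)\<rfloor>..1}"
      using col_bounds_rank_down[OF parts(2,1)] by blast
    have "h = s \<and> one_step 1 s' h"
      using h(2,3) step0[of 1 s h] step0[of 1 s' h] 0 dn by auto
    then show "\<forall>i. int (s' i) - int (s i) \<in> {- \<lfloor>sqrt (real (part_sum 1 s))\<rfloor>..1}"
      using row_bounds_rank_up(2)[OF parts(4,3)] by blast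
  next
    assume up: "normal_rank (H + P) = normal_rank H + 1"
    show "\<forall>i\<ge>1. \<forall>\<mu>. int (w' \<mu> i) - int (w \<mu> i) \<in> {0..2}"
    proof (intro allI impI)
      fix i \<mu> assume "1 \<le> (i :: nat)"
      from W[OF this, of \<mu>] up show "int (w' \<mu> i) - int (w \<mu> i) \<in> {0..2}" by simp
    qed
    have "g = r' \<and> one_step 0 r g"
      using g(2,3) step0[of 0 r g] step0[of 0 r' g] 0 up by auto
    then show "\<forall>i. int (r' i) - int (r i) \<in> {- 1..- 1 + \<lfloor>sqrt (real (part_sum 0 r))\<rfloor>}"
      using col_bounds_rank_up[OF parts(1,2)] by blast
    have "h = s' \<and> one_step 1 s h"
      using h(2,3) step0[of 1 s h] step0[of 1 s' h] 0 up by auto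
    then show "\<forall>i. int (s' i) - int (s i) \<in> {- 1..\<lfloor>sqrt (real (part_sum 1 s) + 1)\<rfloor>}"
      using row_bounds_rank_up(1)[OF parts(3,4)] by blast
  qed
qed

end
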